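(* Let $f(s)=s|s|$, $s\in\mathbb{R}$. There is an absolute constant $c>0$ such that for every $1<p<\infty$, $$\| M_{f^{[2]}}: S_{2p}\times S_{2p}\to S_p\| \ge c\, p^2 p^\ast,\qquad p^\ast=\frac{p}{p-1}.$$
   Context: For $f(s)=s|s|$ (a $C^1$ function with $f'(s)=2|s|$), let $f^{[1]}(\lambda,\mu)=\frac{f(\lambda)-f(\mu)}{\lambda-\mu}$ for $\lambda\ne\mu$ and $f^{[1]}(\lambda,\lambda)=f'(\lambda)$. Then $f^{[2]}(\lambda_0,\lambda_1,\lambda_2)=\frac{f^{[1]}(\lambda_{i-1},\lambda_i)-f^{[1]}(\lambda_i,\lambda_{i+1})}{\lambda_{i-1}-\lambda_{i+1}}$, where (indices modulo $3$) $i$ is chosen such that $\lambda_{i-1}\neq\lambda_{i+1}$, and $f^{[2]}(\lambda,\lambda,\lambda)=0$ by convention. This is well defined, bounded, and invariant under permutation of the variables. Schatten classes: $S_p$ is the Schatten $p$-class of $B(L^2(\mathbb{R}))$ with norm $\|x\|_p=\mathrm{Tr}(|x|^p)^{1/p}$. $S_2$ is identified with $L^2(\mathbb{R}\times\mathbb{R})$ via kernels: $A\in L^2(\mathbb{R}^2)$ corresponds to $(A\xi)(t)=\int_{\mathbb{R}}A(t,s)\xi(s)\,ds$. Bilinear Schur multipliers: for $m\in L^\infty(\mathbb{R}^3)$, $M_m:S_2\times S_2\to S_2$ is the bounded bilinear map for which $M_m(A_1,A_2)$ has kernel $(s_0,s_2)\mapsto\int_{\mathbb{R}}m(s_0,s_1,s_2)A_1(s_0,s_1)A_2(s_1,s_2)\,ds_1$.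 The norm $\|M_m:S_{p_1}\times S_{p_2}\to S_p\|$ is the norm of the bounded bilinear extension to $S_{p_1}\times S_{p_2}\to S_p$ of the restriction of $M_m$ to $(S_2\cap S_{p_1})\times(S_2\cap S_{p_2})$ (and is $\infty$ if no such extension exists). *)

theory Defs
  imports "HOL-Analysis.Analysis" "HOL-Computational_Algebra.Polynomial"
begin

section \<open>The Hilbert space \<open>L\<^sup>2(\<real>)\<close> of complex-valued functions\<close>

definition square_integrable :: "'a measure \<Rightarrow> ('a \<Rightarrow> complex) \<Rightarrow> bool" where
  "square_integrable M f \<longleftrightarrow>
     f \<in> borel_measurable M \<and> integrable M (\<lambda>x. (cmod (f x))\<^sup>2)"

lemma square_integrable_zero: "square_integrable M (\<lambda>_. 0)"
  by (simp add: square_integrable_def)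

lemma square_integrable_cmult:
  assumes "square_integrable M f"
  shows "square_integrable M (\<lambda>x. c * f x)"
  using assms by (auto simp: square_integrable_def norm_mult power_mult_distrib)

lemma square_integrable_add:
  assumes f: "square_integrable M f" and g: "square_integrable M g"
  shows "square_integrable M (\<lambda>x. f x + g x)"
proof -
  have [measurable]: "f \<in> borel_measurable M" "g \<in> borel_measurable M"
    using f g by (auto simp: square_integrable_def)
  have le: "(cmod (a + b))\<^sup>2 \<le> 2 * ((cmod a)\<^sup>2 + (cmod b)\<^sup>2)" for a b
  proof -
    have "(cmod (a + b))\<^sup>2 \<le> (cmod a + cmod b)\<^sup>2"
      by (intro power_mono norm_triangle_ineq norm_ge_zero)
    also have "\<dots> \<le> 2 * ((cmod a)\<^sup>2 + (cmod b)\<^sup>2)"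
      using sum_squares_bound[of "cmod a" "cmod b"] by (simp add: power2_sum)
    finally show ?thesis .
  qed
  have "integrable M (\<lambda>x. 2 * ((cmod (f x))\<^sup>2 + (cmod (g x))\<^sup>2))"
    using f g by (simp add: square_integrable_def)
  then have "integrable M (\<lambda>x. (cmod (f x + g x))\<^sup>2)"
    by (rule Bochner_Integration.integrable_bound) (use le in \<open>auto intro!: AE_I2 simp: distrib_left\<close>)
  then show ?thesis by (simp add: square_integrable_def)
qed

lemma square_integrable_mult:
  assumes f: "square_integrable M f" and g: "square_integrable M g"
  shows "integrable M (\<lambda>x. cnj (f x) * g x)"
proof -
  have [measurable]: "f \<in> borel_measurable M" "g \<in> borel_measurable M"
    using f g by (auto simp: square_integrable_def)
  have [measurable]: "(\<lambda>x. cnj (f x)) \<in> borel_measurable M"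
    by (rule borel_measurable_continuous_on[OF _ \<open>f \<in> borel_measurable M\<close>])
       (intro continuous_intros)
  have le: "cmod a * cmod b \<le> (cmod a)\<^sup>2 + (cmod b)\<^sup>2" for a b
    using sum_squares_bound[of "cmod a" "cmod b"] mult_nonneg_nonneg[OF norm_ge_zero[of a] norm_ge_zero[of b]]
    unfolding mult.assoc by linarith
  have "integrable M (\<lambda>x. (cmod (f x))\<^sup>2 + (cmod (g x))\<^sup>2)"
    using f g by (simp add: square_integrable_def)
  then show ?thesis
    by (rule Bochner_Integration.integrable_bound)
       (auto intro!: AE_I2 simp: norm_mult le)
qed

definition l2_rel :: "(real \<Rightarrow> complex) \<Rightarrow> (real \<Rightarrow> complex) \<Rightarrow> bool" where
  "l2_rel f g \<longleftrightarrow> square_integrable lborel f \<and> square_integrable lborel g \<and>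
     (AE x in lborel. f x = g x)"

quotient_type l2 = "real \<Rightarrow> complex" / partial: l2_rel
proof (rule part_equivpI)
  show "\<exists>f. l2_rel f f"
    by (rule exI[of _ "\<lambda>_. 0"]) (simp add: l2_rel_def square_integrable_zero)
  show "symp l2_rel"
    by (auto simp: symp_def l2_rel_def)
  show "transp l2_rel"
    unfolding transp_def l2_rel_def by (auto elim: eventually_elim2)
qed

lift_definition cinner :: "l2 \<Rightarrow> l2 \<Rightarrow> complex"
  is "\<lambda>f g. \<integral>x. cnj (f x) * g x \<partial>lborel"
proof -
  fix f f' g g' :: "real \<Rightarrow> complex"
  assume r: "l2_rel f f'" "l2_rel g g'"
  then have "integrable lborel (\<lambda>x. cnj (f x) * g x)" "integrable lborel (\<lambda>x. cnj (f' x) * g' x)"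
    by (auto simp: l2_rel_def intro: square_integrable_mult)
  moreover have "AE x in lborel. cnj (f x) * g x = cnj (f' x) * g' x"
    using r by (auto simp: l2_rel_def elim: eventually_elim2)
  ultimately show "(\<integral>x. cnj (f x) * g x \<partial>lborel) = (\<integral>x. cnj (f' x) * g' x \<partial>lborel)"
    by (intro integral_cong_AE) auto
qed

lift_definition l2_scaleC :: "complex \<Rightarrow> l2 \<Rightarrow> l2" is "\<lambda>c f x. c * f x"
  by (auto simp: l2_rel_def square_integrable_cmult elim: eventually_mono)

instantiation l2 :: real_inner
begin

lift_definition zero_l2 :: l2 is "\<lambda>_. 0"
  by (simp add: l2_rel_def square_integrable_zero)

lift_definition plus_l2 :: "l2 \<Rightarrow> l2 \<Rightarrow> l2" is "\<lambda>f g x. f x + g x"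
  by (auto simp: l2_rel_def square_integrable_add elim: eventually_elim2)

definition uminus_l2 :: "l2 \<Rightarrow> l2" where "- x = l2_scaleC (- 1) x"

definition minus_l2 :: "l2 \<Rightarrow> l2 \<Rightarrow> l2" where "x - y = x + (- y :: l2)"

definition scaleR_l2 :: "real \<Rightarrow> l2 \<Rightarrow> l2" where "r *\<^sub>R x = l2_scaleC (of_real r) x"

definition inner_l2 :: "l2 \<Rightarrow> l2 \<Rightarrow> real" where "x \<bullet> y = Re (cinner x y)"

definition norm_l2 :: "l2 \<Rightarrow> real" where "norm x = sqrt (x \<bullet> x)" for x :: l2

definition sgn_l2 :: "l2 \<Rightarrow> l2" where "sgn x = inverse (norm x) *\<^sub>R x" for x :: l2

definition dist_l2 :: "l2 \<Rightarrow> l2 \<Rightarrow> real" where "dist x y = norm (x - y)" for x y :: l2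

definition uniformity_l2 :: "(l2 \<times> l2) filter" where
  "uniformity_l2 = (INF e\<in>{0<..}. principal {(x, y). dist x y < e})"

definition open_l2 :: "l2 set \<Rightarrow> bool" where
  "open_l2 U \<longleftrightarrow> (\<forall>x\<in>U. \<forall>\<^sub>F (x', y) in uniformity. x' = x \<longrightarrow> y \<in> U)"

instance
proof
  fix x y z :: l2 and r s :: real
  show "x + y + z = x + (y + z)"
    by transfer (simp add: l2_rel_def square_integrable_add add.assoc)
  show "x + y = y + x"
    by transfer (simp add: l2_rel_def square_integrable_add add.commute)
  show "0 + x = x"
    by transfer (simp add: l2_rel_def)
  show "- x + x = 0"
    unfolding uminus_l2_def
    by transfer (simp add: l2_rel_def square_integrable_zero)
  show "x - y = x + - y" by (rule minus_l2_def)
  show "r *\<^sub>R (x + y) = r *\<^sub>R x + r *\<^sub>R y"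
    unfolding scaleR_l2_def
    by transfer (simp add: l2_rel_def square_integrable_cmult square_integrable_add distrib_left)
  show "(r + s) *\<^sub>R x = r *\<^sub>R x + s *\<^sub>R x"
    unfolding scaleR_l2_def of_real_add
    by transfer (simp add: l2_rel_def square_integrable_cmult square_integrable_add distrib_right)
  show "r *\<^sub>R s *\<^sub>R x = (r * s) *\<^sub>R x"
    unfolding scaleR_l2_def of_real_mult
    by transfer (simp add: l2_rel_def square_integrable_cmult mult.assoc)
  show "1 *\<^sub>R x = x"
    unfolding scaleR_l2_def of_real_1 by transfer (simp add: l2_rel_def)
  show "x \<bullet> y = y \<bullet> x"
  proof -
    have "cinner x y = cnj (cinner y x)"
    proof transfer
      fix f g :: "real \<Rightarrow> complex"
      show "(\<integral>x. cnj (f x) * g x \<partial>lborel) = cnj (\<integral>x. cnj (g x) * f x \<partial>lborel)"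
        by (subst Bochner_Integration.integral_cnj [symmetric]) (simp add: mult.commute)
    qed
    then show ?thesis by (simp add: inner_l2_def)
  qed
  have "cinner (x + y) z = cinner x z + cinner y z"
    by transfer (simp add: l2_rel_def distrib_right square_integrable_mult)
  then show "(x + y) \<bullet> z = x \<bullet> z + y \<bullet> z" by (simp add: inner_l2_def)
  have "cinner (r *\<^sub>R x) y = of_real r * cinner x y"
    unfolding scaleR_l2_def by transfer (simp add: mult.assoc)
  then show "r *\<^sub>R x \<bullet> y = r * (x \<bullet> y)" by (simp add: inner_l2_def)
  have *: "x \<bullet> x = (\<integral>t. (cmod (rep_l2 x t))\<^sup>2 \<partial>lborel)"
          "square_integrable lborel (rep_l2 x)" for x
  proof -
    have r: "l2_rel (rep_l2 x) (rep_l2 x)"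
      using Quotient3_l2 by (simp add: Quotient3_rep_reflp)
    then show "square_integrable lborel (rep_l2 x)" by (simp add: l2_rel_def)
    have "cinner x x = cinner (abs_l2 (rep_l2 x)) (abs_l2 (rep_l2 x))"
      by (metis Quotient3_abs_rep Quotient3_l2)
    also have "\<dots> = (\<integral>t. cnj (rep_l2 x t) * rep_l2 x t \<partial>lborel)"
      by (rule cinner.abs_eq[OF r r])
    also have "\<dots> = (\<integral>t. complex_of_real ((cmod (rep_l2 x t))\<^sup>2) \<partial>lborel)"
      by (intro Bochner_Integration.integral_cong refl) (metis complex_norm_square mult.commute)
    also have "\<dots> = complex_of_real (\<integral>t. (cmod (rep_l2 x t))\<^sup>2 \<partial>lborel)"
      by (rule integral_complex_of_real)
    finally show "x \<bullet> x = (\<integral>t. (cmod (rep_l2 x t))\<^sup>2 \<partial>lborel)"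
      by (simp only: inner_l2_def Re_complex_of_real)
  qed
  show "0 \<le> x \<bullet> x" by (simp add: *)
  show "x \<bullet> x = 0 \<longleftrightarrow> x = 0"
  proof
    assume "x \<bullet> x = 0"
    then have "AE t in lborel. (cmod (rep_l2 x t))\<^sup>2 = 0"
      using *[of x] by (subst (asm) *)
        (simp add: square_integrable_def integral_nonneg_eq_0_iff_AE)
    then have "l2_rel (rep_l2 x) (\<lambda>_. 0)"
      using *(2)[of x] by (simp add: l2_rel_def square_integrable_zero)
    then have "abs_l2 (rep_l2 x) = abs_l2 (\<lambda>_. 0)"
      by (rule Quotient3_rel_abs [OF Quotient3_l2])
    then show "x = 0" by (metis Quotient3_abs_rep Quotient3_l2 zero_l2_def)
  next
    assume "x = 0"
    moreover have "cinner 0 0 = 0" by transfer simp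
    ultimately show "x \<bullet> x = 0" by (simp add: inner_l2_def)
  qed
  show "norm x = sqrt (x \<bullet> x)" by (rule norm_l2_def)
qed (rule sgn_l2_def dist_l2_def uniformity_l2_def open_l2_def)+

end


section \<open>Bounded operators and Schatten classes\<close>

text \<open>The members of \<open>l2 \<Rightarrow>\<^sub>L l2\<close> are only real-linear;
  \<open>B(L\<^sup>2(\<real>))\<close> consists of the complex-linear ones.\<close>

type_synonym l2op = "l2 \<Rightarrow>\<^sub>L l2"

definition bounded_ops :: "l2op set" where
  "bounded_ops = {T :: l2op. \<forall>c \<xi>. T (l2_scaleC c \<xi>) = l2_scaleC c (T \<xi>)}"

definition op_scaleC :: "complex \<Rightarrow> l2op \<Rightarrow> l2op" where
  "op_scaleC c T = Blinfun (\<lambda>\<xi>. l2_scaleC c (T \<xi>))"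

definition op_adjoint :: "l2op \<Rightarrow> l2op" where
  "op_adjoint T = (THE S :: l2op. \<forall>\<xi> \<eta>. cinner (S \<xi>) \<eta> = cinner \<xi> (T \<eta>))"

definition op_poly :: "real poly \<Rightarrow> l2op \<Rightarrow> l2op" where
  "op_poly q P = (\<Sum>i\<le>degree q. coeff q i *\<^sub>R (((o\<^sub>L) P) ^^ i) id_blinfun)"

text \<open>Continuous functional calculus of a positive operator \<open>P\<close>, whose spectrum lies in
  \<open>[0, \<parallel>P\<parallel>]\<close>: \<open>g(P)\<close> is the norm limit of \<open>q(P)\<close> for polynomials \<open>q\<close> converging to \<open>g\<close>
  uniformly on that interval.\<close>

definition op_cfc :: "(real \<Rightarrow> real) \<Rightarrow> l2op \<Rightarrow> l2op" where
  "op_cfc g P = (THE B. \<forall>\<epsilon>>0. \<exists>q. (\<forall>t\<in>{0..norm P}. \<bar>poly q t - g t\<bar> \<le> \<epsilon>) \<and>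
                               norm (op_poly q P - B) \<le> \<epsilon>)"

definition op_abs :: "l2op \<Rightarrow> l2op" where
  "op_abs T = op_cfc sqrt (op_adjoint T o\<^sub>L T)"

definition op_abs_powr :: "l2op \<Rightarrow> real \<Rightarrow> l2op" where
  "op_abs_powr T p = op_cfc (\<lambda>t. t powr p) (op_abs T)"

definition orthonormal_basis :: "(nat \<Rightarrow> l2) \<Rightarrow> bool" where
  "orthonormal_basis e \<longleftrightarrow>
     (\<forall>i j. cinner (e i) (e j) = (if i = j then 1 else 0)) \<and>
     (\<forall>\<xi>. (\<lambda>i. l2_scaleC (cinner (e i) \<xi>) (e i)) sums \<xi>)"

text \<open>Trace of a positive operator, with values in \<open>[0, \<infinity>]\<close>; the choice of the basis
  is immaterial.\<close>

definition op_trace :: "l2op \<Rightarrow> ennreal" where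
  "op_trace B = (let e = (SOME e. orthonormal_basis e)
                 in \<Sum>i. ennreal (Re (cinner (e i) (B (e i)))))"

definition schatten_class :: "real \<Rightarrow> l2op set" where
  "schatten_class p = {T \<in> bounded_ops. op_trace (op_abs_powr T p) < \<infinity>}"

definition schatten_norm :: "real \<Rightarrow> l2op \<Rightarrow> real" where
  "schatten_norm p T = enn2real (op_trace (op_abs_powr T p)) powr (1 / p)"


section \<open>Bilinear Schur multipliers\<close>

definition has_kernel :: "l2op \<Rightarrow> (real \<times> real \<Rightarrow> complex) \<Rightarrow> bool" where
  "has_kernel T A \<longleftrightarrow> square_integrable lborel A \<and>
     (\<forall>\<xi>. AE t in lborel. rep_l2 (T \<xi>) t = (\<integral>s. A (t, s) * rep_l2 \<xi> s \<partial>lborel))"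

definition kernel_of :: "l2op \<Rightarrow> real \<times> real \<Rightarrow> complex" where
  "kernel_of T = (SOME A. has_kernel T A)"

definition op_of_kernel :: "(real \<times> real \<Rightarrow> complex) \<Rightarrow> l2op" where
  "op_of_kernel A = (THE T. has_kernel T A)"

definition schur_multiplier ::
    "(real \<Rightarrow> real \<Rightarrow> real \<Rightarrow> complex) \<Rightarrow> l2op \<Rightarrow> l2op \<Rightarrow> l2op" where
  "schur_multiplier m T\<^sub>1 T\<^sub>2 = op_of_kernel (\<lambda>(s\<^sub>0, s\<^sub>2).
     \<integral>s\<^sub>1. m s\<^sub>0 s\<^sub>1 s\<^sub>2 * kernel_of T\<^sub>1 (s\<^sub>0, s\<^sub>1) * kernel_of T\<^sub>2 (s\<^sub>1, s\<^sub>2) \<partial>lborel)"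

definition schatten_bilinear ::
    "real \<Rightarrow> real \<Rightarrow> real \<Rightarrow> (l2op \<Rightarrow> l2op \<Rightarrow> l2op) \<Rightarrow> bool" where
  "schatten_bilinear p\<^sub>1 p\<^sub>2 p N \<longleftrightarrow>
     (\<forall>A\<in>schatten_class p\<^sub>1. \<forall>B\<in>schatten_class p\<^sub>2. N A B \<in> schatten_class p) \<and>
     (\<forall>A\<in>schatten_class p\<^sub>1. \<forall>A'\<in>schatten_class p\<^sub>1. \<forall>B\<in>schatten_class p\<^sub>2.
        N (A + A') B = N A B + N A' B) \<and>
     (\<forall>A\<in>schatten_class p\<^sub>1. \<forall>B\<in>schatten_class p\<^sub>2. \<forall>B'\<in>schatten_class p\<^sub>2.
        N A (B + B') = N A B + N A B') \<and>
     (\<forall>c. \<forall>A\<in>schatten_class p\<^sub>1. \<forall>B\<in>schatten_class p\<^sub>2.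
        N (op_scaleC c A) B = op_scaleC c (N A B) \<and>
        N A (op_scaleC c B) = op_scaleC c (N A B))"

definition schatten_bilinear_bounds ::
    "real \<Rightarrow> real \<Rightarrow> real \<Rightarrow> (l2op \<Rightarrow> l2op \<Rightarrow> l2op) \<Rightarrow> real set" where
  "schatten_bilinear_bounds p\<^sub>1 p\<^sub>2 p N = {C. 0 \<le> C \<and>
     (\<forall>A\<in>schatten_class p\<^sub>1. \<forall>B\<in>schatten_class p\<^sub>2.
        schatten_norm p (N A B) \<le> C * schatten_norm p\<^sub>1 A * schatten_norm p\<^sub>2 B)}"

definition schur_extensions ::
    "real \<Rightarrow> real \<Rightarrow> real \<Rightarrow> (real \<Rightarrow> real \<Rightarrow> real \<Rightarrow> complex) \<Rightarrow> (l2op \<Rightarrow> l2op \<Rightarrow> l2op) set" where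
  "schur_extensions p\<^sub>1 p\<^sub>2 p m = {N. schatten_bilinear p\<^sub>1 p\<^sub>2 p N \<and>
     schatten_bilinear_bounds p\<^sub>1 p\<^sub>2 p N \<noteq> {} \<and>
     (\<forall>A\<in>schatten_class 2 \<inter> schatten_class p\<^sub>1. \<forall>B\<in>schatten_class 2 \<inter> schatten_class p\<^sub>2.
        N A B = schur_multiplier m A B)}"

text \<open>For finite exponents a bounded extension is unique on
  \<open>schatten_class p\<^sub>1 \<times> schatten_class p\<^sub>2\<close>, so the outer infimum ranges over at most one
  value; it is \<open>\<infinity>\<close> if no bounded extension exists.\<close>

definition schur_norm ::
    "real \<Rightarrow> real \<Rightarrow> real \<Rightarrow> (real \<Rightarrow> real \<Rightarrow> real \<Rightarrow> complex) \<Rightarrow> ennreal" where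
  "schur_norm p\<^sub>1 p\<^sub>2 p m =
     (INF N\<in>schur_extensions p\<^sub>1 p\<^sub>2 p m. ennreal (Inf (schatten_bilinear_bounds p\<^sub>1 p\<^sub>2 p N)))"


section \<open>Divided differences\<close>

definition divdiff1 :: "(real \<Rightarrow> real) \<Rightarrow> real \<Rightarrow> real \<Rightarrow> real" where
  "divdiff1 f x y = (if x = y then deriv f x else (f x - f y) / (x - y))"

text \<open>The value on the diagonal is a convention for functions that need not be twice
  differentiable; it is not \<open>f''(x) / 2\<close>.\<close>

definition divdiff2 :: "(real \<Rightarrow> real) \<Rightarrow> real \<Rightarrow> real \<Rightarrow> real \<Rightarrow> real" where
  "divdiff2 f x\<^sub>0 x\<^sub>1 x\<^sub>2 =
     (if x\<^sub>0 \<noteq> x\<^sub>2 then (divdiff1 f x\<^sub>0 x\<^sub>1 - divdiff1 f x\<^sub>1 x\<^sub>2) / (x\<^sub>0 - x\<^sub>2)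
      else if x\<^sub>1 \<noteq> x\<^sub>0 then (divdiff1 f x\<^sub>1 x\<^sub>2 - divdiff1 f x\<^sub>2 x\<^sub>0) / (x\<^sub>1 - x\<^sub>0)
      else 0)"

lemma divdiff1_commute: "divdiff1 f x y = divdiff1 f y x"
  by (auto simp: divdiff1_def field_simps)

text \<open>The cyclic index used in the defining quotient does not matter.\<close>

lemma divdiff2_cyclic: "divdiff2 f x\<^sub>0 x\<^sub>1 x\<^sub>2 = divdiff2 f x\<^sub>1 x\<^sub>2 x\<^sub>0"
proof -
  define a b c where abc: "a = divdiff1 f x\<^sub>0 x\<^sub>1" "b = divdiff1 f x\<^sub>1 x\<^sub>2" "c = divdiff1 f x\<^sub>2 x\<^sub>0"
  have sum: "a * (x\<^sub>0 - x\<^sub>1) + b * (x\<^sub>1 - x\<^sub>2) + c * (x\<^sub>2 - x\<^sub>0) = 0"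
    by (simp add: abc divdiff1_def)
  have "(a - b) / (x\<^sub>0 - x\<^sub>2) = (b - c) / (x\<^sub>1 - x\<^sub>0)" if "x\<^sub>0 \<noteq> x\<^sub>2" "x\<^sub>1 \<noteq> x\<^sub>0"
  proof -
    have "(a - b) * (x\<^sub>1 - x\<^sub>0) = (b - c) * (x\<^sub>0 - x\<^sub>2)"
      using sum by (simp add: algebra_simps)
    with that show ?thesis by (simp add: frac_eq_eq)
  qed
  moreover have "(a - b) / (x\<^sub>0 - x\<^sub>2) = (c - a) / (x\<^sub>2 - x\<^sub>1)" if "x\<^sub>1 = x\<^sub>0"
  proof -
    have "b = c" using that by (simp add: abc divdiff1_commute)
    then show ?thesis
      using that minus_divide_divide [of "a - b" "x\<^sub>0 - x\<^sub>2"] by simp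
  qed
  ultimately show ?thesis
    unfolding divdiff2_def abc [symmetric] by auto
qed

definition signed_square :: "real \<Rightarrow> real" where
  "signed_square s = s * \<bar>s\<bar>"

end

theory Submission
  imports Defs
begin

text \<open>
  For \<open>a, b, c > 0\<close> the symbol at \<open>(-b, a, c)\<close> equals \<open>1 - 2 \<cdot> b/(a+b) \<cdot> b/(b+c)\<close>
  (\<open>divdiff2_signed_square\<close>).  On unit intervals at exponentially separated positions each quotient is
  almost 0 or 1, so up to a small error the multiplier sends matrices \<open>(a\<^sub>x\<^sub>y)\<close>, \<open>(b\<^sub>y\<^sub>z)\<close> to their product
  minus twice the sum of those terms \<open>a\<^sub>x\<^sub>y b\<^sub>y\<^sub>z\<close> for which \<open>x\<close> stands above both \<open>y\<close> and \<open>z\<close>.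
  The positions of the three index sets can be prescribed freely.  Writing \<open>\<T>\<close> for triangular
  truncation, the multiplier thus contains \<open>(A, B) \<mapsto> \<T>(\<T>(A) B)\<close>, and each truncation can
  contribute to the growth of the norm.  The lemma \<open>schur_transfer\<close> makes this reduction precise.

  For \<open>p \<le> 2\<close> one truncation suffices.  Applied to a rank one matrix it produces a matrix with singular
  values of order \<open>1/k\<close>, whose \<open>p\<close>-norm is of order \<open>1/(p-1)\<close>, and a rank one matrix is the product
  of a column and a row of norm 1 (\<open>bound_small_p\<close>).  For \<open>p \<ge> 2\<close> the positions are arranged
  lexicographically so that the truncations act on the two factors of a tensor product.  Each of them
  turns a unitary matrix of size \<open>n\<close> into one of norm of order \<open>ln n\<close>; for \<open>n\<close> exponential in
  \<open>p\<close> this is of order \<open>p\<close>, while the Schatten norms of the unitary inputs remain bounded.  Together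
  this gives \<open>p\<^sup>2\<close> (\<open>bound_large_p\<close>).

  Both examples rest on one matrix, the upper triangular sign matrix with \<open>1\<close> above and \<open>-1\<close> on and
  below the diagonal.  It is negacyclic, so its singular values and its unitary part are explicit.

  The Schatten norms are estimated without a spectral theorem.  The functional calculus of a positive
  operator preserves order (\<open>op_poly_weighted_nonneg\<close>), hence comparing \<open>t\<^sup>p\<close> with even polynomials of
  degree at most 4 bounds the trace of \<open>|T|\<^sup>p\<close> through norms of \<open>Tg\<close> and \<open>T\<^sup>*Tg\<close> for
  orthonormal vectors \<open>g\<close> (\<open>schatten_kop_le\<close>, \<open>schatten_kop_ge\<close>).
\<close>

section \<open>The space \<open>L\<^sup>2(\<real>)\<close> and its representatives\<close>

lemma abs_rep_l2 [simp]: "abs_l2 (rep_l2 x) = x"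
  by (rule Quotient3_abs_rep [OF Quotient3_l2])

lemma rep_l2_square_integrable [simp]: "square_integrable lborel (rep_l2 x)"
  using Quotient3_rep_reflp [OF Quotient3_l2, of x] by (simp add: l2_rel_def)

lemma rep_l2_measurable [measurable]: "rep_l2 x \<in> borel_measurable borel"
  using rep_l2_square_integrable[of x] by (simp add: square_integrable_def)

lemma rep_abs_l2:
  assumes "square_integrable lborel f"
  shows "AE t in lborel. rep_l2 (abs_l2 f) t = f t"
proof -
  have "l2_rel f f" using assms by (simp add: l2_rel_def)
  then have "l2_rel (rep_l2 (abs_l2 f)) f"
    by (rule rep_abs_rsp_left [OF Quotient3_l2])
  then show ?thesis by (simp add: l2_rel_def)
qed

lemma abs_l2_eq_iff:
  assumes "square_integrable lborel f" "square_integrable lborel g"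
  shows "abs_l2 f = abs_l2 g \<longleftrightarrow> (AE t in lborel. f t = g t)"
  using Quotient3_rel[OF Quotient3_l2, of f g] assms by (auto simp: l2_rel_def)

lemma abs_l2_add:
  assumes "square_integrable lborel f" "square_integrable lborel g"
  shows "abs_l2 f + abs_l2 g = abs_l2 (\<lambda>t. f t + g t)"
  by (rule plus_l2.abs_eq) (use assms in \<open>simp_all add: l2_rel_def\<close>)

lemma abs_l2_scaleC:
  assumes "square_integrable lborel f"
  shows "l2_scaleC c (abs_l2 f) = abs_l2 (\<lambda>t. c * f t)"
  by (rule l2_scaleC.abs_eq) (use assms in \<open>simp_all add: l2_rel_def\<close>)

lemma abs_l2_diff:
  assumes "square_integrable lborel f" "square_integrable lborel g"
  shows "abs_l2 f - abs_l2 g = abs_l2 (\<lambda>t. f t - g t)"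
  using abs_l2_add[OF assms(1) square_integrable_cmult[OF assms(2), of "-1"]]
  by (simp add: minus_l2_def uminus_l2_def abs_l2_scaleC[OF assms(2)])

lemma cinner_abs_l2:
  assumes "square_integrable lborel f" "square_integrable lborel g"
  shows "cinner (abs_l2 f) (abs_l2 g) = (\<integral>t. cnj (f t) * g t \<partial>lborel)"
  by (rule cinner.abs_eq) (use assms in \<open>simp_all add: l2_rel_def\<close>)

lemma cinner_rep_l2: "cinner x y = (\<integral>t. cnj (rep_l2 x t) * rep_l2 y t \<partial>lborel)"
  using cinner_abs_l2[of "rep_l2 x" "rep_l2 y"] by simp

lemma cinner_abs_left:
  assumes "square_integrable lborel f"
  shows "cinner (abs_l2 f) y = (\<integral>t. cnj (f t) * rep_l2 y t \<partial>lborel)"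
  using cinner_abs_l2[of f "rep_l2 y"] assms by simp

lemma square_integrable_diff:
  assumes "square_integrable M f" "square_integrable M g"
  shows "square_integrable M (\<lambda>x. f x - g x)"
  using square_integrable_add[OF assms(1) square_integrable_cmult[OF assms(2), of "-1"]] by simp

lemma rep_l2_add: "AE t in lborel. rep_l2 (x + y) t = rep_l2 x t + rep_l2 y t"
proof -
  have "x + y = abs_l2 (\<lambda>t. rep_l2 x t + rep_l2 y t)"
    using abs_l2_add[of "rep_l2 x" "rep_l2 y"] by simp
  then show ?thesis
    using rep_abs_l2[OF square_integrable_add, of "rep_l2 x" "rep_l2 y"] by simp
qed

lemma rep_l2_scaleC: "AE t in lborel. rep_l2 (l2_scaleC c x) t = c * rep_l2 x t"
proof -
  have "l2_scaleC c x = abs_l2 (\<lambda>t. c * rep_l2 x t)"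
    using abs_l2_scaleC[of "rep_l2 x"] by simp
  then show ?thesis
    using rep_abs_l2[OF square_integrable_cmult, of "rep_l2 x" c] by simp
qed

subsection \<open>The complex inner product\<close>

lemma cinner_commute: "cinner x y = cnj (cinner y x)"
  unfolding cinner_rep_l2 by (subst Bochner_Integration.integral_cnj [symmetric]) (simp add: mult.commute)

lemma cinner_add_left: "cinner (x + y) z = cinner x z + cinner y z"
  by transfer (simp add: l2_rel_def distrib_right square_integrable_mult)

lemma cinner_add_right: "cinner z (x + y) = cinner z x + cinner z y"
  by transfer (simp add: l2_rel_def distrib_left square_integrable_mult)

lemma cinner_scaleC_left [simp]: "cinner (l2_scaleC c x) y = cnj c * cinner x y"
  by transfer (simp add: mult.assoc)

lemma cinner_scaleC_right [simp]: "cinner x (l2_scaleC c y) = c * cinner x y"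
  by transfer (simp add: mult.left_commute)

lemma l2_scaleC_of_real: "l2_scaleC (of_real r) x = r *\<^sub>R x"
  by (simp add: scaleR_l2_def)

lemma cinner_scaleR_left [simp]: "cinner (r *\<^sub>R x) y = of_real r * cinner x y"
  by (simp add: scaleR_l2_def)

lemma cinner_scaleR_right [simp]: "cinner x (r *\<^sub>R y) = of_real r * cinner x y"
  by (simp add: scaleR_l2_def)

lemma cinner_zero_left [simp]: "cinner 0 y = 0"
  using cinner_scaleR_left[of 0 0 y] by simp

lemma cinner_zero_right [simp]: "cinner y 0 = 0"
  using cinner_scaleR_right[of y 0 0] by simp

lemma cinner_minus_left [simp]: "cinner (- x) y = - cinner x y"
  using cinner_scaleR_left[of "-1" x y] by simp

lemma cinner_minus_right [simp]: "cinner x (- y) = - cinner x y"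
  using cinner_scaleR_right[of x "-1" y] by simp

lemma cinner_diff_left: "cinner (x - y) z = cinner x z - cinner y z"
  using cinner_add_left[of x "-y" z] by simp

lemma cinner_diff_right: "cinner z (x - y) = cinner z x - cinner z y"
  using cinner_add_right[of z x "-y"] by simp

lemma cinner_sum_left: "cinner (\<Sum>i\<in>I. f i) y = (\<Sum>i\<in>I. cinner (f i) y)"
  by (induction I rule: infinite_finite_induct) (auto simp: cinner_add_left)

lemma cinner_sum_right: "cinner y (\<Sum>i\<in>I. f i) = (\<Sum>i\<in>I. cinner y (f i))"
  by (induction I rule: infinite_finite_induct) (auto simp: cinner_add_right)

lemma cinner_self: "cinner x x = of_real ((norm x)\<^sup>2)"
proof -
  have "cinner x x = cnj (cinner x x)" by (rule cinner_commute)
  then have "Im (cinner x x) = 0" by (simp add: complex_eq_iff)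
  moreover have "Re (cinner x x) = (norm x)\<^sup>2"
    by (simp add: power2_norm_eq_inner inner_l2_def)
  ultimately show ?thesis by (simp add: complex_eq_iff)
qed

lemma l2_scaleC_add: "l2_scaleC c (x + y) = l2_scaleC c x + l2_scaleC c y"
  by transfer (simp add: l2_rel_def square_integrable_cmult square_integrable_add distrib_left)

lemma norm_l2_scaleC [simp]: "norm (l2_scaleC c x) = cmod c * norm x"
proof -
  have "complex_of_real ((norm (l2_scaleC c x))\<^sup>2) = (c * cnj c) * cinner x x"
    using cinner_self[of "l2_scaleC c x"] by (simp add: mult_ac)
  also have "\<dots> = of_real ((cmod c * norm x)\<^sup>2)"
    by (simp only: complex_norm_square[symmetric] cinner_self of_real_mult[symmetric] power_mult_distrib)
  finally have "complex_of_real ((norm (l2_scaleC c x))\<^sup>2) = of_real ((cmod c * norm x)\<^sup>2)" .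
  then have "(norm (l2_scaleC c x))\<^sup>2 = (cmod c * norm x)\<^sup>2"
    by (simp only: of_real_eq_iff)
  then show ?thesis by (simp add: power2_eq_iff_nonneg)
qed

lemma l2_scaleC_scaleC [simp]: "l2_scaleC c (l2_scaleC d x) = l2_scaleC (c * d) x"
  by transfer (simp add: l2_rel_def square_integrable_cmult mult.assoc)

lemma l2_scaleC_zero_right [simp]: "l2_scaleC c 0 = 0"
  by (metis norm_eq_zero norm_l2_scaleC mult_zero_right norm_zero)

lemma l2_scaleC_scaleR: "l2_scaleC c (r *\<^sub>R x) = r *\<^sub>R l2_scaleC c x"
  by (simp add: scaleR_l2_def mult.commute)

lemma l2_scaleC_sum: "l2_scaleC c (\<Sum>i\<in>I. f i) = (\<Sum>i\<in>I. l2_scaleC c (f i))"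
  by (induction I rule: infinite_finite_induct) (auto simp: l2_scaleC_add)

lemma bounded_linear_l2_scaleC: "bounded_linear (l2_scaleC c)"
  by (rule bounded_linear_intro[where K = "cmod c"])
     (auto simp: l2_scaleC_add l2_scaleC_scaleR mult.commute)

lemma cmod_cinner_le: "cmod (cinner x y) \<le> norm x * norm y"
proof (cases "cinner x y = 0")
  case False
  define u where "u = cnj (cinner x y) / cmod (cinner x y)"
  have u: "cmod u = 1" using False by (simp add: u_def norm_divide)
  have "u * cinner x y = of_real (cmod (cinner x y))"
    using False complex_norm_square[of "cinner x y"]
    by (simp add: u_def field_simps power2_eq_square)
  then have "cmod (cinner x y) = x \<bullet> l2_scaleC u y"
    by (simp add: inner_l2_def)
  also have "\<dots> \<le> norm x * norm (l2_scaleC u y)" by (rule norm_cauchy_schwarz)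
  finally show ?thesis using u by simp
qed auto

lemma norm_l2_square: "(norm x)\<^sup>2 = (\<integral>t. (cmod (rep_l2 x t))\<^sup>2 \<partial>lborel)"
proof -
  have "complex_of_real ((norm x)\<^sup>2) = (\<integral>t. complex_of_real ((cmod (rep_l2 x t))\<^sup>2) \<partial>lborel)"
    unfolding cinner_self[symmetric] cinner_rep_l2
    by (intro Bochner_Integration.integral_cong refl) (metis complex_norm_square mult.commute)
  then show ?thesis by (simp only: integral_complex_of_real of_real_eq_iff)
qed

lemma norm_abs_l2_square:
  assumes "square_integrable lborel f"
  shows "(norm (abs_l2 f))\<^sup>2 = (\<integral>t. (cmod (f t))\<^sup>2 \<partial>lborel)"
  unfolding norm_l2_square
  by (rule integral_cong_AE) (use assms rep_abs_l2[OF assms] in \<open>auto simp: square_integrable_def\<close>)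

lemma cmod_integral_mult_le:
  fixes f g :: "real \<Rightarrow> complex"
  assumes "square_integrable lborel f" "square_integrable lborel g"
  shows "cmod (\<integral>t. f t * g t \<partial>lborel) \<le>
    sqrt (\<integral>t. (cmod (f t))\<^sup>2 \<partial>lborel) * sqrt (\<integral>t. (cmod (g t))\<^sup>2 \<partial>lborel)"
proof -
  have m: "(\<lambda>t. cnj (f t)) \<in> borel_measurable lborel"
    by (rule borel_measurable_continuous_on[of cnj])
       (use assms in \<open>auto simp: square_integrable_def intro: continuous_intros\<close>)
  have s: "square_integrable lborel (\<lambda>t. cnj (f t))"
    using assms(1) m by (simp add: square_integrable_def)
  have "cmod (cinner (abs_l2 (\<lambda>t. cnj (f t))) (abs_l2 g)) \<le> norm (abs_l2 (\<lambda>t. cnj (f t))) * norm (abs_l2 g)"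
    by (rule cmod_cinner_le)
  also have "\<dots> = sqrt ((norm (abs_l2 (\<lambda>t. cnj (f t))))\<^sup>2) * sqrt ((norm (abs_l2 g))\<^sup>2)" by simp
  finally show ?thesis
    by (simp only: cinner_abs_l2[OF s assms(2)] norm_abs_l2_square[OF s] norm_abs_l2_square[OF assms(2)]) simp
qed

subsection \<open>Completeness\<close>

text \<open>A Cauchy sequence whose steps have norm at most \<open>2\<^sup>-\<^sup>n\<close> stays summable after weighting the squared
  steps by \<open>2\<^sup>n\<close>.  Hence almost everywhere the steps are \<open>O(2\<^sup>-\<^sup>n\<^sup>/\<^sup>2)\<close> and the sequence converges
  pointwise; Fatou's lemma turns this into convergence in norm.\<close>

lemma l2_completeness_fast:
  fixes X :: "nat \<Rightarrow> l2"
  assumes fast: "\<And>n. norm (X (Suc n) - X n) \<le> (1/2) ^ n" and C: "Cauchy X"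
  shows "convergent X"
proof -
  define f where "f n = rep_l2 (X n)" for n
  have [measurable]: "f n \<in> borel_measurable borel" for n by (simp add: f_def)
  have sqd: "square_integrable lborel (\<lambda>t. f m t - f n t)" for m n
    unfolding f_def by (intro square_integrable_diff rep_l2_square_integrable)
  have absd: "X m - X n = abs_l2 (\<lambda>t. f m t - f n t)" for m n
    using abs_l2_diff[of "f m" "f n"] by (simp add: f_def)
  have nd: "(norm (X m - X n))\<^sup>2 = (\<integral>t. (cmod (f m t - f n t))\<^sup>2 \<partial>lborel)" for m n
    by (simp only: absd norm_abs_l2_square[OF sqd])
  define d where "d n t = 2 ^ n * (cmod (f (Suc n) t - f n t))\<^sup>2" for n t
  have dint: "integrable lborel (d n)" for n
    unfolding d_def using sqd by (auto simp: square_integrable_def)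
  have dm[measurable]: "d n \<in> borel_measurable borel" for n
    unfolding d_def by measurable
  have "(\<integral>\<^sup>+ t. (\<Sum>n. ennreal (d n t)) \<partial>lborel) = (\<Sum>n. \<integral>\<^sup>+ t. ennreal (d n t) \<partial>lborel)"
    by (rule nn_integral_suminf) simp
  also have "\<dots> = (\<Sum>n. ennreal (\<integral>t. d n t \<partial>lborel))"
    by (subst nn_integral_eq_integral[OF dint]) (auto simp: d_def)
  also have "\<dots> \<le> (\<Sum>n. ennreal ((1/2) ^ n))"
  proof (rule suminf_le)
    fix n
    have "(\<integral>t. d n t \<partial>lborel) = 2 ^ n * (norm (X (Suc n) - X n))\<^sup>2"
      unfolding d_def nd by simp
    also have "\<dots> \<le> 2 ^ n * ((1/2) ^ n)\<^sup>2"
      by (intro mult_left_mono power_mono fast) auto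
    also have "\<dots> = (1/2) ^ n" by (simp add: power2_eq_square power_divide)
    finally show "ennreal (\<integral>t. d n t \<partial>lborel) \<le> ennreal ((1/2) ^ n)"
      by (rule ennreal_leI)
  qed auto
  also have "\<dots> = ennreal (\<Sum>n. (1/2) ^ n)"
    by (rule suminf_ennreal2) auto
  also have "\<dots> < \<infinity>" by simp
  finally have "(\<integral>\<^sup>+ t. (\<Sum>n. ennreal (d n t)) \<partial>lborel) \<noteq> \<infinity>" by simp
  then have "AE t in lborel. (\<Sum>n. ennreal (d n t)) \<noteq> \<infinity>"
    by (intro nn_integral_PInf_AE) auto
  then have ae: "AE t in lborel. convergent (\<lambda>n. f n t)"
  proof eventually_elim
    case (elim t)
    have "summable (\<lambda>n. d n t)"
      using elim by (intro summable_suminf_not_top) (auto simp: d_def)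
    then have "(\<lambda>n. d n t) \<longlonglongrightarrow> 0" by (rule summable_LIMSEQ_zero)
    then have "Bseq (\<lambda>n. d n t)" by (meson Bseq_conv_Bfun convergentI convergent_imp_Bseq)
    then obtain K where K: "K > 0" "\<And>n. norm (d n t) \<le> K" by (auto elim: BseqE)
    have b: "norm (f (Suc n) t - f n t) \<le> sqrt K * (1 / sqrt 2) ^ n" for n
    proof -
      have "2 ^ n * (cmod (f (Suc n) t - f n t))\<^sup>2 \<le> K" using K(2)[of n] by (simp add: d_def)
      then have "(cmod (f (Suc n) t - f n t))\<^sup>2 \<le> K * (1/2) ^ n" by (simp add: field_simps power_divide)
      then have "sqrt ((cmod (f (Suc n) t - f n t))\<^sup>2) \<le> sqrt (K * (1/2) ^ n)" by (rule real_sqrt_le_mono)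
      then show ?thesis by (simp add: real_sqrt_mult real_sqrt_power real_sqrt_divide)
    qed
    have "summable (\<lambda>n. f (Suc n) t - f n t)"
      by (rule summable_comparison_test'[where N = 0 and g = "\<lambda>n. sqrt K * (1 / sqrt 2) ^ n"])
         (use b in \<open>auto intro!: summable_mult summable_geometric simp: real_less_lsqrt\<close>)
    then obtain s where "(\<lambda>n. f (Suc n) t - f n t) sums s" by (auto simp: summable_def)
    then have "(\<lambda>n. \<Sum>i<n. f (Suc i) t - f i t) \<longlonglongrightarrow> s" by (simp add: sums_def)
    then have "(\<lambda>n. f n t - f 0 t) \<longlonglongrightarrow> s"
      using sum_lessThan_telescope[of "\<lambda>n. f n t"] by simp
    then have "(\<lambda>n. (f n t - f 0 t) + f 0 t) \<longlonglongrightarrow> s + f 0 t" by (intro tendsto_intros)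
    then show ?case by (auto simp: convergent_def)
  qed
  define g where "g t = lim (\<lambda>n. f n t)" for t
  have gm[measurable]: "g \<in> borel_measurable borel"
    unfolding g_def by (rule borel_measurable_lim_metric) simp
  have lim: "AE t in lborel. (\<lambda>n. f n t) \<longlonglongrightarrow> g t"
    using ae by eventually_elim (simp add: g_def convergent_LIMSEQ_iff)
  have fatou: "(\<integral>\<^sup>+ t. ennreal ((cmod (g t - f n t))\<^sup>2) \<partial>lborel) \<le> ennreal (e\<^sup>2)"
    if e: "\<And>m. m \<ge> n \<Longrightarrow> norm (X m - X n) \<le> e" and n: "n \<ge> 0" for n e
  proof -
    have "AE t in lborel. ennreal ((cmod (g t - f n t))\<^sup>2) \<le> liminf (\<lambda>m. ennreal ((cmod (f m t - f n t))\<^sup>2))"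
      using lim
    proof eventually_elim
      case (elim t)
      have "(\<lambda>m. ennreal ((cmod (f m t - f n t))\<^sup>2)) \<longlonglongrightarrow> ennreal ((cmod (g t - f n t))\<^sup>2)"
        by (intro tendsto_intros elim)
      from lim_imp_Liminf[OF sequentially_bot this] show ?case by (rule eq_refl[OF sym])
    qed
    then have "(\<integral>\<^sup>+ t. ennreal ((cmod (g t - f n t))\<^sup>2) \<partial>lborel)
        \<le> (\<integral>\<^sup>+ t. liminf (\<lambda>m. ennreal ((cmod (f m t - f n t))\<^sup>2)) \<partial>lborel)"
      by (rule nn_integral_mono_AE)
    also have "\<dots> \<le> liminf (\<lambda>m. \<integral>\<^sup>+ t. ennreal ((cmod (f m t - f n t))\<^sup>2) \<partial>lborel)"
      by (rule nn_integral_liminf) simp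
    also have "\<dots> = liminf (\<lambda>m. ennreal ((norm (X m - X n))\<^sup>2))"
      unfolding nd using sqd by (subst nn_integral_eq_integral) (auto simp: square_integrable_def)
    also have "\<dots> \<le> liminf (\<lambda>m. ennreal (e\<^sup>2))"
    proof (rule Liminf_mono)
      show "\<forall>\<^sub>F m in sequentially. ennreal ((norm (X m - X n))\<^sup>2) \<le> ennreal (e\<^sup>2)"
        using eventually_ge_at_top[of n]
        by eventually_elim (intro ennreal_leI power_mono e norm_ge_zero)
    qed
    finally show ?thesis by (simp add: Liminf_const)
  qed
  have sqg: "square_integrable lborel (\<lambda>t. g t - f n t)"
    and ng: "norm (abs_l2 (\<lambda>t. g t - f n t)) \<le> e"
    if e: "\<And>m. m \<ge> n \<Longrightarrow> norm (X m - X n) \<le> e" for n e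
  proof -
    have e0: "e \<ge> 0" using e[of n] by simp
    have fin: "(\<integral>\<^sup>+ t. ennreal ((cmod (g t - f n t))\<^sup>2) \<partial>lborel) < \<infinity>"
      using fatou[OF e] by (simp add: le_less_trans)
    show s: "square_integrable lborel (\<lambda>t. g t - f n t)"
      unfolding square_integrable_def using fin by (auto intro!: integrableI_bounded)
    have "ennreal ((norm (abs_l2 (\<lambda>t. g t - f n t)))\<^sup>2) \<le> ennreal (e\<^sup>2)"
      unfolding norm_abs_l2_square[OF s] using fatou[OF e] s
      by (subst nn_integral_eq_integral[symmetric]) (auto simp: square_integrable_def)
    then show "norm (abs_l2 (\<lambda>t. g t - f n t)) \<le> e"
      using e0 by (auto simp: ennreal_le_iff intro: power2_le_imp_le)
  qed
  have Cb: "\<exists>n. \<forall>k\<ge>n. \<forall>m\<ge>k. norm (X m - X k) \<le> e" if "e > 0" for e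
    using CauchyD[OF C that] by (meson less_imp_le le_trans)
  obtain n1 where n1: "\<forall>k\<ge>n1. \<forall>m\<ge>k. norm (X m - X k) \<le> 1" using Cb[of 1] by auto
  have "square_integrable lborel (\<lambda>t. (g t - f n1 t) + f n1 t)"
    by (intro square_integrable_add sqg[of n1 1]) (use n1 in \<open>auto simp: f_def\<close>)
  then have gs: "square_integrable lborel g" by simp
  have "X \<longlonglongrightarrow> abs_l2 g"
  proof (rule LIMSEQ_I)
    fix r :: real assume "0 < r"
    then obtain n where n: "\<forall>k\<ge>n. \<forall>m\<ge>k. norm (X m - X k) \<le> r / 2" using Cb[of "r/2"] by auto
    have "norm (X k - abs_l2 g) < r" if "k \<ge> n" for k
    proof -
      have "abs_l2 g - X k = abs_l2 (\<lambda>t. g t - f k t)"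
        using abs_l2_diff[OF gs, of "f k"] by (simp add: f_def)
      then have "norm (abs_l2 g - X k) \<le> r / 2" using ng[of k "r/2"] n that by simp
      then show ?thesis using \<open>0 < r\<close> by (simp add: norm_minus_commute)
    qed
    then show "\<exists>no. \<forall>n\<ge>no. norm (X n - abs_l2 g) < r" by blast
  qed
  then show ?thesis by (auto simp: convergent_def)
qed

instance l2 :: banach
proof
  fix X :: "nat \<Rightarrow> l2" assume C: "Cauchy X"
  have "\<exists>r. strict_mono r \<and> (\<forall>n. \<forall>m\<ge>r n. norm (X m - X (r n)) \<le> (1/2) ^ n)"
  proof -
    have ex: "\<exists>N. \<forall>m\<ge>N. \<forall>k\<ge>N. norm (X m - X k) \<le> (1/2) ^ n" for n
      using CauchyD[OF C, of "(1/2) ^ n"] by (auto intro: less_imp_le)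
    then obtain N where N: "\<And>n m k. m \<ge> N n \<Longrightarrow> k \<ge> N n \<Longrightarrow> norm (X m - X k) \<le> (1/2) ^ n"
      by metis
    define r where "r n = (\<Sum>i\<le>n. N i) + n" for n
    have "strict_mono r" by (rule strict_mono_Suc_iff[THEN iffD2]) (simp add: r_def)
    moreover have "r n \<ge> N n" for n
      unfolding r_def using member_le_sum[of n "{..n}" N] by auto
    ultimately show ?thesis using N by (meson le_trans)
  qed
  then obtain r where r: "strict_mono r" "\<And>n m. m \<ge> r n \<Longrightarrow> norm (X m - X (r n)) \<le> (1/2) ^ n" by blast
  have "convergent (X \<circ> r)"
  proof (rule l2_completeness_fast)
    show "norm ((X \<circ> r) (Suc n) - (X \<circ> r) n) \<le> (1/2) ^ n" for n
      using r(2)[of n "r (Suc n)"] strict_mono_less_eq[OF r(1), of n "Suc n"] by simp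
    show "Cauchy (X \<circ> r)" using C r(1) by (rule Cauchy_subseq_Cauchy)
  qed
  then show "convergent X"
    using Cauchy_converges_subseq[OF C r(1)] by (auto simp: convergent_def)
qed

section \<open>Orthonormal families and bases\<close>

definition orthonormal_on :: "'i set \<Rightarrow> ('i \<Rightarrow> l2) \<Rightarrow> bool" where
  "orthonormal_on I e \<longleftrightarrow> (\<forall>i\<in>I. \<forall>j\<in>I. cinner (e i) (e j) = (if i = j then 1 else 0))"

lemma orthonormal_onD:
  "orthonormal_on I e \<Longrightarrow> i \<in> I \<Longrightarrow> j \<in> I \<Longrightarrow> cinner (e i) (e j) = (if i = j then 1 else 0)"
  by (simp add: orthonormal_on_def)

lemma orthonormal_on_subset: "orthonormal_on I e \<Longrightarrow> J \<subseteq> I \<Longrightarrow> orthonormal_on J e"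
  by (auto simp: orthonormal_on_def subset_iff)

lemma orthonormal_on_norm: "orthonormal_on I e \<Longrightarrow> i \<in> I \<Longrightarrow> norm (e i) = 1"
  using cinner_self[of "e i"] orthonormal_onD[of I e i i]
  by (metis of_real_eq_1_iff power2_norm_eq_inner norm_eq_1)

lemma orthonormal_cinner_sum:
  assumes "orthonormal_on I e" "finite I" "i \<in> I"
  shows "cinner (e i) (\<Sum>j\<in>I. l2_scaleC (c j) (e j)) = c i"
proof -
  have "cinner (e i) (\<Sum>j\<in>I. l2_scaleC (c j) (e j)) = (\<Sum>j\<in>I. if i = j then c j else 0)"
    unfolding cinner_sum_right
    by (intro sum.cong refl) (use assms in \<open>simp add: orthonormal_onD\<close>)
  then show ?thesis using assms by simp
qed

lemma orthonormal_cinner_sum_sum: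
  assumes "orthonormal_on I e" "finite I"
  shows "cinner (\<Sum>j\<in>I. l2_scaleC (b j) (e j)) (\<Sum>j\<in>I. l2_scaleC (c j) (e j)) = (\<Sum>i\<in>I. cnj (b i) * c i)"
  unfolding cinner_sum_left
  by (intro sum.cong refl) (simp add: orthonormal_cinner_sum[OF assms])

lemma norm_orthonormal_sum:
  assumes "orthonormal_on I e" "finite I"
  shows "(norm (\<Sum>i\<in>I. l2_scaleC (c i) (e i)))\<^sup>2 = (\<Sum>i\<in>I. (cmod (c i))\<^sup>2)"
proof -
  have "complex_of_real ((norm (\<Sum>i\<in>I. l2_scaleC (c i) (e i)))\<^sup>2) = (\<Sum>i\<in>I. cnj (c i) * c i)"
    unfolding cinner_self[symmetric] by (rule orthonormal_cinner_sum_sum[OF assms])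
  also have "\<dots> = complex_of_real (\<Sum>i\<in>I. (cmod (c i))\<^sup>2)"
    unfolding of_real_sum by (intro sum.cong refl) (metis complex_norm_square mult.commute)
  finally show ?thesis by (simp only: of_real_eq_iff)
qed

lemma norm_diff_projection:
  assumes "orthonormal_on I e" "finite I"
  shows "(norm (x - (\<Sum>i\<in>I. l2_scaleC (cinner (e i) x) (e i))))\<^sup>2
       = (norm x)\<^sup>2 - (\<Sum>i\<in>I. (cmod (cinner (e i) x))\<^sup>2)"
proof -
  define s where "s = (\<Sum>i\<in>I. l2_scaleC (cinner (e i) x) (e i))"
  have ss: "cinner s s = (\<Sum>i\<in>I. cnj (cinner (e i) x) * cinner (e i) x)"
    unfolding s_def by (rule orthonormal_cinner_sum_sum[OF assms])
  have sx: "cinner s x = (\<Sum>i\<in>I. cnj (cinner (e i) x) * cinner (e i) x)"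
    unfolding s_def cinner_sum_left by simp
  have ns: "(norm s)\<^sup>2 = (\<Sum>i\<in>I. (cmod (cinner (e i) x))\<^sup>2)"
    unfolding s_def by (rule norm_orthonormal_sum[OF assms])
  have "s \<bullet> x = s \<bullet> s" using ss sx by (simp add: inner_l2_def)
  then have "(norm (x - s))\<^sup>2 = (norm x)\<^sup>2 - (norm s)\<^sup>2"
    by (simp add: power2_norm_eq_inner inner_diff_left inner_diff_right inner_commute)
  then show ?thesis by (simp add: s_def[symmetric] ns)
qed

lemma Bessel_finite:
  assumes "orthonormal_on I e" "finite I"
  shows "(\<Sum>i\<in>I. (cmod (cinner (e i) x))\<^sup>2) \<le> (norm x)\<^sup>2"
  using norm_diff_projection[OF assms, of x]
  by (metis diff_ge_0_iff_ge zero_le_power2)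

lemma orthonormal_basis_orthonormal_on: "orthonormal_basis e \<Longrightarrow> orthonormal_on UNIV e"
  by (simp add: orthonormal_basis_def orthonormal_on_def)

lemma Parseval:
  assumes "orthonormal_basis e"
  shows "(\<lambda>i. (cmod (cinner (e i) x))\<^sup>2) sums (norm x)\<^sup>2"
proof -
  have o: "orthonormal_on {..<n} e" for n
    using assms by (simp add: orthonormal_basis_def orthonormal_on_def)
  have "(\<lambda>i. l2_scaleC (cinner (e i) x) (e i)) sums x"
    using assms by (simp add: orthonormal_basis_def)
  then have "(\<lambda>n. (norm (\<Sum>i<n. l2_scaleC (cinner (e i) x) (e i)))\<^sup>2) \<longlonglongrightarrow> (norm x)\<^sup>2"
    unfolding sums_def by (intro tendsto_intros)
  then show ?thesis
    unfolding sums_def norm_orthonormal_sum[OF o finite_lessThan] .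
qed

subsection \<open>A countable total family\<close>

definition rat_intervals :: "real set set" where
  "rat_intervals = {{a<..<b} | a b. a \<in> \<rat> \<and> b \<in> \<rat>}"

lemma countable_rat_intervals: "countable rat_intervals"
proof -
  have "rat_intervals = (\<lambda>(a, b). {a<..<b}) ` (\<rat> \<times> \<rat>)"
    by (auto simp: rat_intervals_def)
  then show ?thesis using countable_rat by (metis countable_SIGMA countable_image)
qed

lemma borel_eq_rat_intervals: "(borel :: real measure) = sigma UNIV rat_intervals"
proof (rule borel_eq_countable_basis[OF countable_rat_intervals])
  show "topological_basis rat_intervals"
  proof (rule topological_basisI)
    show "open B" if "B \<in> rat_intervals" for B using that by (auto simp: rat_intervals_def)
  next
    fix O' :: "real set" and x assume "open O'" "x \<in> O'"
    then obtain e where e: "e > 0" "ball x e \<subseteq> O'" using openE by blast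
    obtain a where a: "a \<in> \<rat>" "x - e < a" "a < x" using Rats_dense_in_real[of "x - e" x] e by auto
    obtain b where b: "b \<in> \<rat>" "x < b" "b < x + e" using Rats_dense_in_real[of x "x + e"] e by auto
    have "{a<..<b} \<subseteq> O'" using a b e(2) by (auto simp: subset_iff dist_real_def)
    then show "\<exists>B'\<in>rat_intervals. x \<in> B' \<and> B' \<subseteq> O'"
      using a b unfolding rat_intervals_def by (intro bexI[of _ "{a<..<b}"]) auto
  qed
qed

lemma Int_stable_rat_intervals: "Int_stable rat_intervals"
  unfolding Int_stable_def rat_intervals_def
proof (intro ballI, clarify)
  fix a b c d :: real assume "a \<in> \<rat>" "b \<in> \<rat>" "c \<in> \<rat>" "d \<in> \<rat>"
  then show "\<exists>a' b'. {a<..<b} \<inter> {c<..<d} = {a'<..<b'} \<and> a' \<in> \<rat> \<and> b' \<in> \<rat>"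
    by (intro exI[of _ "max a c"] exI[of _ "min b d"]) (auto simp: max_def min_def)
qed

lemma integrable_on_interval:
  assumes "square_integrable lborel f" "I \<in> sets borel" "emeasure lborel I < \<infinity>"
  shows "integrable lborel (\<lambda>t. indicator I t * f t)" and "square_integrable lborel (\<lambda>t. indicator I t :: complex)"
proof -
  show s: "square_integrable lborel (\<lambda>t. indicator I t :: complex)"
    unfolding square_integrable_def
  proof
    show "(\<lambda>t. indicator I t :: complex) \<in> borel_measurable lborel" using assms by measurable
    have "integrable lborel (indicator I :: _ \<Rightarrow> real)" using assms by simp
    moreover have "(cmod (indicator I x :: complex))\<^sup>2 = indicator I x" for x
      by (simp add: indicator_def)
    ultimately show "integrable lborel (\<lambda>x. (cmod (indicator I x :: complex))\<^sup>2)"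
      by (simp only:)
  qed
  have "cnj (indicator I t) = indicator I t" for t by (simp add: indicator_def)
  then show "integrable lborel (\<lambda>t. indicator I t * f t)"
    using square_integrable_mult[OF s assms(1)] by (simp only:)
qed

lemma rat_intervals_fin: "I \<in> rat_intervals \<Longrightarrow> I \<in> sets borel \<and> emeasure lborel I < \<infinity>"
  by (auto simp: rat_intervals_def simp flip: infinity_ennreal_def intro!: emeasure_bounded_finite)

text \<open>Intervals with rational endpoints form a countable generator of the Borel sets that is closed
  under intersection, so integrals over them determine a function up to a null set.  Countability
  matters twice: for the size of an orthonormal basis, and for the uniqueness of kernels, where
  one null set has to serve all test functions.\<close>

lemma AE_zero_if_integral_rat_intervals:
  fixes f :: "real \<Rightarrow> complex"
  assumes sq: "square_integrable lborel f"
    and z: "\<And>I. I \<in> rat_intervals \<Longrightarrow> (\<integral>t. indicator I t * f t \<partial>lborel) = 0"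
  shows "AE t in lborel. f t = 0"
proof -
  have fm[measurable]: "f \<in> borel_measurable borel" using sq by (simp add: square_integrable_def)
  have main: "AE t in lborel. indicator {-real n<..<real n} t * f t = 0" for n :: nat
  proof -
    define J where "J = {-real n<..<real n}"
    define g where "g t = indicator J t * f t" for t
    have [measurable]: "J \<in> sets borel" by (simp add: J_def)
    have Jr: "J \<in> rat_intervals" unfolding J_def rat_intervals_def
      by (intro CollectI exI[of _ "- real n"] exI[of _ "real n"]) simp
    have gi: "integrable lborel g"
      unfolding g_def using rat_intervals_fin[OF Jr] by (intro integrable_on_interval sq) auto
    have "set_lebesgue_integral lborel A g = 0" if "A \<in> sets borel" for A
    proof -
      have "A \<in> sigma_sets UNIV rat_intervals" using that by (simp add: borel_eq_rat_intervals)
      with Int_stable_rat_intervals subset_UNIV[of rat_intervals, folded Pow_UNIV] show ?thesis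
      proof (induction rule: sigma_sets_induct_disjoint)
        case (basic A)
        then have "A \<inter> J \<in> rat_intervals"
          using Int_stable_rat_intervals Jr by (auto simp: Int_stable_def)
        moreover have "indicator A t *\<^sub>R g t = indicator (A \<inter> J) t * f t" for t
          by (auto simp: g_def indicator_def)
        ultimately show ?case using z by (simp add: set_lebesgue_integral_def)
      next
        case empty then show ?case by (simp add: set_lebesgue_integral_def)
      next
        case (compl A)
        then have [measurable]: "A \<in> sets borel" by (simp add: borel_eq_rat_intervals)
        have u: "set_lebesgue_integral lborel UNIV g = 0"
          using z[OF Jr] by (simp add: set_lebesgue_integral_def g_def)
        have gA: "integrable lborel (\<lambda>t. indicator B t *\<^sub>R g t)" if "B \<in> sets borel" for B
          by (rule integrable_mult_indicator[OF _ gi]) (use that in simp)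
        have "set_lebesgue_integral lborel (UNIV - A) g = set_lebesgue_integral lborel UNIV g - set_lebesgue_integral lborel A g"
          unfolding set_lebesgue_integral_def
          by (subst Bochner_Integration.integral_diff[symmetric, OF gA gA])
             (auto intro!: Bochner_Integration.integral_cong simp: indicator_def)
        then show ?case using u compl by simp
      next
        case (union A)
        then have Am: "A i \<in> sets borel" for i by (auto simp: borel_eq_rat_intervals)
        have "set_lebesgue_integral lborel (\<Union>i. A i) g = (\<Sum>i. set_lebesgue_integral lborel (A i) g)"
          using union(1) Am
          by (intro lebesgue_integral_countable_add)
             (auto simp: disjoint_family_on_def set_integrable_def intro!: integrable_mult_indicator gi)
        then show ?case using union by simp
      qed
    qed
    then have "AE t in lborel. g t = 0" by (intro sigma_finite_measure.density_zero[OF sigma_finite_lborel] gi) simp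
    then show ?thesis by (simp add: g_def J_def)
  qed
  then have "AE t in lborel. \<forall>n. indicator {-real n<..<real n} t * f t = 0"
    unfolding AE_all_countable by (rule allI)
  then show ?thesis
  proof eventually_elim
    case (elim t)
    obtain n where n: "\<bar>t\<bar> < real n" using reals_Archimedean2 by blast
    then have "t \<in> {-real n<..<real n}" by auto
    then show ?case using elim[rule_format, of n] by simp
  qed
qed

definition ind_l2 :: "real set \<Rightarrow> l2" where
  "ind_l2 I = abs_l2 (indicator I)"

lemma cinner_ind_l2:
  assumes "I \<in> sets borel" "emeasure lborel I < \<infinity>"
  shows "cinner (ind_l2 I) x = (\<integral>t. indicator I t * rep_l2 x t \<partial>lborel)"
proof -
  have "cnj (indicator I t) = indicator I t" for t by (simp add: indicator_def)
  then show ?thesis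
    unfolding ind_l2_def
    by (subst cinner_abs_left) (use integrable_on_interval(2)[OF square_integrable_zero assms] in auto)
qed

lemma total_rat_intervals:
  assumes "\<And>I. I \<in> rat_intervals \<Longrightarrow> cinner (ind_l2 I) x = 0"
  shows "x = 0"
proof -
  have "AE t in lborel. rep_l2 x t = 0"
    by (rule AE_zero_if_integral_rat_intervals)
       (use assms rat_intervals_fin in \<open>auto simp: cinner_ind_l2\<close>)
  then have "abs_l2 (rep_l2 x) = abs_l2 (\<lambda>_. 0)"
    by (subst abs_l2_eq_iff) (auto simp: square_integrable_zero)
  then show ?thesis by (simp add: zero_l2_def)
qed

subsection \<open>Existence of an orthonormal basis\<close>

lemma orthonormal_ind_l2:
  assumes J: "\<And>i. i \<in> I \<Longrightarrow> J i \<in> sets borel" "\<And>i. i \<in> I \<Longrightarrow> emeasure lborel (J i) = 1"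
    and d: "disjoint_family_on J I"
  shows "orthonormal_on I (\<lambda>i. ind_l2 (J i))"
  unfolding orthonormal_on_def
proof (intro ballI)
  fix i j assume ij: "i \<in> I" "j \<in> I"
  have s: "square_integrable lborel (indicator (J j) :: real \<Rightarrow> complex)"
    using integrable_on_interval(2)[OF square_integrable_zero, of "J j"] J ij by simp
  have "cinner (ind_l2 (J i)) (ind_l2 (J j)) = (\<integral>t. indicator (J i) t * rep_l2 (ind_l2 (J j)) t \<partial>lborel)"
    using J ij by (simp add: cinner_ind_l2)
  also have "\<dots> = (\<integral>t. indicator (J i) t * indicator (J j) t \<partial>lborel)"
  proof (rule integral_cong_AE)
    show "AE t in lborel. indicator (J i) t * rep_l2 (ind_l2 (J j)) t = indicator (J i) t * indicator (J j) t"
      using rep_abs_l2[OF s] unfolding ind_l2_def by eventually_elim simp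
  qed (use J ij in measurable)
  also have "\<dots> = (\<integral>t. complex_of_real (indicator (J i \<inter> J j) t) \<partial>lborel)"
    by (intro Bochner_Integration.integral_cong) (auto simp: indicator_def)
  also have "\<dots> = complex_of_real (measure lborel (J i \<inter> J j))"
    unfolding integral_complex_of_real by simp
  also have "\<dots> = (if i = j then 1 else 0)"
    using d ij J(2) by (auto simp: disjoint_family_on_def measure_def)
  finally show "cinner (ind_l2 (J i)) (ind_l2 (J j)) = (if i = j then 1 else 0)" .
qed

lemma maximal_orthonormal_set:
  "\<exists>S. orthonormal_on S id \<and> (\<forall>x. (\<forall>s\<in>S. cinner s x = 0) \<longrightarrow> x = 0)"
proof -
  define \<A> where "\<A> = {S. orthonormal_on S (id :: l2 \<Rightarrow> l2)}"
  have "\<exists>M\<in>\<A>. \<forall>X\<in>\<A>. M \<subseteq> X \<longrightarrow> X = M"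
  proof (rule subset_Zorn')
    fix C assume C: "subset.chain \<A> C"
    show "\<Union>C \<in> \<A>"
      unfolding \<A>_def mem_Collect_eq orthonormal_on_def
    proof (intro ballI)
      fix x y assume "x \<in> \<Union>C" "y \<in> \<Union>C"
      then obtain X Y where XY: "X \<in> C" "x \<in> X" "Y \<in> C" "y \<in> Y" by auto
      then have "X \<subseteq> Y \<or> Y \<subseteq> X" using C by (auto simp: subset_chain_def)
      then obtain Z where "Z \<in> C" "x \<in> Z" "y \<in> Z" using XY by blast
      moreover then have "orthonormal_on Z (id :: l2 \<Rightarrow> l2)" using C by (auto simp: subset_chain_def \<A>_def)
      ultimately show "cinner (id x) (id y) = (if x = y then 1 else 0)"
        by (simp add: orthonormal_on_def)
    qed
  qed
  then obtain S where S: "orthonormal_on S id" "\<And>X. orthonormal_on X id \<Longrightarrow> S \<subseteq> X \<Longrightarrow> X = S"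
    by (auto simp: \<A>_def)
  have "x = 0" if x: "\<And>s. s \<in> S \<Longrightarrow> cinner s x = 0" for x
  proof (rule ccontr)
    assume nz: "x \<noteq> 0"
    define y where "y = (1 / norm x) *\<^sub>R x"
    have yy: "cinner y y = 1" using nz by (simp add: cinner_self y_def)
    have sy: "cinner s y = 0" "cinner y s = 0" if "s \<in> S" for s
      using x[OF that] cinner_commute[of y s] by (auto simp: y_def)
    have "orthonormal_on (insert y S) id"
      using S(1) yy sy unfolding orthonormal_on_def by auto
    then have "insert y S = S" by (rule S(2)) auto
    then have "cinner y y = 0" using sy by auto
    then show False using yy by simp
  qed
  with S(1) show ?thesis by blast
qed

text \<open>The trace is defined through a chosen orthonormal basis, so a basis must be exhibited before any
  trace can be computed.  A maximal orthonormal set is countable, because each of its members has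
  a nonzero inner product with one of countably many interval indicators, and Bessel's inequality
  allows only countably many members for each indicator.  It is infinite, because a finite one
  would contradict Bessel's inequality for the indicators of many disjoint unit intervals.\<close>

lemma ex_orthonormal_basis: "\<exists>e. orthonormal_basis e"
proof -
  obtain S where S: "orthonormal_on S id" and tot: "\<And>x. (\<And>s. s \<in> S \<Longrightarrow> cinner s x = 0) \<Longrightarrow> x = 0"
    using maximal_orthonormal_set by blast
  have fin: "finite {s \<in> S. cmod (cinner s x) > 1 / Suc n}" for x n
  proof (rule ccontr)
    assume inf: "infinite {s \<in> S. cmod (cinner s x) > 1 / Suc n}"
    obtain m :: nat where m: "(norm x)\<^sup>2 * (Suc n)\<^sup>2 < real m" using reals_Archimedean2 by blast
    obtain F where F: "F \<subseteq> {s \<in> S. cmod (cinner s x) > 1 / Suc n}" "finite F" "card F = m"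
      using infinite_arbitrarily_large[OF inf] by metis
    have "real m * (1 / Suc n)\<^sup>2 = (\<Sum>s\<in>F. (1 / Suc n)\<^sup>2)" by (simp add: F)
    also have "\<dots> \<le> (\<Sum>s\<in>F. (cmod (cinner (id s) x))\<^sup>2)"
      by (intro sum_mono power_mono) (use F in \<open>auto simp: less_imp_le\<close>)
    also have "\<dots> \<le> (norm x)\<^sup>2"
      by (rule Bessel_finite[OF orthonormal_on_subset[OF S]]) (use F in auto)
    finally show False using m by (simp add: field_simps)
  qed
  have cnt: "countable {s \<in> S. cinner s x \<noteq> 0}" for x
  proof -
    have "{s \<in> S. cinner s x \<noteq> 0} \<subseteq> (\<Union>n. {s \<in> S. cmod (cinner s x) > 1 / Suc n})"
    proof
      fix s assume s: "s \<in> {s \<in> S. cinner s x \<noteq> 0}"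
      then obtain n where "inverse (real (Suc n)) < cmod (cinner s x)"
        using reals_Archimedean[of "cmod (cinner s x)"] by auto
      then show "s \<in> (\<Union>n. {s \<in> S. cmod (cinner s x) > 1 / Suc n})"
        using s by (auto simp: inverse_eq_divide)
    qed
    then show ?thesis by (rule countable_subset) (intro countable_UN countable_finite fin countableI_type)
  qed
  have "S \<subseteq> (\<Union>I\<in>rat_intervals. {s \<in> S. cinner s (ind_l2 I) \<noteq> 0})"
  proof
    fix s assume s: "s \<in> S"
    then have "s \<noteq> 0" using orthonormal_onD[OF S s s] by auto
    then obtain I where I: "I \<in> rat_intervals" "cinner (ind_l2 I) s \<noteq> 0"
      using total_rat_intervals by blast
    then have "cinner s (ind_l2 I) \<noteq> 0" by (subst cinner_commute) simp
    with I s show "s \<in> (\<Union>I\<in>rat_intervals. {s \<in> S. cinner s (ind_l2 I) \<noteq> 0})" by auto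
  qed
  then have cS: "countable S"
    by (rule countable_subset) (intro countable_UN countable_rat_intervals cnt)
  have iS: "infinite S"
  proof
    assume fS: "finite S"
    define J where "J i = {real i<..<real i + 1}" for i :: nat
    have g: "orthonormal_on {..card S} (\<lambda>i. ind_l2 (J i))"
    proof (rule orthonormal_ind_l2)
      show "disjoint_family_on J {..card S}" unfolding disjoint_family_on_def J_def by force
    qed (auto simp: J_def)
    have "x = (\<Sum>s\<in>S. l2_scaleC (cinner (id s) x) (id s))" for x
    proof -
      have "x - (\<Sum>s\<in>S. l2_scaleC (cinner (id s) x) (id s)) = 0"
        by (rule tot) (use orthonormal_cinner_sum[OF S fS, of _ "\<lambda>s. cinner (id s) x"] in \<open>simp add: cinner_diff_right\<close>)
      then show ?thesis by simp
    qed
    then have P: "(norm x)\<^sup>2 = (\<Sum>s\<in>S. (cmod (cinner s x))\<^sup>2)" for x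
      using norm_orthonormal_sum[OF S fS, of "\<lambda>s. cinner (id s) x"] by simp
    have "real (Suc (card S)) = (\<Sum>i\<le>card S. (norm (ind_l2 (J i)))\<^sup>2)"
      using orthonormal_on_norm[OF g] by simp
    also have "\<dots> = (\<Sum>s\<in>S. \<Sum>i\<le>card S. (cmod (cinner s (ind_l2 (J i))))\<^sup>2)"
      unfolding P by (rule sum.swap)
    also have "\<dots> = (\<Sum>s\<in>S. \<Sum>i\<le>card S. (cmod (cinner (ind_l2 (J i)) s))\<^sup>2)"
      by (intro sum.cong refl) (metis cinner_commute complex_mod_cnj)
    also have "\<dots> \<le> (\<Sum>s\<in>S. (norm s)\<^sup>2)"
      by (intro sum_mono Bessel_finite g) auto
    also have "\<dots> = card S" using orthonormal_on_norm[OF S] by simp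
    finally show False by simp
  qed
  define e where "e = from_nat_into S"
  have bij: "bij_betw e UNIV S" unfolding e_def using cS iS by (rule bij_betw_from_nat_into)
  then have inj: "inj e" and ran: "range e = S" by (auto simp: bij_betw_def)
  have oe: "orthonormal_on UNIV e"
    using S ran inj unfolding orthonormal_on_def by (auto simp: inj_eq)
  have "(\<lambda>i. l2_scaleC (cinner (e i) x) (e i)) sums x" for x
  proof -
    define c where "c i = cinner (e i) x" for i
    have o: "orthonormal_on I e" for I using oe by (rule orthonormal_on_subset) simp
    have "summable (\<lambda>i. (cmod (c i))\<^sup>2)"
      by (rule bounded_imp_summable[where B = "(norm x)\<^sup>2"])
         (auto simp: c_def intro!: Bessel_finite o)
    then have "summable (\<lambda>i. l2_scaleC (c i) (e i))"
      unfolding summable_Cauchy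
    proof (intro allI impI)
      fix r :: real assume *: "\<forall>e>0. \<exists>N. \<forall>m\<ge>N. \<forall>n. norm (\<Sum>i\<in>{m..<n}. (cmod (c i))\<^sup>2) < e" and r: "r > 0"
      then obtain N where N: "\<And>m n. m \<ge> N \<Longrightarrow> norm (\<Sum>i\<in>{m..<n}. (cmod (c i))\<^sup>2) < r\<^sup>2"
        by (meson zero_less_power)
      have "norm (\<Sum>i\<in>{m..<n}. l2_scaleC (c i) (e i)) < r" if "m \<ge> N" for m n
      proof -
        have "(norm (\<Sum>i\<in>{m..<n}. l2_scaleC (c i) (e i)))\<^sup>2 < r\<^sup>2"
          using N[OF that, of n] by (subst norm_orthonormal_sum[OF o]) auto
        then show ?thesis using r by (simp add: power2_less_imp_less)
      qed
      then show "\<exists>N. \<forall>m\<ge>N. \<forall>n. norm (\<Sum>i\<in>{m..<n}. l2_scaleC (c i) (e i)) < r" by blast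
    qed
    then obtain y where y: "(\<lambda>i. l2_scaleC (c i) (e i)) sums y" by (auto simp: summable_def)
    have bl: "bounded_linear (\<lambda>y. cinner z y)" for z
      by (rule bounded_linear_intro[where K = "norm z"])
         (auto simp: cinner_add_right scaleR_conv_of_real mult.commute intro: order_trans[OF cmod_cinner_le])
    have "cinner (e j) y = c j" for j
    proof -
      have "(\<lambda>i. cinner (e j) (l2_scaleC (c i) (e i))) sums cinner (e j) y"
        by (rule bounded_linear.sums[OF bl y])
      moreover have "(\<lambda>i. cinner (e j) (l2_scaleC (c i) (e i))) = (\<lambda>i. if i = j then c i else 0)"
        using oe by (auto simp: fun_eq_iff orthonormal_on_def)
      ultimately show ?thesis using sums_single[of j c] sums_unique2 by metis
    qed
    then have "cinner s (x - y) = 0" if "s \<in> S" for s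
      using that ran by (auto simp: cinner_diff_right c_def)
    then have "x - y = 0" by (rule tot)
    then show ?thesis using y by (simp add: c_def)
  qed
  then have "orthonormal_basis e"
    using oe by (simp add: orthonormal_basis_def orthonormal_on_def)
  then show ?thesis by blast
qed

section \<open>Functional calculus of a positive operator\<close>

text \<open>Symmetry with respect to the real inner product suffices for the functional calculus;
  complex-linearity is carried along separately as membership in \<open>bounded_ops\<close>.\<close>

definition op_psd :: "l2op \<Rightarrow> bool" where
  "op_psd P \<longleftrightarrow> (\<forall>x y. P x \<bullet> y = x \<bullet> P y) \<and> (\<forall>x. 0 \<le> x \<bullet> P x)"

lemma op_psd_sym: "op_psd P \<Longrightarrow> P x \<bullet> y = x \<bullet> P y"
  by (simp add: op_psd_def)

lemma op_psd_nonneg: "op_psd P \<Longrightarrow> 0 \<le> x \<bullet> P x"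
  by (simp add: op_psd_def)

subsection \<open>Polynomials of an operator\<close>

lemma op_poly_apply:
  assumes "degree q \<le> N"
  shows "op_poly q P x = (\<Sum>i\<le>N. coeff q i *\<^sub>R ((blinfun_apply P ^^ i) x))"
proof -
  have pow: "blinfun_apply (((o\<^sub>L) P ^^ i) id_blinfun) x = (blinfun_apply P ^^ i) x" for i
    by (induction i) auto
  have "op_poly q P x = (\<Sum>i\<le>degree q. coeff q i *\<^sub>R ((blinfun_apply P ^^ i) x))"
    by (simp add: op_poly_def blinfun.sum_left blinfun.scaleR_left pow)
  also have "\<dots> = (\<Sum>i\<le>N. coeff q i *\<^sub>R ((blinfun_apply P ^^ i) x))"
    by (rule sum.mono_neutral_left) (use assms in \<open>auto simp: coeff_eq_0\<close>)
  finally show ?thesis .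
qed

lemma op_poly_add: "op_poly (p + q) P x = op_poly p P x + op_poly q P x"
  using op_poly_apply[of "p + q" "max (degree p) (degree q)" P x]
    op_poly_apply[of p "max (degree p) (degree q)" P x] op_poly_apply[of q "max (degree p) (degree q)" P x]
  by (simp add: degree_add_le scaleR_left_distrib sum.distrib)

lemma op_poly_smult: "op_poly (smult c q) P x = c *\<^sub>R op_poly q P x"
  using op_poly_apply[of "smult c q" "degree q" P x] op_poly_apply[of q "degree q" P x]
  by (simp add: degree_smult_le scaleR_sum_right)

lemma op_poly_diff: "op_poly (p - q) P x = op_poly p P x - op_poly q P x"
  using op_poly_add[of p "- q" P x] op_poly_smult[of "-1" q P x] by simp

lemma op_poly_0 [simp]: "op_poly 0 P x = 0"
  using op_poly_apply[of 0 0 P x] by simp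

lemma op_poly_pCons [simp]: "op_poly (pCons a q) P x = a *\<^sub>R x + P (op_poly q P x)"
proof -
  have "op_poly (pCons a q) P x = (\<Sum>i\<le>Suc (degree q). coeff (pCons a q) i *\<^sub>R ((blinfun_apply P ^^ i) x))"
    by (rule op_poly_apply) (rule degree_pCons_le)
  also have "\<dots> = a *\<^sub>R x + (\<Sum>i\<le>degree q. coeff q i *\<^sub>R ((blinfun_apply P ^^ Suc i) x))"
    by (subst sum.atMost_Suc_shift) simp
  also have "(\<Sum>i\<le>degree q. coeff q i *\<^sub>R ((blinfun_apply P ^^ Suc i) x)) = P (op_poly q P x)"
    by (simp add: op_poly_apply[OF order_refl] blinfun.sum_right blinfun.scaleR_right)
  finally show ?thesis .
qed

lemma op_poly_mult: "op_poly (p * q) P x = op_poly p P (op_poly q P x)"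
  by (induction p) (auto simp: op_poly_add op_poly_smult)

lemma op_poly_sym:
  assumes "op_psd P"
  shows "op_poly q P x \<bullet> y = x \<bullet> op_poly q P y"
proof (induction q arbitrary: x y)
  case (pCons a q)
  have "P (op_poly q P x) \<bullet> y = x \<bullet> op_poly q P (P y)"
    by (simp add: op_psd_sym[OF assms] pCons.IH)
  also have "op_poly q P (P y) = P (op_poly q P y)"
    using op_poly_mult[of q "[:0,1:]" P y] op_poly_mult[of "[:0,1:]" q P y] by (simp add: mult.commute)
  finally show ?case by (simp add: inner_add_left inner_add_right)
qed simp

lemma op_poly_conj_nonneg:
  assumes "op_psd P" "\<And>x. 0 \<le> x \<bullet> op_poly g P x"
  shows "0 \<le> x \<bullet> op_poly (u * (g * u)) P x"
  using assms(2)[of "op_poly u P x"] by (simp add: op_poly_mult flip: op_poly_sym[OF assms(1)])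

subsection \<open>Positivity of the polynomial calculus\<close>

lemma norm_blinfun_apply_le: "norm P \<le> M \<Longrightarrow> norm (blinfun_apply P x) \<le> M * norm x"
  by (rule order_trans[OF norm_blinfun mult_right_mono]) auto

text \<open>Positivity of \<open>P(M - P)\<close>, obtained by testing positivity of \<open>P\<close> on \<open>x - Px/M\<close>.\<close>

lemma psd_norm_apply_square_le:
  assumes P: "op_psd P" and M: "norm P \<le> M" "M > 0"
  shows "P x \<bullet> P x \<le> M * (x \<bullet> P x)"
proof -
  define c where "c = P x \<bullet> P x"
  have b: "P x \<bullet> P (P x) \<le> M * c"
  proof -
    have "P x \<bullet> P (P x) \<le> norm (P x) * norm (P (P x))" by (rule norm_cauchy_schwarz)
    also have "\<dots> \<le> norm (P x) * (M * norm (P x))"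
      by (intro mult_left_mono norm_blinfun_apply_le M) auto
    also have "\<dots> = M * c" by (simp add: c_def power2_eq_square flip: power2_norm_eq_inner)
    finally show ?thesis .
  qed
  define s where "s = 1 / M"
  have "0 \<le> (x - s *\<^sub>R P x) \<bullet> P (x - s *\<^sub>R P x)" by (rule op_psd_nonneg[OF P])
  also have "\<dots> = x \<bullet> P x - 2 * s * c + s * s * (P x \<bullet> P (P x))"
    using op_psd_sym[OF P, of x "P x"]
    by (simp add: blinfun.diff_right blinfun.scaleR_right inner_diff_left inner_diff_right c_def inner_commute algebra_simps)
  also have "\<dots> \<le> x \<bullet> P x - 2 * s * c + s * s * (M * c)"
    using b by (intro add_left_mono mult_left_mono) (auto simp: s_def)
  also have "\<dots> = x \<bullet> P x - c / M" using M by (simp add: s_def field_simps)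
  finally show ?thesis using M by (simp add: c_def field_simps)
qed

lemma poly_nonneg_closure:
  assumes "\<And>t. t \<in> S \<Longrightarrow> 0 \<le> poly r t" "t0 \<in> closure S"
  shows "0 \<le> poly r (t0::real)"
  by (rule continuous_ge_on_closure[of S "poly r" t0 0]) (use assms in \<open>auto intro!: continuous_intros\<close>)

text \<open>A polynomial that is nonnegative on \<open>[0, M]\<close> gives a positive operator; no spectral theorem is
  used.  The induction is on the degree: subtract the minimum of \<open>q\<close> on the interval and split off
  the zero that this creates.  An interior zero is double, and the factor \<open>(t - t\<^sub>0)\<^sup>2\<close> acts as a
  conjugation, which preserves positivity.  A zero at an endpoint leaves a factor \<open>t\<close> or \<open>M - t\<close>.  The
  four weights are there to absorb these factors: the set is closed under multiplication by \<open>t\<close> and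
  by \<open>M - t\<close> up to squares.\<close>

lemma op_poly_weighted_nonneg:
  assumes P: "op_psd P" and M: "norm P \<le> M" "M > 0"
    and w: "w \<in> {1, [:0, 1:], [:M, -1:], [:0, 1:] * [:M, -1:]}"
    and q: "\<And>t. t \<in> {0..M} \<Longrightarrow> 0 \<le> poly q t"
  shows "0 \<le> x \<bullet> op_poly (w * q) P x"
  using q w
proof (induction "degree q" arbitrary: q w x rule: less_induct)
  case less
  define X :: "real poly" where "X = [:0, 1:]"
  define Y :: "real poly" where "Y = [:M, -1:]"
  have wXY: "w = 1 \<or> w = X \<or> w = Y \<or> w = X * Y" using less.prems(2) by (auto simp: X_def Y_def)
  have base: "0 \<le> x \<bullet> op_poly w P x" for x
  proof -
    have "x \<bullet> P x \<le> norm x * norm (P x)" by (rule norm_cauchy_schwarz)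
    also have "\<dots> \<le> norm x * (M * norm x)"
      by (intro mult_left_mono norm_blinfun_apply_le M) auto
    finally have "x \<bullet> P x \<le> M * (x \<bullet> x)" by (simp add: power2_eq_square mult_ac flip: power2_norm_eq_inner)
    moreover have "x \<bullet> P (P x) \<le> M * (x \<bullet> P x)"
      using psd_norm_apply_square_le[OF P M, of x] by (simp add: op_psd_sym[OF P])
    ultimately show ?thesis
      using wXY op_psd_nonneg[OF P, of x]
      by (auto simp: X_def Y_def one_pCons inner_diff_right inner_add_right blinfun.diff_right blinfun.add_right
          blinfun.minus_right blinfun.scaleR_right)
  qed
  have IH: "0 \<le> x \<bullet> op_poly (v * r) P x"
    if "degree r < degree q" "\<And>t. t \<in> {0..M} \<Longrightarrow> 0 \<le> poly r t" "v \<in> {1, X, Y, X * Y}" for r v x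
    using less.hyps[OF that(1,2)] that(3) by (simp add: X_def Y_def)
  note cj = op_poly_conj_nonneg[OF P]
  show ?case
  proof (cases "degree q = 0")
    case True
    then obtain c where c: "q = [:c:]" by (auto elim: degree_eq_zeroE)
    then have "c \<ge> 0" using less.prems(1)[of 0] M by simp
    moreover have "w * q = smult c w" using c by simp
    ultimately show ?thesis using base[of x] by (simp add: op_poly_smult)
  next
    case False
    have "\<exists>t0\<in>{0..M}. \<forall>t\<in>{0..M}. poly q t0 \<le> poly q t"
      by (rule continuous_attains_inf) (use M in \<open>auto intro: continuous_intros\<close>)
    then obtain t0 where t0: "t0 \<in> {0..M}" "\<And>t. t \<in> {0..M} \<Longrightarrow> poly q t0 \<le> poly q t" by blast
    define \<mu> where "\<mu> = poly q t0"
    have mu: "\<mu> \<ge> 0" using less.prems(1) t0 by (simp add: \<mu>_def)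
    have "[:-t0, 1:] dvd q - [:\<mu>:]" by (simp add: \<mu>_def flip: poly_eq_0_iff_dvd)
    then obtain r where r: "q - [:\<mu>:] = [:-t0, 1:] * r" by (elim dvdE)
    have qr: "q = [:\<mu>:] + [:-t0, 1:] * r" using r by (simp add: algebra_simps)
    have "degree [:- \<mu>:] < degree q" using False by simp
    from degree_add_eq_left[OF this] have dq: "degree (q - [:\<mu>:]) = degree q"
      by (metis add_uminus_conv_diff minus_pCons minus_zero)
    have rnz: "r \<noteq> 0"
    proof
      assume "r = 0" then show False using qr False by simp
    qed
    then have dr: "degree r < degree q"
      using dq unfolding r by (subst (asm) degree_mult_eq) auto
    have sgn: "0 \<le> (t - t0) * poly r t" if "t \<in> {0..M}" for t
    proof -
      have "(t - t0) * poly r t = poly q t - \<mu>" by (subst qr) (simp add: algebra_simps)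
      then show ?thesis using t0(2)[OF that] by (simp add: \<mu>_def)
    qed
    have right: "0 \<le> poly r t" if "t0 < t" "t \<le> M" for t
      using sgn[of t] that t0(1) by (simp add: zero_le_mult_iff)
    have left: "0 \<le> poly (- r) t" if "0 \<le> t" "t < t0" for t
      using sgn[of t] that t0(1) by (simp add: zero_le_mult_iff)
    have "0 \<le> x \<bullet> op_poly (w * ([:-t0, 1:] * r)) P x"
    proof -
      consider "t0 = 0" | "t0 = M" "t0 \<noteq> 0" | "0 < t0" "t0 < M" using t0(1) by fastforce
      then show ?thesis
      proof cases
        case 1
        have "0 \<le> poly r t" if "t \<in> {0..M}" for t
          using poly_nonneg_closure[of "{0<..<M}" r t] right that 1 M
          by (auto simp: closure_greaterThanLessThan)
        note I = IH[OF dr this]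
        have e: "w * ([:-t0, 1:] * r) = w * (X * r)" by (simp add: X_def 1)
        show ?thesis unfolding e using wXY
        proof (elim disjE)
          assume "w = 1" then show "0 \<le> x \<bullet> op_poly (w * (X * r)) P x" using I[of X] by simp
        next
          assume w: "w = X"
          show "0 \<le> x \<bullet> op_poly (w * (X * r)) P x" using cj[where g = "1 * r" and u = X, OF I[of 1]] w by (simp add: mult_ac)
        next
          assume w: "w = Y"
          then show "0 \<le> x \<bullet> op_poly (w * (X * r)) P x" using I[of "X * Y"] by (simp add: mult_ac)
        next
          assume w: "w = X * Y"
          then show "0 \<le> x \<bullet> op_poly (w * (X * r)) P x" using cj[where g = "Y * r" and u = X, OF I[of Y]] w by (simp add: mult_ac)
        qed
      next
        case 2
        have "0 \<le> poly (- r) t" if "t \<in> {0..M}" for t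
          using poly_nonneg_closure[of "{0<..<M}" "- r" t] left that 2 M
          by (auto simp: closure_greaterThanLessThan)
        then have I: "0 \<le> x \<bullet> op_poly (v * (- r)) P x" if "v \<in> {1, X, Y, X * Y}" for v x
          using that dr by (intro IH) auto
        have e: "w * ([:-t0, 1:] * r) = w * (Y * (- r))" by (simp add: Y_def 2)
        show ?thesis unfolding e using wXY
        proof (elim disjE)
          assume "w = 1" then show "0 \<le> x \<bullet> op_poly (w * (Y * (- r))) P x" using I[of Y] by simp
        next
          assume w: "w = X"
          then show "0 \<le> x \<bullet> op_poly (w * (Y * (- r))) P x" using I[of "X * Y"] by (simp add: mult_ac)
        next
          assume w: "w = Y"
          show "0 \<le> x \<bullet> op_poly (w * (Y * (- r))) P x" using cj[where g = "1 * (- r)" and u = Y, OF I[of 1]] w by (simp add: mult_ac)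
        next
          assume w: "w = X * Y"
          then show "0 \<le> x \<bullet> op_poly (w * (Y * (- r))) P x" using cj[where g = "X * (- r)" and u = Y, OF I[of X]] w by (simp add: mult_ac)
        qed
      next
        case 3
        have "0 \<le> poly r t0"
          by (rule poly_nonneg_closure[of "{t0<..<M}"]) (use right 3 in \<open>auto simp: closure_greaterThanLessThan\<close>)
        moreover have "0 \<le> poly (- r) t0"
          by (rule poly_nonneg_closure[of "{0<..<t0}"]) (use left 3 in \<open>auto simp: closure_greaterThanLessThan\<close>)
        ultimately have "poly r t0 = 0" by simp
        then obtain s where s: "r = [:-t0, 1:] * s" by (auto simp: poly_eq_0_iff_dvd elim: dvdE)
        have snz: "s \<noteq> 0" using rnz s by auto
        have ds: "degree s < degree q" using dr s snz by (subst (asm) s) (subst (asm) degree_mult_eq, auto)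
        have s0: "0 \<le> poly s t" if "t \<in> {0..M} - {t0}" for t
        proof -
          have "(t - t0) * poly r t = (t - t0)\<^sup>2 * poly s t" by (simp add: s power2_eq_square algebra_simps)
          then show ?thesis using sgn[of t] that by (simp add: zero_le_mult_iff)
        qed
        have "0 \<le> poly s t0"
          by (rule poly_nonneg_closure[of "{t0<..<M}"]) (use s0 3 in \<open>auto simp: closure_greaterThanLessThan\<close>)
        then have "0 \<le> poly s t" if "t \<in> {0..M}" for t using s0 that by (cases "t = t0") auto
        note I = IH[OF ds this]
        have "0 \<le> x \<bullet> op_poly ([:-t0, 1:] * ((w * s) * [:-t0, 1:])) P x"
          by (rule cj) (rule I, use wXY in auto)
        then show ?thesis unfolding s by (simp only: mult_ac)
      qed
    qed
    moreover have "w * q = smult \<mu> w + w * ([:-t0, 1:] * r)"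
      by (subst qr) (simp add: algebra_simps)
    ultimately show ?thesis
      using base[of x] mu by (simp only: op_poly_add op_poly_smult inner_add_right inner_scaleR_right) simp
  qed
qed

lemma op_poly_zero_op: "op_poly q 0 x = poly q 0 *\<^sub>R x"
  by (induction q) auto

lemma op_poly_nonneg:
  assumes P: "op_psd P" and q: "\<And>t. t \<in> {0..norm P} \<Longrightarrow> 0 \<le> poly q t"
  shows "0 \<le> x \<bullet> op_poly q P x"
proof (cases "P = 0")
  case True
  then show ?thesis using q[of 0] by (simp add: op_poly_zero_op)
next
  case False
  then show ?thesis
    using op_poly_weighted_nonneg[OF P order_refl, of 1 q x] q by simp
qed

lemma op_poly_norm_le:
  assumes P: "op_psd P" and q: "\<And>t. t \<in> {0..norm P} \<Longrightarrow> \<bar>poly q t\<bar> \<le> s"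
  shows "norm (op_poly q P) \<le> s"
proof -
  have s: "s \<ge> 0" using q[of 0] by simp
  show ?thesis
  proof (rule norm_blinfun_bound[OF s])
    fix x
    have "0 \<le> x \<bullet> op_poly ([:s\<^sup>2:] - q * q) P x"
    proof (rule op_poly_nonneg[OF P])
      fix t assume "t \<in> {0..norm P}"
      then have "(poly q t)\<^sup>2 \<le> s\<^sup>2" using q by (metis abs_ge_zero power2_abs power_mono)
      then show "0 \<le> poly ([:s\<^sup>2:] - q * q) t" by (simp add: power2_eq_square)
    qed
    then have "(norm (op_poly q P x))\<^sup>2 \<le> (s * norm x)\<^sup>2"
      by (simp add: op_poly_diff op_poly_mult inner_diff_right power_mult_distrib power2_norm_eq_inner
          op_poly_sym[OF P])
    then show "norm (op_poly q P x) \<le> s * norm x"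
      by (rule power2_le_imp_le) (use s in simp)
  qed
qed

subsection \<open>Continuous functions of an operator\<close>

text \<open>The property that singles out the value of \<open>op_cfc\<close>.\<close>

definition cfc_limit :: "(real \<Rightarrow> real) \<Rightarrow> l2op \<Rightarrow> l2op \<Rightarrow> bool" where
  "cfc_limit g P B \<longleftrightarrow> (\<forall>\<epsilon>>0. \<exists>q. (\<forall>t\<in>{0..norm P}. \<bar>poly q t - g t\<bar> \<le> \<epsilon>) \<and> norm (op_poly q P - B) \<le> \<epsilon>)"

lemma cfc_limit_unique:
  assumes P: "op_psd P" and B: "cfc_limit g P B" "cfc_limit g P B'"
  shows "B = B'"
proof -
  have "norm (B - B') \<le> e" if "e > 0" for e
  proof -
    have e4: "e / 4 > 0" using that by simp
    obtain q where q: "\<forall>t\<in>{0..norm P}. \<bar>poly q t - g t\<bar> \<le> e/4" "norm (op_poly q P - B) \<le> e/4"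
      using B(1)[unfolded cfc_limit_def, rule_format, OF e4] by blast
    obtain q' where q': "\<forall>t\<in>{0..norm P}. \<bar>poly q' t - g t\<bar> \<le> e/4" "norm (op_poly q' P - B') \<le> e/4"
      using B(2)[unfolded cfc_limit_def, rule_format, OF e4] by blast
    have "norm (op_poly (q - q') P) \<le> e / 2"
    proof (rule op_poly_norm_le[OF P])
      fix t assume "t \<in> {0..norm P}"
      then have "\<bar>poly q t - g t\<bar> \<le> e/4" "\<bar>poly q' t - g t\<bar> \<le> e/4" using q q' by auto
      then show "\<bar>poly (q - q') t\<bar> \<le> e / 2" unfolding poly_diff by linarith
    qed
    moreover have "op_poly (q - q') P = op_poly q P - op_poly q' P"
      by (rule blinfun_eqI) (simp add: op_poly_diff blinfun.diff_left)
    ultimately have d: "dist (op_poly q P) (op_poly q' P) \<le> e / 2" by (simp only: dist_norm)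
    have "dist B B' \<le> dist B (op_poly q P) + dist (op_poly q P) (op_poly q' P) + dist (op_poly q' P) B'"
      using dist_triangle[of B B' "op_poly q P"] dist_triangle[of "op_poly q P" B' "op_poly q' P"] by linarith
    moreover have "dist B (op_poly q P) \<le> e / 4" using q(2) by (subst dist_commute) (simp only: dist_norm)
    moreover have "dist (op_poly q' P) B' \<le> e / 4" using q'(2) by (simp only: dist_norm)
    ultimately have "dist B B' \<le> e" using d by linarith
    then show ?thesis by (simp only: dist_norm)
  qed
  then have "norm (B - B') \<le> 0 + e" if "e > 0" for e using that by simp
  then have "norm (B - B') \<le> 0" by (rule field_le_epsilon)
  then show ?thesis by simp
qed

lemma cfc_limit_op_cfc:
  assumes P: "op_psd P" and B: "cfc_limit g P B"
  shows "op_cfc g P = B"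
  unfolding op_cfc_def cfc_limit_def[symmetric]
  using B cfc_limit_unique[OF P _ B] by (rule the_equality)

text \<open>The Weierstrass theorem supplies the polynomials, the norm bound makes their values at \<open>P\<close> a
  Cauchy sequence, and completeness of the operator space supplies the limit.\<close>

lemma op_cfc_limit:
  assumes P: "op_psd P" and g: "continuous_on {0..norm P} g"
  shows "cfc_limit g P (op_cfc g P)"
proof -
  have ap: "\<exists>q. \<forall>t\<in>{0..norm P}. \<bar>poly q t - g t\<bar> \<le> e" if e: "e > 0" for e
  proof -
    obtain h where h: "real_polynomial_function h" "\<And>t. t \<in> {0..norm P} \<Longrightarrow> \<bar>g t - h t\<bar> < e"
      using Stone_Weierstrass_real_polynomial_function[OF compact_Icc g e] by metis
    obtain a n where an: "h = (\<lambda>x. \<Sum>i\<le>n. a i * x ^ i)" using h(1) real_polynomial_function_iff_sum by metis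
    define q where "q = (\<Sum>i\<le>n. monom (a i) i)"
    have "poly q t = h t" for t by (simp add: q_def an poly_sum poly_monom)
    then show ?thesis using h(2) by (intro exI[of _ q]) (auto simp: abs_minus_commute less_imp_le)
  qed
  have "\<forall>n. \<exists>q. \<forall>t\<in>{0..norm P}. \<bar>poly q t - g t\<bar> \<le> 1 / real (Suc n)" using ap by simp
  then obtain q where q: "\<And>n t. t \<in> {0..norm P} \<Longrightarrow> \<bar>poly (q n) t - g t\<bar> \<le> 1 / real (Suc n)" by metis
  have d: "norm (op_poly (q m) P - op_poly (q n) P) \<le> 1 / real (Suc m) + 1 / real (Suc n)" for m n
  proof -
    have "op_poly (q m) P - op_poly (q n) P = op_poly (q m - q n) P"
      by (rule blinfun_eqI) (simp add: op_poly_diff blinfun.diff_left)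
    moreover have "norm (op_poly (q m - q n) P) \<le> 1 / real (Suc m) + 1 / real (Suc n)"
    proof (rule op_poly_norm_le[OF P])
      fix t assume "t \<in> {0..norm P}"
      from q[OF this, of m] q[OF this, of n]
      show "\<bar>poly (q m - q n) t\<bar> \<le> 1 / real (Suc m) + 1 / real (Suc n)" unfolding poly_diff by linarith
    qed
    ultimately show ?thesis by simp
  qed
  have small: "1 / real (Suc m) \<le> e" if "m \<ge> N" "1 / real (Suc N) \<le> e" for m N e
  proof -
    have "1 / real (Suc m) \<le> 1 / real (Suc N)" using that by (simp add: frac_le)
    then show ?thesis using that by linarith
  qed
  have arch: "\<exists>N. 1 / real (Suc N) \<le> e" if "e > 0" for e
    using reals_Archimedean[OF that] by (auto simp: inverse_eq_divide intro: less_imp_le)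
  have "Cauchy (\<lambda>n. op_poly (q n) P)"
  proof (rule CauchyI)
    fix e :: real assume e: "0 < e"
    then obtain N where N: "1 / real (Suc N) \<le> e / 3" using arch[of "e/3"] by auto
    have "norm (op_poly (q m) P - op_poly (q n) P) < e" if "m \<ge> N" "n \<ge> N" for m n
      using d[of m n] small[OF that(1) N] small[OF that(2) N] e by linarith
    then show "\<exists>M. \<forall>m\<ge>M. \<forall>n\<ge>M. norm (op_poly (q m) P - op_poly (q n) P) < e" by blast
  qed
  then obtain B where B: "(\<lambda>n. op_poly (q n) P) \<longlonglongrightarrow> B"
    using Cauchy_convergent convergentD by blast
  have "cfc_limit g P B"
    unfolding cfc_limit_def
  proof (intro allI impI)
    fix e :: real assume e: "0 < e"
    obtain N where N: "1 / real (Suc N) \<le> e" using arch[OF e] by auto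
    obtain N' where N': "\<And>n. n \<ge> N' \<Longrightarrow> norm (op_poly (q n) P - B) < e" using LIMSEQ_D[OF B e] by auto
    define n where "n = max N N'"
    show "\<exists>q. (\<forall>t\<in>{0..norm P}. \<bar>poly q t - g t\<bar> \<le> e) \<and> norm (op_poly q P - B) \<le> e"
    proof (intro exI[of _ "q n"] conjI ballI)
      show "\<bar>poly (q n) t - g t\<bar> \<le> e" if "t \<in> {0..norm P}" for t
        using q[OF that, of n] small[of N n e] N by (simp add: n_def)
      show "norm (op_poly (q n) P - B) \<le> e" using N'[of n] by (simp add: n_def)
    qed
  qed
  then show ?thesis using cfc_limit_op_cfc[OF P] by metis
qed

lemma op_cfc_cong:
  assumes "\<And>t. t \<in> {0..norm P} \<Longrightarrow> g t = h t"
  shows "op_cfc g P = op_cfc h P"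
  unfolding op_cfc_def using assms by simp

lemma op_cfc_poly:
  assumes "op_psd P" "\<And>t. t \<in> {0..norm P} \<Longrightarrow> g t = poly q t"
  shows "op_cfc g P = op_poly q P"
  by (rule cfc_limit_op_cfc[OF assms(1)])
     (use assms(2) in \<open>auto simp: cfc_limit_def intro!: exI[of _ q]\<close>)

lemma op_cfc_seq:
  assumes P: "op_psd P" and g: "continuous_on {0..norm P} g"
  obtains q where "\<And>n t. t \<in> {0..norm P} \<Longrightarrow> \<bar>poly (q n) t - g t\<bar> \<le> 1 / real (Suc n)"
    "\<And>x. (\<lambda>n. op_poly (q n) P x) \<longlonglongrightarrow> op_cfc g P x"
proof -
  have "\<forall>n. \<exists>q. (\<forall>t\<in>{0..norm P}. \<bar>poly q t - g t\<bar> \<le> 1 / real (Suc n)) \<and>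
      norm (op_poly q P - op_cfc g P) \<le> 1 / real (Suc n)"
    using op_cfc_limit[OF P g] unfolding cfc_limit_def by simp
  then obtain q where q: "\<And>n t. t \<in> {0..norm P} \<Longrightarrow> \<bar>poly (q n) t - g t\<bar> \<le> 1 / real (Suc n)"
    "\<And>n. norm (op_poly (q n) P - op_cfc g P) \<le> 1 / real (Suc n)" by metis
  have "(\<lambda>n. op_poly (q n) P - op_cfc g P) \<longlonglongrightarrow> 0"
    by (rule Lim_null_comparison[OF always_eventually LIMSEQ_inverse_real_of_nat])
       (use q(2) in \<open>simp add: inverse_eq_divide\<close>)
  then have "(\<lambda>n. op_poly (q n) P) \<longlonglongrightarrow> op_cfc g P" by (simp add: LIM_zero_iff)
  then have "(\<lambda>n. op_poly (q n) P x) \<longlonglongrightarrow> op_cfc g P x" for x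
    by (intro tendsto_intros)
  then show thesis using q(1) that by blast
qed

lemma op_cfc_sym:
  assumes P: "op_psd P" and g: "continuous_on {0..norm P} g"
  shows "op_cfc g P x \<bullet> y = x \<bullet> op_cfc g P y"
proof -
  obtain q where q: "\<And>x. (\<lambda>n. op_poly (q n) P x) \<longlonglongrightarrow> op_cfc g P x" using op_cfc_seq[OF P g] by metis
  have "(\<lambda>n. op_poly (q n) P x \<bullet> y) \<longlonglongrightarrow> op_cfc g P x \<bullet> y" by (intro tendsto_intros q)
  moreover have "(\<lambda>n. op_poly (q n) P x \<bullet> y) \<longlonglongrightarrow> x \<bullet> op_cfc g P y"
    unfolding op_poly_sym[OF P] by (intro tendsto_intros q)
  ultimately show ?thesis by (rule LIMSEQ_unique)
qed

lemma op_cfc_ge: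
  assumes P: "op_psd P" and g: "continuous_on {0..norm P} g"
    and r: "\<And>t. t \<in> {0..norm P} \<Longrightarrow> poly r t \<le> g t"
  shows "x \<bullet> op_poly r P x \<le> x \<bullet> op_cfc g P x"
proof -
  obtain q where q1: "\<And>n t. t \<in> {0..norm P} \<Longrightarrow> \<bar>poly (q n) t - g t\<bar> \<le> 1 / real (Suc n)"
    and q: "\<And>x. (\<lambda>n. op_poly (q n) P x) \<longlonglongrightarrow> op_cfc g P x" using op_cfc_seq[OF P g] by metis
  have le: "x \<bullet> op_poly r P x \<le> x \<bullet> op_poly (q n) P x + inverse (real (Suc n)) * (x \<bullet> x)" for n
  proof -
    have "0 \<le> x \<bullet> op_poly (q n + [:1 / real (Suc n):] - r) P x"
    proof (rule op_poly_nonneg[OF P])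
      fix t assume "t \<in> {0..norm P}"
      from q1[OF this, of n] r[OF this] show "0 \<le> poly (q n + [:1 / real (Suc n):] - r) t"
        unfolding poly_diff poly_add by simp
    qed
    then show ?thesis by (simp add: op_poly_diff op_poly_add inner_diff_right inner_add_right inverse_eq_divide)
  qed
  have "(\<lambda>n. x \<bullet> op_poly (q n) P x + inverse (real (Suc n)) * (x \<bullet> x)) \<longlonglongrightarrow> x \<bullet> op_cfc g P x + 0 * (x \<bullet> x)"
    by (intro tendsto_intros q LIMSEQ_inverse_real_of_nat)
  then show ?thesis using LIMSEQ_le_const[of _ "x \<bullet> op_cfc g P x"] le by fastforce
qed

lemma op_cfc_le:
  assumes P: "op_psd P" and g: "continuous_on {0..norm P} g"
    and r: "\<And>t. t \<in> {0..norm P} \<Longrightarrow> g t \<le> poly r t"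
  shows "x \<bullet> op_cfc g P x \<le> x \<bullet> op_poly r P x"
proof -
  obtain q where q1: "\<And>n t. t \<in> {0..norm P} \<Longrightarrow> \<bar>poly (q n) t - g t\<bar> \<le> 1 / real (Suc n)"
    and q: "\<And>x. (\<lambda>n. op_poly (q n) P x) \<longlonglongrightarrow> op_cfc g P x" using op_cfc_seq[OF P g] by metis
  have le: "x \<bullet> op_poly (q n) P x - inverse (real (Suc n)) * (x \<bullet> x) \<le> x \<bullet> op_poly r P x" for n
  proof -
    have "0 \<le> x \<bullet> op_poly (r + [:1 / real (Suc n):] - q n) P x"
    proof (rule op_poly_nonneg[OF P])
      fix t assume "t \<in> {0..norm P}"
      from q1[OF this, of n] r[OF this] show "0 \<le> poly (r + [:1 / real (Suc n):] - q n) t"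
        unfolding poly_diff poly_add by simp
    qed
    then show ?thesis by (simp add: op_poly_diff op_poly_add inner_diff_right inner_add_right inverse_eq_divide)
  qed
  have "(\<lambda>n. x \<bullet> op_poly (q n) P x - inverse (real (Suc n)) * (x \<bullet> x)) \<longlonglongrightarrow> x \<bullet> op_cfc g P x - 0 * (x \<bullet> x)"
    by (intro tendsto_intros q LIMSEQ_inverse_real_of_nat)
  then show ?thesis using LIMSEQ_le_const2[of _ "x \<bullet> op_cfc g P x"] le by fastforce
qed

lemma op_cfc_psd:
  assumes P: "op_psd P" and g: "continuous_on {0..norm P} g"
    and "\<And>t. t \<in> {0..norm P} \<Longrightarrow> 0 \<le> g t"
  shows "op_psd (op_cfc g P)"
  unfolding op_psd_def
  using op_cfc_sym[OF P g] op_cfc_ge[OF P g, of 0] assms(3) by auto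

lemma op_cfc_square:
  assumes P: "op_psd P" and g: "continuous_on {0..norm P} g"
  shows "op_cfc (\<lambda>t. g t * g t) P x = op_cfc g P (op_cfc g P x)"
proof -
  define B where "B = op_cfc g P"
  have cp: "compact (g ` {0..norm P})" using g by (intro compact_continuous_image) auto
  then obtain G where G: "\<And>t. t \<in> {0..norm P} \<Longrightarrow> \<bar>g t\<bar> \<le> G"
    using compact_imp_bounded bounded_iff by (metis imageI real_norm_def)
  define K where "K = 2 * (\<bar>G\<bar> + norm B) + 1"
  have K: "K > 0" unfolding K_def by (rule add_nonneg_pos) auto
  have "cfc_limit (\<lambda>t. g t * g t) P (B o\<^sub>L B)"
    unfolding cfc_limit_def
  proof (intro allI impI)
    fix e :: real assume e: "0 < e"
    define d where "d = min 1 (e / K)"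
    have d: "0 < d" "d \<le> 1" "d * K \<le> e" using e K by (auto simp: d_def min_def field_simps)
    obtain q where q: "\<forall>t\<in>{0..norm P}. \<bar>poly q t - g t\<bar> \<le> d" "norm (op_poly q P - B) \<le> d"
      using op_cfc_limit[OF P g] d unfolding cfc_limit_def B_def by blast
    have "\<bar>poly (q * q) t - g t * g t\<bar> \<le> e" if t: "t \<in> {0..norm P}" for t
    proof -
      have "\<bar>poly (q * q) t - g t * g t\<bar> = \<bar>poly q t - g t\<bar> * \<bar>(poly q t - g t) + 2 * g t\<bar>"
        by (simp add: algebra_simps flip: abs_mult)
      also have "\<dots> \<le> d * K"
      proof (rule mult_mono)
        show 1: "\<bar>poly q t - g t\<bar> \<le> d" using q(1) t by blast
        show "\<bar>(poly q t - g t) + 2 * g t\<bar> \<le> K"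
        proof -
          have "\<bar>(poly q t - g t) + 2 * g t\<bar> \<le> 1 + 2 * \<bar>G\<bar>" using 1 d(2) G[OF t] by linarith
          then show ?thesis unfolding K_def using norm_ge_zero[of B] by argo
        qed
      qed (use d in auto)
      finally show ?thesis using d by linarith
    qed
    moreover have "norm (op_poly (q * q) P - (B o\<^sub>L B)) \<le> e"
    proof -
      define D where "D = op_poly q P - B"
      have eq: "op_poly (q * q) P - (B o\<^sub>L B) = (D o\<^sub>L D) + (D o\<^sub>L B) + (B o\<^sub>L D)"
        by (rule blinfun_eqI) (simp add: op_poly_mult D_def blinfun.bilinear_simps)
      have "norm (op_poly (q * q) P - (B o\<^sub>L B)) \<le> norm D * norm D + norm D * norm B + norm B * norm D"
        unfolding eq
        using norm_triangle_ineq[of "(D o\<^sub>L D) + (D o\<^sub>L B)" "B o\<^sub>L D"] norm_triangle_ineq[of "D o\<^sub>L D" "D o\<^sub>L B"]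
          norm_blinfun_compose[of D D] norm_blinfun_compose[of D B] norm_blinfun_compose[of B D] by linarith
      also have "\<dots> = norm D * (norm D + 2 * norm B)" by (simp add: algebra_simps)
      also have "\<dots> \<le> d * K" using q(2) d by (intro mult_mono) (auto simp: D_def K_def)
      finally show ?thesis using d by linarith
    qed
    ultimately show "\<exists>q. (\<forall>t\<in>{0..norm P}. \<bar>poly q t - g t * g t\<bar> \<le> e) \<and> norm (op_poly q P - (B o\<^sub>L B)) \<le> e"
      by blast
  qed
  then show ?thesis using cfc_limit_op_cfc[OF P] by (simp add: B_def)
qed

lemma op_poly_bounded_ops:
  assumes "P \<in> bounded_ops"
  shows "op_poly q P \<in> bounded_ops"
proof -
  have "op_poly q P (l2_scaleC c x) = l2_scaleC c (op_poly q P x)" for c x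
    using assms by (induction q) (auto simp: bounded_ops_def l2_scaleC_add l2_scaleC_scaleR)
  then show ?thesis by (simp add: bounded_ops_def)
qed

lemma op_cfc_bounded_ops:
  assumes P: "op_psd P" and g: "continuous_on {0..norm P} g" and b: "P \<in> bounded_ops"
  shows "op_cfc g P \<in> bounded_ops"
  unfolding bounded_ops_def
proof (intro CollectI allI)
  fix c x
  obtain q where q: "\<And>x. (\<lambda>n. op_poly (q n) P x) \<longlonglongrightarrow> op_cfc g P x" using op_cfc_seq[OF P g] by metis
  have "(\<lambda>n. op_poly (q n) P (l2_scaleC c x)) \<longlonglongrightarrow> l2_scaleC c (op_cfc g P x)"
    using op_poly_bounded_ops[OF b] bounded_linear.tendsto[OF bounded_linear_l2_scaleC q] by (simp add: bounded_ops_def)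
  then show "op_cfc g P (l2_scaleC c x) = l2_scaleC c (op_cfc g P x)"
    using q LIMSEQ_unique by blast
qed

section \<open>Hilbert--Schmidt operators and their kernels\<close>

definition hs2 :: "(real \<times> real \<Rightarrow> complex) \<Rightarrow> real" where
  "hs2 A = (\<integral>z. (cmod (A z))\<^sup>2 \<partial>lborel)"

definition kfun :: "(real \<times> real \<Rightarrow> complex) \<Rightarrow> (real \<Rightarrow> complex) \<Rightarrow> real \<Rightarrow> complex" where
  "kfun A f t = (\<integral>s. A (t, s) * f s \<partial>lborel)"

definition kop :: "(real \<times> real \<Rightarrow> complex) \<Rightarrow> l2op" where
  "kop A = Blinfun (\<lambda>\<xi>. abs_l2 (kfun A (rep_l2 \<xi>)))"

lemma square_integrable_measurable:
  "square_integrable lborel f \<Longrightarrow> f \<in> borel_measurable borel"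
  by (simp add: square_integrable_def)

lemma square_integrable_pair_measurable:
  fixes A :: "real \<times> real \<Rightarrow> complex"
  shows "square_integrable lborel A \<Longrightarrow> A \<in> borel_measurable (borel \<Otimes>\<^sub>M borel)"
  by (simp add: square_integrable_def borel_prod)

lemma square_integrable_cnj:
  assumes "square_integrable M f"
  shows "square_integrable M (\<lambda>t. cnj (f t))"
proof -
  have "(\<lambda>t. cnj (f t)) \<in> borel_measurable M"
    by (rule borel_measurable_continuous_on[of cnj])
       (use assms in \<open>auto simp: square_integrable_def intro: continuous_intros\<close>)
  then show ?thesis using assms by (simp add: square_integrable_def)
qed

lemma integrable_mult_square_integrable:
  assumes "square_integrable M f" "square_integrable M g"
  shows "integrable M (\<lambda>t. f t * g t)"
  using square_integrable_mult[OF square_integrable_cnj[OF assms(1)] assms(2)] by simp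

lemma square_integrable_tensor:
  fixes f g :: "real \<Rightarrow> complex"
  assumes "square_integrable lborel f" "square_integrable lborel g"
  shows "square_integrable lborel (\<lambda>z. f (fst z) * g (snd z))"
proof -
  note [measurable] = assms[THEN square_integrable_measurable]
  have m: "(\<lambda>z. f (fst z) * g (snd z)) \<in> borel_measurable (lborel \<Otimes>\<^sub>M lborel)" by measurable
  have "integrable (lborel \<Otimes>\<^sub>M lborel) (\<lambda>z. (cmod (f (fst z) * g (snd z)))\<^sup>2)"
  proof (rule lborel_pair.Fubini_integrable)
    show "(\<lambda>z. (cmod (f (fst z) * g (snd z)))\<^sup>2) \<in> borel_measurable (lborel \<Otimes>\<^sub>M lborel)" by measurable
  qed (use assms in \<open>auto simp: square_integrable_def norm_mult power_mult_distrib\<close>)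
  then show ?thesis using m by (simp add: square_integrable_def lborel_prod)
qed

lemma AE_kernel_section:
  fixes A :: "real \<times> real \<Rightarrow> complex"
  assumes "square_integrable lborel A"
  shows "AE t in lborel. square_integrable lborel (\<lambda>s. A (t, s))"
proof -
  note [measurable] = square_integrable_pair_measurable[OF assms]
  have "integrable (lborel \<Otimes>\<^sub>M lborel) (\<lambda>z. (cmod (A z))\<^sup>2)"
    using assms by (simp add: square_integrable_def lborel_prod)
  then have "AE t in lborel. integrable lborel (\<lambda>s. (cmod (A (t, s)))\<^sup>2)"
    by (rule lborel_pair.AE_integrable_fst')
  then show ?thesis
    by eventually_elim (simp add: square_integrable_def)
qed

lemma kernel_section_integral:
  assumes "square_integrable lborel A"
  shows "integrable lborel (\<lambda>t. \<integral>s. (cmod (A (t, s)))\<^sup>2 \<partial>lborel)"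
    and "(\<integral>t. (\<integral>s. (cmod (A (t, s)))\<^sup>2 \<partial>lborel) \<partial>lborel) = hs2 A"
proof -
  have i: "integrable (lborel \<Otimes>\<^sub>M lborel) (\<lambda>z. (cmod (A z))\<^sup>2)"
    using assms by (simp add: square_integrable_def lborel_prod)
  from lborel_pair.integrable_fst'[OF i] lborel_pair.integral_fst'[OF i]
  show "integrable lborel (\<lambda>t. \<integral>s. (cmod (A (t, s)))\<^sup>2 \<partial>lborel)"
    "(\<integral>t. (\<integral>s. (cmod (A (t, s)))\<^sup>2 \<partial>lborel) \<partial>lborel) = hs2 A"
    by (simp_all add: hs2_def lborel_prod)
qed

lemma hs2_nonneg: "0 \<le> hs2 A"
  by (simp add: hs2_def)

lemma kfun_measurable:
  assumes "square_integrable lborel A" "f \<in> borel_measurable borel"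
  shows "kfun A f \<in> borel_measurable borel"
proof -
  note [measurable] = square_integrable_pair_measurable[OF assms(1)] assms(2)
  have "(\<lambda>t. \<integral>s. A (t, s) * f s \<partial>lborel) \<in> borel_measurable borel"
    by (rule sigma_finite_measure.borel_measurable_lebesgue_integral[OF sigma_finite_lborel]) simp
  then show ?thesis by (simp add: kfun_def[abs_def])
qed

lemma AE_kfun_le:
  assumes A: "square_integrable lborel A" and f: "square_integrable lborel f"
  shows "AE t in lborel. (cmod (kfun A f t))\<^sup>2 \<le> (\<integral>s. (cmod (A (t, s)))\<^sup>2 \<partial>lborel) * (\<integral>s. (cmod (f s))\<^sup>2 \<partial>lborel)"
  using AE_kernel_section[OF A]
proof eventually_elim
  case (elim t)
  have "(cmod (kfun A f t))\<^sup>2 \<le> (sqrt (\<integral>s. (cmod (A (t, s)))\<^sup>2 \<partial>lborel) * sqrt (\<integral>s. (cmod (f s))\<^sup>2 \<partial>lborel))\<^sup>2"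
    unfolding kfun_def by (intro power_mono cmod_integral_mult_le elim f) simp
  then show ?case by (simp add: power_mult_distrib)
qed

lemma kfun_square_integrable:
  assumes A: "square_integrable lborel A" and f: "square_integrable lborel f"
  shows "square_integrable lborel (kfun A f)"
    and "(\<integral>t. (cmod (kfun A f t))\<^sup>2 \<partial>lborel) \<le> hs2 A * (\<integral>s. (cmod (f s))\<^sup>2 \<partial>lborel)"
proof -
  have m[measurable]: "kfun A f \<in> borel_measurable borel"
    using kfun_measurable[OF A square_integrable_measurable[OF f]] .
  have i: "integrable lborel (\<lambda>t. (\<integral>s. (cmod (A (t, s)))\<^sup>2 \<partial>lborel) * (\<integral>s. (cmod (f s))\<^sup>2 \<partial>lborel))"
    using kernel_section_integral(1)[OF A] by simp
  have i2: "integrable lborel (\<lambda>t. (cmod (kfun A f t))\<^sup>2)"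
    by (rule Bochner_Integration.integrable_bound[OF i]) (use AE_kfun_le[OF A f] in \<open>auto\<close>)
  then show "square_integrable lborel (kfun A f)" by (simp add: square_integrable_def)
  have "(\<integral>t. (cmod (kfun A f t))\<^sup>2 \<partial>lborel) \<le>
     (\<integral>t. (\<integral>s. (cmod (A (t, s)))\<^sup>2 \<partial>lborel) * (\<integral>s. (cmod (f s))\<^sup>2 \<partial>lborel) \<partial>lborel)"
    by (rule integral_mono_AE[OF i2 i AE_kfun_le[OF A f]])
  also have "\<dots> = hs2 A * (\<integral>s. (cmod (f s))\<^sup>2 \<partial>lborel)"
    by (simp add: kernel_section_integral(2)[OF A])
  finally show "(\<integral>t. (cmod (kfun A f t))\<^sup>2 \<partial>lborel) \<le> hs2 A * (\<integral>s. (cmod (f s))\<^sup>2 \<partial>lborel)" .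
qed

lemma kfun_cong_AE:
  assumes A: "square_integrable lborel A" and "f \<in> borel_measurable borel" "g \<in> borel_measurable borel"
    and "AE s in lborel. f s = g s"
  shows "kfun A f = kfun A g"
proof
  fix t
  note [measurable] = square_integrable_pair_measurable[OF A] assms(2,3)
  show "kfun A f t = kfun A g t"
    unfolding kfun_def by (rule integral_cong_AE) (use assms(4) in auto)
qed

lemma kfun_add:
  assumes A: "square_integrable lborel A" and f: "square_integrable lborel f" and g: "square_integrable lborel g"
  shows "AE t in lborel. kfun A (\<lambda>s. f s + g s) t = kfun A f t + kfun A g t"
  using AE_kernel_section[OF A]
  by eventually_elim (simp add: kfun_def distrib_left integrable_mult_square_integrable f g)

lemma kfun_scaleC: "kfun A (\<lambda>s. c * f s) t = c * kfun A f t"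
  unfolding kfun_def by (subst integral_mult_right_zero[symmetric]) (simp add: mult.left_commute)

lemma bounded_linear_kop:
  assumes A: "square_integrable lborel A"
  shows "bounded_linear (\<lambda>\<xi>. abs_l2 (kfun A (rep_l2 \<xi>)))"
    and "abs_l2 (kfun A (rep_l2 (l2_scaleC c x))) = l2_scaleC c (abs_l2 (kfun A (rep_l2 x)))"
    and "norm (abs_l2 (kfun A (rep_l2 x))) \<le> sqrt (hs2 A) * norm x"
proof -
  note sq = kfun_square_integrable(1)[OF A rep_l2_square_integrable]
  have add: "abs_l2 (kfun A (rep_l2 (x + y))) = abs_l2 (kfun A (rep_l2 x)) + abs_l2 (kfun A (rep_l2 y))" for x y
  proof -
    have "kfun A (rep_l2 (x + y)) = kfun A (\<lambda>s. rep_l2 x s + rep_l2 y s)"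
      by (rule kfun_cong_AE[OF A _ _ rep_l2_add]) auto
    then show ?thesis
      using kfun_add[OF A rep_l2_square_integrable[of x] rep_l2_square_integrable[of y]]
      by (simp add: abs_l2_add sq abs_l2_eq_iff square_integrable_add kfun_square_integrable[OF A])
  qed
  have sc: "abs_l2 (kfun A (rep_l2 (l2_scaleC c x))) = l2_scaleC c (abs_l2 (kfun A (rep_l2 x)))" for c x
  proof -
    have "kfun A (rep_l2 (l2_scaleC c x)) = kfun A (\<lambda>s. c * rep_l2 x s)"
      by (rule kfun_cong_AE[OF A _ _ rep_l2_scaleC]) auto
    also have "\<dots> = (\<lambda>t. c * kfun A (rep_l2 x) t)" by (rule ext) (rule kfun_scaleC)
    finally show ?thesis by (simp add: abs_l2_scaleC sq)
  qed
  have nrm: "norm (abs_l2 (kfun A (rep_l2 x))) \<le> sqrt (hs2 A) * norm x" for x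
  proof (rule power2_le_imp_le)
    show "(norm (abs_l2 (kfun A (rep_l2 x))))\<^sup>2 \<le> (sqrt (hs2 A) * norm x)\<^sup>2"
      using kfun_square_integrable(2)[OF A rep_l2_square_integrable[of x]] hs2_nonneg[of A]
      by (simp only: norm_abs_l2_square[OF sq] norm_l2_square[of x] power_mult_distrib real_sqrt_pow2)
  qed (use hs2_nonneg[of A] in simp)
  show "abs_l2 (kfun A (rep_l2 (l2_scaleC c x))) = l2_scaleC c (abs_l2 (kfun A (rep_l2 x)))" by (rule sc)
  show "norm (abs_l2 (kfun A (rep_l2 x))) \<le> sqrt (hs2 A) * norm x" by (rule nrm)
  show "bounded_linear (\<lambda>\<xi>. abs_l2 (kfun A (rep_l2 \<xi>)))"
    by (rule bounded_linear_intro[where K = "sqrt (hs2 A)"])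
       (use nrm in \<open>simp_all add: add scaleR_l2_def sc mult.commute\<close>)
qed

lemma kop_apply:
  assumes A: "square_integrable lborel A"
  shows "kop A x = abs_l2 (kfun A (rep_l2 x))"
  unfolding kop_def by (simp add: bounded_linear_Blinfun_apply bounded_linear_kop[OF A])

lemma rep_kop:
  assumes A: "square_integrable lborel A"
  shows "AE t in lborel. rep_l2 (kop A x) t = kfun A (rep_l2 x) t"
  unfolding kop_apply[OF A] by (rule rep_abs_l2) (simp add: kfun_square_integrable A)

lemma has_kernel_kop:
  assumes A: "square_integrable lborel A"
  shows "has_kernel (kop A) A"
  unfolding has_kernel_def using A rep_kop[OF A] by (auto simp: kfun_def)

lemma kop_bounded_ops:
  assumes A: "square_integrable lborel A"
  shows "kop A \<in> bounded_ops"
  unfolding bounded_ops_def by (simp add: kop_apply[OF A] bounded_linear_kop(2)[OF A])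

lemma norm_kop_le:
  assumes A: "square_integrable lborel A"
  shows "norm (kop A) \<le> sqrt (hs2 A)"
  by (rule norm_blinfun_bound) (use hs2_nonneg[of A] bounded_linear_kop(3)[OF A] in \<open>auto simp: kop_apply[OF A]\<close>)

lemma has_kernel_unique:
  assumes "has_kernel T A"
  shows "T = kop A"
proof (rule blinfun_eqI)
  fix x
  have A: "square_integrable lborel A" using assms by (simp add: has_kernel_def)
  have "AE t in lborel. rep_l2 (T x) t = kfun A (rep_l2 x) t"
    using assms by (simp add: has_kernel_def kfun_def)
  then have "abs_l2 (rep_l2 (T x)) = abs_l2 (kfun A (rep_l2 x))"
    by (subst abs_l2_eq_iff) (auto simp: kfun_square_integrable A)
  then show "T x = kop A x" by (simp add: kop_apply[OF A])
qed

lemma op_of_kernel_eq: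
  assumes "square_integrable lborel A"
  shows "op_of_kernel A = kop A"
  unfolding op_of_kernel_def
  by (rule the_equality) (use assms has_kernel_kop has_kernel_unique in auto)

lemma kop_add:
  assumes "square_integrable lborel A" "square_integrable lborel B"
  shows "kop (\<lambda>z. A z + B z) = kop A + kop B"
proof (rule has_kernel_unique[symmetric])
  have "AE t in lborel. rep_l2 ((kop A + kop B) x) t = (\<integral>s. (A (t, s) + B (t, s)) * rep_l2 x s \<partial>lborel)" for x
    using rep_l2_add[of "kop A x" "kop B x"] rep_kop[OF assms(1), of x] rep_kop[OF assms(2), of x]
      AE_kernel_section[OF assms(1)] AE_kernel_section[OF assms(2)]
    by eventually_elim (simp add: blinfun.add_left kfun_def distrib_right integrable_mult_square_integrable)
  then show "has_kernel (kop A + kop B) (\<lambda>z. A z + B z)"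
    using assms by (simp add: has_kernel_def square_integrable_add)
qed

lemma cinner_kop:
  assumes A: "square_integrable lborel A"
  shows "cinner y (kop A x) = (\<integral>z. cnj (rep_l2 y (fst z)) * (A z * rep_l2 x (snd z)) \<partial>lborel)"
    and "cinner y (kop A x) = (\<integral>s. (\<integral>t. cnj (rep_l2 y t) * (A (t, s) * rep_l2 x s) \<partial>lborel) \<partial>lborel)"
proof -
  note [measurable] = square_integrable_pair_measurable[OF A]
  have "integrable lborel (\<lambda>z. (cnj (rep_l2 y (fst z)) * rep_l2 x (snd z)) * A z)"
    by (intro integrable_mult_square_integrable square_integrable_tensor square_integrable_cnj A) simp_all
  then have i: "integrable (lborel \<Otimes>\<^sub>M lborel) (\<lambda>z. cnj (rep_l2 y (fst z)) * (A z * rep_l2 x (snd z)))"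
    by (simp add: lborel_prod mult_ac)
  have "cinner y (kop A x) = (\<integral>t. cnj (rep_l2 y t) * kfun A (rep_l2 x) t \<partial>lborel)"
    unfolding cinner_rep_l2
  proof (rule integral_cong_AE)
    show "AE t in lborel. cnj (rep_l2 y t) * rep_l2 (kop A x) t = cnj (rep_l2 y t) * kfun A (rep_l2 x) t"
      using rep_kop[OF A, of x] by eventually_elim simp
    show "(\<lambda>t. cnj (rep_l2 y t) * rep_l2 (kop A x) t) \<in> borel_measurable lborel"
      using square_integrable_mult[of lborel "rep_l2 y" "rep_l2 (kop A x)"] by simp
    show "(\<lambda>t. cnj (rep_l2 y t) * kfun A (rep_l2 x) t) \<in> borel_measurable lborel"
      using square_integrable_mult[of lborel "rep_l2 y" "kfun A (rep_l2 x)"]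
      by (simp add: kfun_square_integrable A)
  qed
  also have "\<dots> = (\<integral>t. (\<integral>s. cnj (rep_l2 y t) * (A (t, s) * rep_l2 x s) \<partial>lborel) \<partial>lborel)"
    by (simp add: kfun_def)
  also have "\<dots> = (\<integral>z. cnj (rep_l2 y (fst z)) * (A z * rep_l2 x (snd z)) \<partial>(lborel \<Otimes>\<^sub>M lborel))"
    using lborel_pair.integral_fst'[OF i] by simp
  finally have *: "cinner y (kop A x) = (\<integral>z. cnj (rep_l2 y (fst z)) * (A z * rep_l2 x (snd z)) \<partial>(lborel \<Otimes>\<^sub>M lborel))" .
  then show "cinner y (kop A x) = (\<integral>z. cnj (rep_l2 y (fst z)) * (A z * rep_l2 x (snd z)) \<partial>lborel)"
    by (simp add: lborel_prod)
  have "(\<integral>s. (\<integral>t. cnj (rep_l2 y t) * (A (t, s) * rep_l2 x s) \<partial>lborel) \<partial>lborel)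
      = (\<integral>z. cnj (rep_l2 y (fst z)) * (A z * rep_l2 x (snd z)) \<partial>(lborel \<Otimes>\<^sub>M lborel))"
    using lborel_pair.integral_snd[of "\<lambda>t s. cnj (rep_l2 y t) * (A (t, s) * rep_l2 x s)"] i
    by (simp add: case_prod_unfold)
  with * show "cinner y (kop A x) = (\<integral>s. (\<integral>t. cnj (rep_l2 y t) * (A (t, s) * rep_l2 x s) \<partial>lborel) \<partial>lborel)"
    by simp
qed

subsection \<open>Uniqueness of the kernel\<close>

text \<open>Both kernels have the same integrals against every rational interval in almost every row.\<close>

lemma kernel_AE_unique:
  assumes "has_kernel T A" "has_kernel T B"
  shows "AE z in lborel. A z = B z"
proof -
  have A: "square_integrable lborel A" and B: "square_integrable lborel B"
    using assms by (auto simp: has_kernel_def)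
  note [measurable] = square_integrable_pair_measurable[OF A] square_integrable_pair_measurable[OF B]
  have *: "AE t in lborel. (\<integral>s. indicator I s * (A (t, s) - B (t, s)) \<partial>lborel) = 0" if I: "I \<in> rat_intervals" for I
  proof -
    have s: "square_integrable lborel (indicator I :: real \<Rightarrow> complex)"
      using integrable_on_interval(2)[OF square_integrable_zero, of I] rat_intervals_fin[OF I] by simp
    have r: "kfun K (rep_l2 (ind_l2 I)) = kfun K (indicator I)" if "square_integrable lborel K" for K
      unfolding ind_l2_def
      by (rule kfun_cong_AE[OF that _ _ rep_abs_l2[OF s]]) (use square_integrable_measurable[OF s] in auto)
    have "AE t in lborel. rep_l2 (T (ind_l2 I)) t = kfun A (rep_l2 (ind_l2 I)) t"
      "AE t in lborel. rep_l2 (T (ind_l2 I)) t = kfun B (rep_l2 (ind_l2 I)) t"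
      using assms by (auto simp: has_kernel_def kfun_def)
    then show ?thesis
      using AE_kernel_section[OF A] AE_kernel_section[OF B]
    proof eventually_elim
      case (elim t)
      then have "kfun A (indicator I) t = kfun B (indicator I) t" using r[OF A] r[OF B] by metis
      moreover have "integrable lborel (\<lambda>x. A (t, x) * indicator I x)" "integrable lborel (\<lambda>x. B (t, x) * indicator I x)"
        using elim s by (auto intro: integrable_mult_square_integrable)
      ultimately show ?case
        by (simp add: kfun_def right_diff_distrib mult.commute[of "indicator I _"])
    qed
  qed
  have "AE t in lborel. \<forall>I\<in>rat_intervals. (\<integral>s. indicator I s * (A (t, s) - B (t, s)) \<partial>lborel) = 0"
    by (rule AE_ball_countable'[OF * countable_rat_intervals])
  then have "AE t in lborel. AE s in lborel. A (t, s) = B (t, s)"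
    using AE_kernel_section[OF A] AE_kernel_section[OF B]
  proof eventually_elim
    case (elim t)
    have "AE s in lborel. A (t, s) - B (t, s) = 0"
      by (rule AE_zero_if_integral_rat_intervals) (use elim in \<open>auto intro: square_integrable_diff\<close>)
    then show ?case by simp
  qed
  moreover have "{z \<in> space (lborel \<Otimes>\<^sub>M lborel). A z = B z} \<in> sets (lborel \<Otimes>\<^sub>M lborel)" by measurable
  ultimately have "AE z in lborel \<Otimes>\<^sub>M lborel. A z = B z"
    by (intro lborel_pair.AE_pair_measure)
  then show ?thesis unfolding lborel_prod .
qed

lemma kernel_of_kop:
  assumes A: "square_integrable lborel A"
  shows "square_integrable lborel (kernel_of (kop A))" "AE z in lborel. kernel_of (kop A) z = A z"
proof -
  have "has_kernel (kop A) (kernel_of (kop A))"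
    unfolding kernel_of_def by (rule someI[of _ A]) (rule has_kernel_kop[OF A])
  then show "square_integrable lborel (kernel_of (kop A))" "AE z in lborel. kernel_of (kop A) z = A z"
    using kernel_AE_unique[OF _ has_kernel_kop[OF A]] by (auto simp: has_kernel_def)
qed

lemma kop_cong_AE:
  assumes A: "square_integrable lborel A" and B: "square_integrable lborel B" and e: "AE z in lborel. A z = B z"
  shows "kop A = kop B"
proof (rule has_kernel_unique)
  have "AE z in lborel \<Otimes>\<^sub>M lborel. A z = B z" unfolding lborel_prod by (rule e)
  then have ae: "AE t in lborel. AE s in lborel. A (t, s) = B (t, s)" by (rule lborel_pair.AE_pair)
  note [measurable] = square_integrable_pair_measurable[OF A] square_integrable_pair_measurable[OF B]
  have "AE t in lborel. rep_l2 (kop A x) t = (\<integral>s. B (t, s) * rep_l2 x s \<partial>lborel)" for x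
    using rep_kop[OF A, of x] ae
  proof eventually_elim
    case (elim t)
    have "kfun A (rep_l2 x) t = (\<integral>s. B (t, s) * rep_l2 x s \<partial>lborel)"
      unfolding kfun_def by (rule integral_cong_AE) (use elim in auto)
    then show ?case using elim by simp
  qed
  then show "has_kernel (kop A) B" using B by (simp add: has_kernel_def)
qed

subsection \<open>The adjoint kernel\<close>

definition adj_kernel :: "(real \<times> real \<Rightarrow> complex) \<Rightarrow> real \<times> real \<Rightarrow> complex" where
  "adj_kernel A = (\<lambda>(s, t). cnj (A (t, s)))"

lemma square_integrable_adj_kernel:
  assumes A: "square_integrable lborel A"
  shows "square_integrable lborel (adj_kernel A)"
proof -
  note [measurable] = square_integrable_pair_measurable[OF square_integrable_cnj[OF A]]
  have m: "adj_kernel A \<in> borel_measurable (lborel \<Otimes>\<^sub>M lborel)"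
    unfolding adj_kernel_def by measurable
  have "integrable (lborel \<Otimes>\<^sub>M lborel) (\<lambda>z. (cmod (A z))\<^sup>2)"
    using A by (simp add: square_integrable_def lborel_prod)
  then have "integrable (lborel \<Otimes>\<^sub>M lborel) (\<lambda>(x, y). (cmod (A (y, x)))\<^sup>2)"
    by (rule lborel_pair.integrable_product_swap)
  then have "integrable (lborel \<Otimes>\<^sub>M lborel) (\<lambda>z. (cmod (adj_kernel A z))\<^sup>2)"
    by (simp add: adj_kernel_def case_prod_unfold)
  then show ?thesis using m by (simp add: square_integrable_def lborel_prod)
qed

lemma cinner_nondegenerate:
  assumes "\<And>y. cinner x y = cinner x' y"
  shows "x = x'"
proof -
  have "cinner (x - x') (x - x') = 0" by (simp only: cinner_diff_left assms diff_self)
  then have "(norm (x - x'))\<^sup>2 = 0" unfolding cinner_self by (simp only: of_real_eq_0_iff)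
  then show ?thesis by simp
qed

lemma cinner_adj_kernel:
  assumes A: "square_integrable lborel A"
  shows "cinner (kop (adj_kernel A) x) y = cinner x (kop A y)"
proof -
  have "cinner (kop (adj_kernel A) x) y = cnj (cinner y (kop (adj_kernel A) x))" by (rule cinner_commute)
  also have "\<dots> = (\<integral>t. (\<integral>s. cnj (cnj (rep_l2 y s) * (adj_kernel A (s, t) * rep_l2 x t)) \<partial>lborel) \<partial>lborel)"
    unfolding cinner_kop(2)[OF square_integrable_adj_kernel[OF A]] by (simp only: Bochner_Integration.integral_cnj)
  also have "\<dots> = (\<integral>t. (\<integral>s. cnj (rep_l2 x t) * (A (t, s) * rep_l2 y s) \<partial>lborel) \<partial>lborel)"
    by (intro Bochner_Integration.integral_cong refl) (simp add: adj_kernel_def)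
  also have "\<dots> = cinner x (kop A y)"
  proof -
    have "integrable lborel (\<lambda>z. (cnj (rep_l2 x (fst z)) * rep_l2 y (snd z)) * A z)"
      by (intro integrable_mult_square_integrable square_integrable_tensor square_integrable_cnj A) simp_all
    then have i: "integrable (lborel \<Otimes>\<^sub>M lborel) (\<lambda>z. cnj (rep_l2 x (fst z)) * (A z * rep_l2 y (snd z)))"
      by (simp add: lborel_prod mult_ac)
    show ?thesis using lborel_pair.integral_fst'[OF i] cinner_kop(1)[OF A] by (simp add: lborel_prod)
  qed
  finally show ?thesis .
qed

lemma op_adjoint_kop:
  assumes A: "square_integrable lborel A"
  shows "op_adjoint (kop A) = kop (adj_kernel A)"
  unfolding op_adjoint_def
proof (rule the_equality)
  show "\<forall>\<xi> \<eta>. cinner (kop (adj_kernel A) \<xi>) \<eta> = cinner \<xi> (kop A \<eta>)"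
    using cinner_adj_kernel[OF A] by simp
  fix S :: l2op assume S: "\<forall>\<xi> \<eta>. cinner (S \<xi>) \<eta> = cinner \<xi> (kop A \<eta>)"
  show "S = kop (adj_kernel A)"
    by (rule blinfun_eqI, rule cinner_nondegenerate) (simp add: S cinner_adj_kernel[OF A])
qed

subsection \<open>The Hilbert--Schmidt norm bounds orthonormal sums\<close>

text \<open>Bessel's inequality in almost every row of the kernel, integrated over the rows.\<close>

lemma hs_sum_le:
  assumes A: "square_integrable lborel A" and e: "orthonormal_on I e" "finite I"
  shows "(\<Sum>i\<in>I. (norm (kop A (e i)))\<^sup>2) \<le> hs2 A"
proof -
  note sqk = kfun_square_integrable(1)[OF A rep_l2_square_integrable]
  have i1: "integrable lborel (\<lambda>t. (cmod (kfun A (rep_l2 (e i)) t))\<^sup>2)" for i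
    using sqk by (simp add: square_integrable_def)
  have "(\<Sum>i\<in>I. (norm (kop A (e i)))\<^sup>2) = (\<Sum>i\<in>I. \<integral>t. (cmod (kfun A (rep_l2 (e i)) t))\<^sup>2 \<partial>lborel)"
    by (simp add: kop_apply[OF A] norm_abs_l2_square[OF sqk])
  also have "\<dots> = (\<integral>t. (\<Sum>i\<in>I. (cmod (kfun A (rep_l2 (e i)) t))\<^sup>2) \<partial>lborel)"
    by (rule Bochner_Integration.integral_sum[symmetric]) (rule i1)
  also have "\<dots> \<le> (\<integral>t. (\<integral>s. (cmod (A (t, s)))\<^sup>2 \<partial>lborel) \<partial>lborel)"
  proof (rule integral_mono_AE)
    show "integrable lborel (\<lambda>t. \<Sum>i\<in>I. (cmod (kfun A (rep_l2 (e i)) t))\<^sup>2)"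
      by (intro Bochner_Integration.integrable_sum i1)
    show "integrable lborel (\<lambda>t. \<integral>s. (cmod (A (t, s)))\<^sup>2 \<partial>lborel)" by (rule kernel_section_integral(1)[OF A])
    show "AE t in lborel. (\<Sum>i\<in>I. (cmod (kfun A (rep_l2 (e i)) t))\<^sup>2) \<le> (\<integral>s. (cmod (A (t, s)))\<^sup>2 \<partial>lborel)"
      using AE_kernel_section[OF A]
    proof eventually_elim
      case (elim t)
      define a where "a = abs_l2 (\<lambda>s. cnj (A (t, s)))"
      have sa: "square_integrable lborel (\<lambda>s. cnj (A (t, s)))" by (rule square_integrable_cnj[OF elim])
      have "cinner a x = kfun A (rep_l2 x) t" for x
        unfolding a_def by (simp add: cinner_abs_left[OF sa] kfun_def)
      then have "(\<Sum>i\<in>I. (cmod (kfun A (rep_l2 (e i)) t))\<^sup>2) = (\<Sum>i\<in>I. (cmod (cinner (e i) a))\<^sup>2)"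
        by (metis (no_types, lifting) cinner_commute complex_mod_cnj)
      also have "\<dots> \<le> (norm a)\<^sup>2" by (rule Bessel_finite[OF e])
      also have "\<dots> = (\<integral>s. (cmod (A (t, s)))\<^sup>2 \<partial>lborel)"
        unfolding a_def by (simp add: norm_abs_l2_square[OF sa])
      finally show ?case .
    qed
  qed
  also have "\<dots> = hs2 A" by (rule kernel_section_integral(2)[OF A])
  finally show ?thesis .
qed

subsection \<open>Schur multipliers in terms of kernels\<close>

text \<open>The definition of the multiplier passes through kernels selected by a choice operator.  Only
  their classes modulo null sets are known, and by Fubini this determines the composed kernel
  almost everywhere.  Square integrability of the kernel \<open>K\<close>, computed from the given representatives,
  passes to the one computed from the selected kernels.\<close>

lemma schur_multiplier_kop:
  assumes A: "square_integrable lborel A" and B: "square_integrable lborel B"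
    and m: "(\<lambda>(x, y, z). m x y z) \<in> borel_measurable (borel \<Otimes>\<^sub>M (borel \<Otimes>\<^sub>M borel))"
    and K: "square_integrable lborel K"
    and eq: "\<And>x z. K (x, z) = (\<integral>y. m x y z * A (x, y) * B (y, z) \<partial>lborel)"
  shows "schur_multiplier m (kop A) (kop B) = kop K"
proof -
  define A' where "A' = kernel_of (kop A)"
  define B' where "B' = kernel_of (kop B)"
  have sA': "square_integrable lborel A'" and sB': "square_integrable lborel B'"
    and aeA: "AE z in lborel. A' z = A z" and aeB: "AE z in lborel. B' z = B z"
    using kernel_of_kop[OF A] kernel_of_kop[OF B] by (auto simp: A'_def B'_def)
  note [measurable] = square_integrable_pair_measurable[OF A] square_integrable_pair_measurable[OF B]
    square_integrable_pair_measurable[OF sA'] square_integrable_pair_measurable[OF sB']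
    square_integrable_pair_measurable[OF K]
  have mm[measurable]: "(\<lambda>w. m (f w) (g w) (h w)) \<in> borel_measurable M"
    if "f \<in> borel_measurable M" "g \<in> borel_measurable M" "h \<in> borel_measurable M" for f g h M
    using measurable_compose[OF _ m, of "\<lambda>w. (f w, g w, h w)" M] that by simp
  define K' where "K' = (\<lambda>(x, z). \<integral>y. m x y z * A' (x, y) * B' (y, z) \<partial>lborel)"
  have K'm: "K' \<in> borel_measurable (borel \<Otimes>\<^sub>M borel)"
    unfolding K'_def case_prod_unfold
    by (rule sigma_finite_measure.borel_measurable_lebesgue_integral[OF sigma_finite_lborel]) simp
  note [measurable] = K'm
  have "AE z in lborel \<Otimes>\<^sub>M lborel. A' z = A z" "AE z in lborel \<Otimes>\<^sub>M lborel. B' z = B z"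
    unfolding lborel_prod by (rule aeA, rule aeB)
  then have a1: "AE x in lborel. AE y in lborel. A' (x, y) = A (x, y)"
    and b1: "AE x in lborel. AE y in lborel. B' (x, y) = B (x, y)"
    by (auto intro: lborel_pair.AE_pair)
  have b2: "AE z in lborel. AE y in lborel. B' (y, z) = B (y, z)"
  proof (subst lborel_pair.AE_commute)
    show "{w \<in> space (lborel \<Otimes>\<^sub>M lborel). B' (snd w, fst w) = B (snd w, fst w)} \<in> sets (lborel \<Otimes>\<^sub>M lborel)"
      by measurable
  qed (rule b1)
  have "AE x in lborel. AE z in lborel. K' (x, z) = K (x, z)"
    using a1
  proof eventually_elim
    case (elim x)
    note ex = elim
    show ?case using b2
    proof eventually_elim
      case (elim z)
      show ?case unfolding K'_def eq prod.case
        by (rule integral_cong_AE) (use ex elim in auto)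
    qed
  qed
  moreover have "{w \<in> space (lborel \<Otimes>\<^sub>M lborel). K' w = K w} \<in> sets (lborel \<Otimes>\<^sub>M lborel)" by measurable
  ultimately have "AE w in lborel \<Otimes>\<^sub>M lborel. K' w = K w"
    by (intro lborel_pair.AE_pair_measure)
  then have ae: "AE w in lborel. K' w = K w" unfolding lborel_prod .
  have sK': "square_integrable lborel K'"
    unfolding square_integrable_def
  proof
    show m': "K' \<in> borel_measurable lborel" using K'm by (simp add: borel_prod)
    have "integrable lborel (\<lambda>w. (cmod (K w))\<^sup>2)" using K by (simp add: square_integrable_def)
    then show "integrable lborel (\<lambda>w. (cmod (K' w))\<^sup>2)"
      by (rule integrable_cong_AE_imp) (use m' ae in auto)
  qed
  have "schur_multiplier m (kop A) (kop B) = op_of_kernel K'"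
    by (simp add: schur_multiplier_def K'_def A'_def B'_def)
  also have "\<dots> = kop K'" by (rule op_of_kernel_eq[OF sK'])
  also have "\<dots> = kop K" by (rule kop_cong_AE[OF sK' K ae])
  finally show ?thesis .
qed

section \<open>Schatten norms of Hilbert--Schmidt operators\<close>

lemma cinner_sym_if_inner_sym:
  assumes S: "S \<in> bounded_ops" and sym: "\<And>x y. S x \<bullet> y = x \<bullet> S y"
  shows "cinner (S x) y = cinner x (S y)"
proof (rule complex_eqI)
  show "Re (cinner (S x) y) = Re (cinner x (S y))" using sym[of x y] by (simp add: inner_l2_def)
  have im: "Im (cinner u v) = l2_scaleC \<i> u \<bullet> v" for u v by (simp add: inner_l2_def)
  show "Im (cinner (S x) y) = Im (cinner x (S y))"
    unfolding im using S sym[of "l2_scaleC \<i> x" y] by (simp add: bounded_ops_def)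
qed

context
  fixes A :: "real \<times> real \<Rightarrow> complex"
  assumes A: "square_integrable lborel A"
begin

lemma kop_gram_inner:
  "(op_adjoint (kop A) o\<^sub>L kop A) x \<bullet> y = kop A x \<bullet> kop A y"
  unfolding op_adjoint_kop[OF A] inner_l2_def
  by (simp add: cinner_adj_kernel[OF A])

lemma kop_gram_psd: "op_psd (op_adjoint (kop A) o\<^sub>L kop A)"
  unfolding op_psd_def
  by (metis kop_gram_inner inner_commute inner_ge_zero)

lemma kop_gram_bounded_ops: "op_adjoint (kop A) o\<^sub>L kop A \<in> bounded_ops"
  unfolding op_adjoint_kop[OF A]
  using kop_bounded_ops[OF A] kop_bounded_ops[OF square_integrable_adj_kernel[OF A]]
  by (simp add: bounded_ops_def)

lemma op_abs_kop:
  shows "op_psd (op_abs (kop A))" "op_abs (kop A) \<in> bounded_ops"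
    and "op_abs (kop A) (op_abs (kop A) x) = op_adjoint (kop A) (kop A x)"
    and "norm (op_abs (kop A)) \<le> norm (kop A)"
proof -
  define P where "P = op_adjoint (kop A) o\<^sub>L kop A"
  have P: "op_psd P" "P \<in> bounded_ops" unfolding P_def by (rule kop_gram_psd, rule kop_gram_bounded_ops)
  have R: "op_abs (kop A) = op_cfc sqrt P" by (simp add: op_abs_def P_def)
  have c: "continuous_on {0..norm P} sqrt" by (intro continuous_intros)
  show psd: "op_psd (op_abs (kop A))" unfolding R by (rule op_cfc_psd[OF P(1) c]) simp
  show "op_abs (kop A) \<in> bounded_ops" unfolding R by (rule op_cfc_bounded_ops[OF P(1) c P(2)])
  have sq: "op_abs (kop A) (op_abs (kop A) x) = P x" for x
  proof -
    have "op_abs (kop A) (op_abs (kop A) x) = op_cfc (\<lambda>t. sqrt t * sqrt t) P x"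
      unfolding R by (rule op_cfc_square[OF P(1) c, symmetric])
    also have "op_cfc (\<lambda>t. sqrt t * sqrt t) P = op_poly [:0, 1:] P"
      by (rule op_cfc_poly[OF P(1)]) simp
    finally show ?thesis by simp
  qed
  show "op_abs (kop A) (op_abs (kop A) x) = op_adjoint (kop A) (kop A x)"
    using sq by (simp add: P_def)
  show "norm (op_abs (kop A)) \<le> norm (kop A)"
  proof (rule norm_blinfun_bound)
    fix x
    have "(norm (op_abs (kop A) x))\<^sup>2 = op_abs (kop A) (op_abs (kop A) x) \<bullet> x"
      by (simp add: power2_norm_eq_inner op_psd_sym[OF psd])
    also have "\<dots> = (norm (kop A x))\<^sup>2"
      unfolding sq P_def kop_gram_inner by (simp add: power2_norm_eq_inner)
    finally have "norm (op_abs (kop A) x) = norm (kop A x)" by (simp add: power2_eq_iff_nonneg)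
    then show "norm (op_abs (kop A) x) \<le> norm (kop A) * norm x" by (simp add: norm_blinfun)
  qed simp
qed

lemma continuous_on_powr_nonneg:
  assumes "p > 0"
  shows "continuous_on {0..b::real} (\<lambda>t. t powr p)"
  using assms by (intro continuous_on_powr') (auto intro!: continuous_intros)

text \<open>Writing \<open>|T|\<^sup>p\<close> as a square \<open>S\<^sup>2\<close> turns its diagonal entries into squared norms, to which the
  inequalities of Parseval and Bessel apply.\<close>

lemma op_abs_powr_root:
  assumes p: "p > 0"
  obtains S where "S \<in> bounded_ops" "\<And>x y. S x \<bullet> y = x \<bullet> S y" "\<And>x. op_abs_powr (kop A) p x = S (S x)"
proof -
  define R where "R = op_abs (kop A)"
  have R: "op_psd R" "R \<in> bounded_ops" by (simp_all add: R_def op_abs_kop)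
  have c: "continuous_on {0..norm R} (\<lambda>t. t powr (p/2))" by (rule continuous_on_powr_nonneg) (use p in simp)
  define S where "S = op_cfc (\<lambda>t. t powr (p/2)) R"
  have "op_abs_powr (kop A) p = op_cfc (\<lambda>t. t powr (p/2) * t powr (p/2)) R"
    unfolding op_abs_powr_def R_def by (rule op_cfc_cong) (simp flip: powr_add)
  then have "op_abs_powr (kop A) p x = S (S x)" for x
    using op_cfc_square[OF R(1) c] by (simp add: S_def)
  with op_cfc_bounded_ops[OF R(1) c R(2)] op_cfc_sym[OF R(1) c] show thesis
    using that by (simp add: S_def)
qed

text \<open>The two bounds that follow compare \<open>t\<^sup>p\<close> with even polynomials on the spectrum of \<open>|T|\<close>.
  Even polynomials are convenient because \<open>|T|\<^sup>2 = T\<^sup>*T\<close> makes their values explicit.\<close>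

lemma op_abs_powr_le:
  assumes p: "p \<ge> 2" and a: "norm (kop A) \<le> a"
  shows "x \<bullet> op_abs_powr (kop A) p x \<le> a powr (p - 2) * (norm (kop A x))\<^sup>2"
proof -
  define R where "R = op_abs (kop A)"
  have R: "op_psd R" by (simp add: R_def op_abs_kop)
  have na: "norm R \<le> a" using op_abs_kop(4) a by (simp add: R_def)
  have "x \<bullet> op_abs_powr (kop A) p x \<le> x \<bullet> op_poly [:0, 0, a powr (p - 2):] R x"
    unfolding op_abs_powr_def R_def[symmetric]
  proof (rule op_cfc_le[OF R])
    show "continuous_on {0..norm R} (\<lambda>t. t powr p)" by (rule continuous_on_powr_nonneg) (use p in simp)
    fix t assume t: "t \<in> {0..norm R}"
    show "t powr p \<le> poly [:0, 0, a powr (p - 2):] t"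
    proof (cases "t = 0")
      case False
      then have "t powr p = t powr (p - 2) * t powr 2" by (simp flip: powr_add)
      also have "\<dots> \<le> a powr (p - 2) * t powr 2"
        using t na p by (intro mult_right_mono powr_mono2) auto
      also have "t powr 2 = t * t" using t by (simp add: powr_numeral power2_eq_square)
      finally show ?thesis by (simp add: mult_ac)
    qed simp
  qed
  also have "\<dots> = a powr (p - 2) * (x \<bullet> R (R x))"
    by (simp add: blinfun.scaleR_right)
  also have "x \<bullet> R (R x) = (norm (kop A x))\<^sup>2"
    using kop_gram_inner[of x x] by (simp add: R_def op_abs_kop(3) power2_norm_eq_inner inner_commute)
  finally show ?thesis .
qed

lemma op_abs_powr_ge:
  assumes p: "p > 0" and r: "\<And>t. t \<ge> 0 \<Longrightarrow> c + a * t\<^sup>2 + b * t ^ 4 \<le> t powr p"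
  shows "c * (norm x)\<^sup>2 + a * (norm (kop A x))\<^sup>2 + b * (norm (op_adjoint (kop A) (kop A x)))\<^sup>2
     \<le> x \<bullet> op_abs_powr (kop A) p x"
proof -
  define R where "R = op_abs (kop A)"
  have R: "op_psd R" by (simp add: R_def op_abs_kop)
  have "x \<bullet> op_poly [:c, 0, a, 0, b:] R x \<le> x \<bullet> op_abs_powr (kop A) p x"
    unfolding op_abs_powr_def R_def[symmetric]
  proof (rule op_cfc_ge[OF R])
    show "continuous_on {0..norm R} (\<lambda>t. t powr p)" by (rule continuous_on_powr_nonneg[OF p])
    fix t assume t: "t \<in> {0..norm R}"
    have "poly [:c, 0, a, 0, b:] t = c + a * t\<^sup>2 + b * t ^ 4"
      by (simp add: power2_eq_square power4_eq_xxxx algebra_simps)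
    then show "poly [:c, 0, a, 0, b:] t \<le> t powr p" using r[of t] t by simp
  qed
  moreover have "x \<bullet> op_poly [:c, 0, a, 0, b:] R x
     = c * (x \<bullet> x) + a * (x \<bullet> R (R x)) + b * (x \<bullet> R (R (R (R x))))"
    by (simp add: blinfun.scaleR_right blinfun.add_right inner_add_right)
  moreover have "x \<bullet> R (R x) = (norm (kop A x))\<^sup>2"
    using kop_gram_inner[of x x] by (simp add: R_def op_abs_kop(3) power2_norm_eq_inner inner_commute)
  moreover have "x \<bullet> R (R (R (R x))) = (norm (op_adjoint (kop A) (kop A x)))\<^sup>2"
    unfolding op_abs_kop(3)[symmetric] R_def[symmetric] power2_norm_eq_inner
    by (simp add: op_psd_sym[OF R])
  ultimately show ?thesis by (simp add: power2_norm_eq_inner)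
qed

lemma op_trace_op_abs_powr:
  assumes S: "\<And>x y. S x \<bullet> y = x \<bullet> S y" "\<And>x. op_abs_powr (kop A) p x = S (S x)"
    and e: "e = (SOME e. orthonormal_basis e)"
  shows "op_trace (op_abs_powr (kop A) p) = (\<Sum>i. ennreal ((norm (S (e i)))\<^sup>2))"
proof -
  have "Re (cinner x (S (S x))) = (norm (S x))\<^sup>2" for x
    using S(1)[of x "S x"] by (simp add: inner_l2_def power2_norm_eq_inner)
  then show ?thesis by (simp add: op_trace_def e Let_def S(2))
qed

text \<open>Interpolation between the operator norm and the Hilbert--Schmidt norm.\<close>

lemma schatten_kop_le:
  assumes p: "p \<ge> 2" and a: "norm (kop A) \<le> a"
  shows "kop A \<in> schatten_class p"
    and "schatten_norm p (kop A) \<le> (a powr (p - 2) * hs2 A) powr (1 / p)"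
proof -
  obtain S where S: "S \<in> bounded_ops" "\<And>x y. S x \<bullet> y = x \<bullet> S y" "\<And>x. op_abs_powr (kop A) p x = S (S x)"
    by (rule op_abs_powr_root[of p]) (use p in auto)
  define e where "e = (SOME e. orthonormal_basis e)"
  have e: "orthonormal_basis e" unfolding e_def by (rule someI_ex[OF ex_orthonormal_basis])
  have "(\<Sum>i<n. ennreal ((norm (S (e i)))\<^sup>2)) \<le> ennreal (a powr (p - 2) * hs2 A)" for n
  proof -
    have o: "orthonormal_on {..<n} e"
      by (rule orthonormal_on_subset[OF orthonormal_basis_orthonormal_on[OF e]]) simp
    have "(\<Sum>i<n. (norm (S (e i)))\<^sup>2) \<le> (\<Sum>i<n. a powr (p - 2) * (norm (kop A (e i)))\<^sup>2)"
    proof (rule sum_mono)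
      fix i
      have "(norm (S (e i)))\<^sup>2 = e i \<bullet> op_abs_powr (kop A) p (e i)"
        by (simp add: S(3) power2_norm_eq_inner S(2))
      also have "\<dots> \<le> a powr (p - 2) * (norm (kop A (e i)))\<^sup>2" by (rule op_abs_powr_le[OF p a])
      finally show "(norm (S (e i)))\<^sup>2 \<le> a powr (p - 2) * (norm (kop A (e i)))\<^sup>2" .
    qed
    also have "\<dots> \<le> a powr (p - 2) * hs2 A"
      unfolding sum_distrib_left[symmetric] by (intro mult_left_mono hs_sum_le A o) auto
    finally show ?thesis by (simp add: ennreal_leI)
  qed
  then have tr: "op_trace (op_abs_powr (kop A) p) \<le> ennreal (a powr (p - 2) * hs2 A)"
    unfolding op_trace_op_abs_powr[OF S(2,3) e_def] by (intro suminf_le_const) auto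
  then have "op_trace (op_abs_powr (kop A) p) < \<infinity>" by (simp add: le_less_trans)
  then show "kop A \<in> schatten_class p" using kop_bounded_ops[OF A] by (simp add: schatten_class_def)
  have "enn2real (op_trace (op_abs_powr (kop A) p)) \<le> a powr (p - 2) * hs2 A"
    using tr hs2_nonneg by (intro enn2real_leI) auto
  then show "schatten_norm p (kop A) \<le> (a powr (p - 2) * hs2 A) powr (1 / p)"
    unfolding schatten_norm_def using p by (intro powr_mono2) auto
qed

text \<open>Testing the trace of \<open>|T|\<^sup>p\<close> on a finite orthonormal family, where the
  power function may be bounded below by a different even quartic polynomial for each vector.\<close>

lemma schatten_kop_ge:
  assumes p: "p > 0" and T: "kop A \<in> schatten_class p"
    and g: "orthonormal_on I g" "finite I"
    and r: "\<And>i t. i \<in> I \<Longrightarrow> t \<ge> 0 \<Longrightarrow> c i + a i * t\<^sup>2 + b i * t ^ 4 \<le> t powr p"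
  shows "(\<Sum>i\<in>I. c i + a i * (norm (kop A (g i)))\<^sup>2 + b i * (norm (op_adjoint (kop A) (kop A (g i))))\<^sup>2)
      \<le> schatten_norm p (kop A) powr p"
proof -
  obtain S where S: "S \<in> bounded_ops" "\<And>x y. S x \<bullet> y = x \<bullet> S y" "\<And>x. op_abs_powr (kop A) p x = S (S x)"
    by (rule op_abs_powr_root[OF p]) auto
  define e where "e = (SOME e. orthonormal_basis e)"
  have e: "orthonormal_basis e" unfolding e_def by (rule someI_ex[OF ex_orthonormal_basis])
  have tr: "op_trace (op_abs_powr (kop A) p) = (\<Sum>j. ennreal ((norm (S (e j)))\<^sup>2))"
    by (rule op_trace_op_abs_powr[OF S(2,3) e_def])
  have fin: "(\<Sum>j. ennreal ((norm (S (e j)))\<^sup>2)) \<noteq> top"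
    using T tr by (simp add: schatten_class_def less_top)
  have sm: "summable (\<lambda>j. (norm (S (e j)))\<^sup>2)"
    by (rule summable_suminf_not_top[OF _ fin]) simp
  have "schatten_norm p (kop A) powr p = enn2real (op_trace (op_abs_powr (kop A) p))"
    using p by (simp add: schatten_norm_def powr_powr)
  also have "\<dots> = (\<Sum>j. (norm (S (e j)))\<^sup>2)"
    unfolding tr by (subst suminf_ennreal2[OF _ sm]) (simp_all add: suminf_nonneg sm)
  finally have norm_eq: "schatten_norm p (kop A) powr p = (\<Sum>j. (norm (S (e j)))\<^sup>2)" .
  have sums: "(\<lambda>j. (cmod (cinner (g i) (S (e j))))\<^sup>2) sums (norm (S (g i)))\<^sup>2" for i
  proof -
    have "cmod (cinner (e j) (S (g i))) = cmod (cinner (g i) (S (e j)))" for j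
      by (metis cinner_sym_if_inner_sym[OF S(1,2)] cinner_commute complex_mod_cnj)
    then show ?thesis using Parseval[OF e, of "S (g i)"] by simp
  qed
  have "(\<Sum>i\<in>I. c i + a i * (norm (kop A (g i)))\<^sup>2 + b i * (norm (op_adjoint (kop A) (kop A (g i))))\<^sup>2)
      \<le> (\<Sum>i\<in>I. (norm (S (g i)))\<^sup>2)"
  proof (rule sum_mono)
    fix i assume i: "i \<in> I"
    have "c i * (norm (g i))\<^sup>2 + a i * (norm (kop A (g i)))\<^sup>2 + b i * (norm (op_adjoint (kop A) (kop A (g i))))\<^sup>2
        \<le> g i \<bullet> op_abs_powr (kop A) p (g i)"
      by (rule op_abs_powr_ge[OF p]) (use r i in auto)
    also have "\<dots> = (norm (S (g i)))\<^sup>2" by (simp add: S(3) power2_norm_eq_inner S(2))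
    finally show "c i + a i * (norm (kop A (g i)))\<^sup>2 + b i * (norm (op_adjoint (kop A) (kop A (g i))))\<^sup>2
      \<le> (norm (S (g i)))\<^sup>2"
      using orthonormal_on_norm[OF g(1) i] by simp
  qed
  also have "\<dots> \<le> (\<Sum>j. (norm (S (e j)))\<^sup>2)"
  proof (rule sums_le)
    show "(\<lambda>j. \<Sum>i\<in>I. (cmod (cinner (g i) (S (e j))))\<^sup>2) sums (\<Sum>i\<in>I. (norm (S (g i)))\<^sup>2)"
      by (intro sums_sum sums)
    show "(\<lambda>j. (norm (S (e j)))\<^sup>2) sums (\<Sum>j. (norm (S (e j)))\<^sup>2)" by (rule summable_sums[OF sm])
  qed (rule Bessel_finite[OF g])
  finally show ?thesis unfolding norm_eq .
qed

end

section \<open>The second divided difference of \<open>s\<bar>s\<bar>\<close> where the signs differ\<close>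

lemma deriv_signed_square: "deriv signed_square x = 2 * \<bar>x\<bar>"
proof (rule DERIV_imp_deriv)
  consider "x > 0" | "x < 0" | "x = 0" by linarith
  then show "(signed_square has_real_derivative 2 * \<bar>x\<bar>) (at x)"
  proof cases
    case 1
    have "((\<lambda>s. s * s) has_real_derivative 2 * \<bar>x\<bar>) (at x)"
      using 1 by (auto intro!: derivative_eq_intros)
    then show ?thesis
      by (rule has_field_derivative_transform_within_open[where S = "{0<..}"]) (use 1 in \<open>auto simp: signed_square_def\<close>)
  next
    case 2
    have "((\<lambda>s. - (s * s)) has_real_derivative 2 * \<bar>x\<bar>) (at x)"
      using 2 by (auto intro!: derivative_eq_intros)
    then show ?thesis
      by (rule has_field_derivative_transform_within_open[where S = "{..<0}"]) (use 2 in \<open>auto simp: signed_square_def\<close>)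
  next
    case 3
    have "((\<lambda>h. \<bar>h\<bar>) \<longlongrightarrow> \<bar>0 :: real\<bar>) (at 0)" by (intro tendsto_intros)
    moreover have "((\<lambda>h. (signed_square (0 + h) - signed_square 0) / h) \<longlongrightarrow> \<bar>0\<bar>) (at 0)
        = ((\<lambda>h. \<bar>h\<bar>) \<longlongrightarrow> \<bar>0 :: real\<bar>) (at 0)"
      by (rule LIM_equal) (simp add: signed_square_def)
    ultimately show ?thesis using 3 by (simp add: DERIV_def)
  qed
qed

text \<open>The identity behind the whole proof.  Each of the two quotients is close to 1 or to 0 according as
  \<open>b\<close> is much larger or much smaller than \<open>a\<close> (respectively \<open>c\<close>); at widely separated arguments the symbol is
  therefore \<open>1\<close> minus twice a product of two triangular truncations that share their first index.\<close>

lemma divdiff2_signed_square: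
  assumes "a > 0" "b > 0" "c > 0"
  shows "divdiff2 signed_square (- b) a c = 1 - 2 * (b / (a + b)) * (b / (b + c))"
proof -
  have 1: "divdiff1 signed_square (- b) a = (a * a + b * b) / (a + b)"
  proof -
    have "a + b \<noteq> 0" "- b - a \<noteq> 0" using assms by auto
    then have "(- (b * b) - a * a) / (- b - a) = (a * a + b * b) / (a + b)"
      by (simp add: divide_simps) (simp add: algebra_simps)
    then show ?thesis using assms by (simp add: divdiff1_def signed_square_def)
  qed
  have 2: "divdiff1 signed_square a c = a + c"
    using assms by (auto simp: divdiff1_def signed_square_def deriv_signed_square field_simps)
  have "divdiff2 signed_square (- b) a c = ((a * a + b * b) / (a + b) - (a + c)) / (- b - c)"
    unfolding divdiff2_def 1 2 using assms by simp
  also have "\<dots> = 1 - 2 * (b / (a + b)) * (b / (b + c))"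
  proof -
    have "a + b \<noteq> 0" "b + c \<noteq> 0" "- b - c \<noteq> 0" using assms by auto
    then show ?thesis by (simp add: divide_simps) (simp add: algebra_simps)
  qed
  finally show ?thesis .
qed

lemma divdiff2_measurable:
  "(\<lambda>(x, y, z). complex_of_real (divdiff2 signed_square x y z)) \<in> borel_measurable (borel \<Otimes>\<^sub>M (borel \<Otimes>\<^sub>M borel))"
  unfolding divdiff2_def divdiff1_def deriv_signed_square signed_square_def by measurable

section \<open>Step kernels\<close>

locale unit_family =
  fixes I :: "'i set" and J :: "'i \<Rightarrow> real set"
  assumes finite_I: "finite I"
    and J_borel [measurable]: "\<And>i. J i \<in> sets borel"
    and J_emeasure: "\<And>i. i \<in> I \<Longrightarrow> emeasure lborel (J i) = 1"
    and J_disjoint: "disjoint_family_on J I"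
begin

lemma J_unique: "i \<in> I \<Longrightarrow> j \<in> I \<Longrightarrow> s \<in> J i \<Longrightarrow> s \<in> J j \<Longrightarrow> i = j"
  using J_disjoint by (auto simp: disjoint_family_on_def)

lemma J_measure: "i \<in> I \<Longrightarrow> measure lborel (J i) = 1"
  by (simp add: measure_def J_emeasure)

lemma sum_step:
  fixes f :: "'i \<Rightarrow> 'a :: {real_vector, semiring_1}"
  assumes "i \<in> I" "s \<in> J i"
  shows "(\<Sum>j\<in>I. f j * indicator (J j) s) = f i"
proof -
  have "(\<Sum>j\<in>I. f j * indicator (J j) s) = (\<Sum>j\<in>I. if j = i then f j else 0)"
    by (intro sum.cong refl) (use assms J_unique in \<open>auto simp: indicator_def\<close>)
  then show ?thesis using finite_I assms by simp
qed

lemma sum_step_0: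
  fixes f :: "'i \<Rightarrow> 'a :: {real_vector, semiring_1}"
  assumes "\<And>i. i \<in> I \<Longrightarrow> s \<notin> J i"
  shows "(\<Sum>j\<in>I. f j * indicator (J j) s) = 0"
  using assms by (intro sum.neutral) auto

lemma cmod_sum_step:
  "(cmod (\<Sum>j\<in>I. f j * indicator (J j) s))\<^sup>2 = (\<Sum>j\<in>I. (cmod (f j))\<^sup>2 * indicator (J j) s)"
proof (cases "\<exists>i\<in>I. s \<in> J i")
  case True
  then obtain i where i: "i \<in> I" "s \<in> J i" by blast
  show ?thesis unfolding sum_step[OF i] ..
next
  case False
  then have *: "\<And>i. i \<in> I \<Longrightarrow> s \<notin> J i" by blast
  have "(\<Sum>j\<in>I. f j * indicator (J j) s) = 0" "(\<Sum>j\<in>I. (cmod (f j))\<^sup>2 * indicator (J j) s) = 0"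
    by (rule sum_step_0, rule *, assumption)+
  then show ?thesis by simp
qed

lemma integral_step:
  fixes f :: "'i \<Rightarrow> real"
  shows "(\<integral>t. (\<Sum>i\<in>I. f i * indicator (J i) t) \<partial>lborel) = (\<Sum>i\<in>I. f i)"
proof -
  have "(\<integral>t. (\<Sum>i\<in>I. f i * indicator (J i) t) \<partial>lborel) = (\<Sum>i\<in>I. \<integral>t. f i * indicator (J i) t \<partial>lborel)"
    by (rule Bochner_Integration.integral_sum) (use J_emeasure in \<open>auto intro!: integrable_mult_right\<close>)
  also have "\<dots> = (\<Sum>i\<in>I. f i)"
    by (intro sum.cong refl) (simp add: J_measure)
  finally show ?thesis .
qed

lemma orthonormal: "orthonormal_on I (\<lambda>i. ind_l2 (J i))"
  using J_emeasure J_disjoint by (intro orthonormal_ind_l2) auto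

lemma square_integrable_ind: "i \<in> I \<Longrightarrow> square_integrable lborel (indicator (J i) :: real \<Rightarrow> complex)"
  using integrable_on_interval(2)[OF square_integrable_zero, of "J i"] J_emeasure[of i] by simp

lemma abs_l2_step:
  "abs_l2 (\<lambda>t. \<Sum>i\<in>I. c i * indicator (J i) t) = (\<Sum>i\<in>I. l2_scaleC (c i) (ind_l2 (J i)))"
proof -
  have "F \<subseteq> I \<Longrightarrow> square_integrable lborel (\<lambda>t. \<Sum>i\<in>F. c i * indicator (J i) t) \<and>
    abs_l2 (\<lambda>t. \<Sum>i\<in>F. c i * indicator (J i) t) = (\<Sum>i\<in>F. l2_scaleC (c i) (ind_l2 (J i)))"
    if "finite F" for F
    using that
  proof induction
    case empty
    then show ?case by (simp add: square_integrable_zero zero_l2_def)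
  next
    case (insert x F)
    have s: "square_integrable lborel (\<lambda>t. c x * indicator (J x) t)"
      using insert square_integrable_ind by (intro square_integrable_cmult) auto
    have "l2_scaleC (c x) (ind_l2 (J x)) = abs_l2 (\<lambda>t. c x * indicator (J x) t)"
      unfolding ind_l2_def using insert square_integrable_ind by (intro abs_l2_scaleC) auto
    moreover have F: "square_integrable lborel (\<lambda>t. \<Sum>i\<in>F. c i * indicator (J i) t)"
      "abs_l2 (\<lambda>t. \<Sum>i\<in>F. c i * indicator (J i) t) = (\<Sum>i\<in>F. l2_scaleC (c i) (ind_l2 (J i)))"
      using insert by blast+
    ultimately show ?case
      unfolding sum.insert[OF insert(1,2)]
      using square_integrable_add[OF s F(1)] abs_l2_add[OF s F(1)] by (simp only: simp_thms)
  qed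
  then show ?thesis using finite_I by blast
qed

end

definition step_kernel ::
    "'x set \<Rightarrow> ('x \<Rightarrow> real set) \<Rightarrow> 'y set \<Rightarrow> ('y \<Rightarrow> real set) \<Rightarrow> ('x \<Rightarrow> 'y \<Rightarrow> complex) \<Rightarrow> real \<times> real \<Rightarrow> complex" where
  "step_kernel X J Y L a z = (\<Sum>x\<in>X. (\<Sum>y\<in>Y. a x y * indicator (L y) (snd z)) * indicator (J x) (fst z))"

lemma step_kernel_eq:
  "step_kernel X J Y L a z = (\<Sum>x\<in>X. \<Sum>y\<in>Y. a x y * (indicator (J x) (fst z) * indicator (L y) (snd z)))"
  unfolding step_kernel_def sum_distrib_right by (simp only: mult_ac)

lemma square_integrable_sum:
  assumes "\<And>i. i \<in> I \<Longrightarrow> square_integrable M (f i)"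
  shows "square_integrable M (\<lambda>z. \<Sum>i\<in>I. f i z)"
  using assms
  by (induction I rule: infinite_finite_induct) (auto simp: square_integrable_zero square_integrable_add)

locale step_pair = X: unit_family X J + Y: unit_family Y L
  for X :: "'x set" and J and Y :: "'y set" and L
begin

abbreviation "\<K> \<equiv> step_kernel X J Y L"

lemma step_kernel_square_integrable: "square_integrable lborel (\<K> a)"
proof -
  have "square_integrable lborel (\<lambda>z. \<Sum>x\<in>X. \<Sum>y\<in>Y. a x y * (indicator (J x) (fst z) * indicator (L y) (snd z)))"
    by (intro square_integrable_sum square_integrable_cmult square_integrable_tensor X.square_integrable_ind Y.square_integrable_ind)
  then show ?thesis
    unfolding step_kernel_eq[abs_def] .
qed

lemma cmod_step_kernel:
  "(cmod (\<K> a (s, t)))\<^sup>2 = (\<Sum>x\<in>X. (\<Sum>y\<in>Y. (cmod (a x y))\<^sup>2 * indicator (L y) t) * indicator (J x) s)"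
  unfolding step_kernel_def fst_conv snd_conv X.cmod_sum_step Y.cmod_sum_step ..

lemma hs2_step_kernel: "hs2 (\<K> a) = (\<Sum>x\<in>X. \<Sum>y\<in>Y. (cmod (a x y))\<^sup>2)"
proof -
  have 1: "(\<integral>t. (cmod (\<K> a (s, t)))\<^sup>2 \<partial>lborel) = (\<Sum>x\<in>X. (\<Sum>y\<in>Y. (cmod (a x y))\<^sup>2) * indicator (J x) s)" for s
  proof -
    have "(cmod (\<K> a (s, t)))\<^sup>2 = (\<Sum>y\<in>Y. (\<Sum>x\<in>X. (cmod (a x y))\<^sup>2 * indicator (J x) s) * indicator (L y) t)" for t
      unfolding cmod_step_kernel sum_distrib_right by (subst sum.swap) (simp only: mult_ac)
    then have "(\<integral>t. (cmod (\<K> a (s, t)))\<^sup>2 \<partial>lborel) = (\<Sum>y\<in>Y. \<Sum>x\<in>X. (cmod (a x y))\<^sup>2 * indicator (J x) s)"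
      by (simp only: Y.integral_step)
    also have "\<dots> = (\<Sum>x\<in>X. (\<Sum>y\<in>Y. (cmod (a x y))\<^sup>2) * indicator (J x) s)"
      unfolding sum_distrib_right by (rule sum.swap)
    finally show ?thesis .
  qed
  have "hs2 (\<K> a) = (\<integral>s. (\<integral>t. (cmod (\<K> a (s, t)))\<^sup>2 \<partial>lborel) \<partial>lborel)"
    by (rule kernel_section_integral(2)[OF step_kernel_square_integrable, symmetric])
  also have "\<dots> = (\<Sum>x\<in>X. \<Sum>y\<in>Y. (cmod (a x y))\<^sup>2)"
    unfolding 1 by (rule X.integral_step)
  finally show ?thesis .
qed

lemma kop_step_kernel:
  "kop (\<K> a) \<xi> = (\<Sum>x\<in>X. l2_scaleC (\<Sum>y\<in>Y. a x y * cinner (ind_l2 (L y)) \<xi>) (ind_l2 (J x)))"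
proof -
  have fin: "y \<in> Y \<Longrightarrow> emeasure lborel (L y) < \<infinity>" for y using Y.J_emeasure[of y] by simp
  have i: "integrable lborel (\<lambda>s. indicator (L y) s * rep_l2 \<xi> s)" if "y \<in> Y" for y
    using fin[OF that] by (intro integrable_on_interval(1)) auto
  have "kfun (\<K> a) (rep_l2 \<xi>) t = (\<Sum>x\<in>X. (\<Sum>y\<in>Y. a x y * cinner (ind_l2 (L y)) \<xi>) * indicator (J x) t)" for t
  proof -
    have "kfun (\<K> a) (rep_l2 \<xi>) t =
      (\<integral>s. (\<Sum>x\<in>X. \<Sum>y\<in>Y. (a x y * indicator (J x) t) * (indicator (L y) s * rep_l2 \<xi> s)) \<partial>lborel)"
      unfolding kfun_def step_kernel_eq sum_distrib_right fst_conv snd_conv by (simp only: mult_ac)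
    also have "\<dots> = (\<Sum>x\<in>X. \<Sum>y\<in>Y. (a x y * indicator (J x) t) * (\<integral>s. indicator (L y) s * rep_l2 \<xi> s \<partial>lborel))"
      by (subst Bochner_Integration.integral_sum, (auto intro!: Bochner_Integration.integrable_sum i)[1],
          rule sum.cong[OF refl], subst Bochner_Integration.integral_sum) (auto intro!: i)
    also have "\<dots> = (\<Sum>x\<in>X. \<Sum>y\<in>Y. (a x y * indicator (J x) t) * cinner (ind_l2 (L y)) \<xi>)"
      by (intro sum.cong refl) (simp only: cinner_ind_l2[OF Y.J_borel fin])
    finally show ?thesis unfolding sum_distrib_right by (simp only: mult_ac)
  qed
  then have "kfun (\<K> a) (rep_l2 \<xi>) = (\<lambda>t. \<Sum>x\<in>X. (\<Sum>y\<in>Y. a x y * cinner (ind_l2 (L y)) \<xi>) * indicator (J x) t)" by auto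
  then show ?thesis
    by (simp add: kop_apply[OF step_kernel_square_integrable] X.abs_l2_step)
qed

lemma kop_step_kernel_sum:
  "kop (\<K> a) (\<Sum>y\<in>Y. l2_scaleC (v y) (ind_l2 (L y))) = (\<Sum>x\<in>X. l2_scaleC (\<Sum>y\<in>Y. a x y * v y) (ind_l2 (J x)))"
  unfolding kop_step_kernel
  by (intro sum.cong refl arg_cong2[where f = l2_scaleC])
     (simp add: orthonormal_cinner_sum[OF Y.orthonormal Y.finite_I])

lemma norm_kop_step_kernel_le_1:
  assumes "\<And>v. (\<Sum>x\<in>X. (cmod (\<Sum>y\<in>Y. a x y * v y))\<^sup>2) \<le> (\<Sum>y\<in>Y. (cmod (v y))\<^sup>2)"
  shows "norm (kop (\<K> a)) \<le> 1"
proof (rule norm_blinfun_bound)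
  fix \<xi>
  have "(norm (kop (\<K> a) \<xi>))\<^sup>2 = (\<Sum>x\<in>X. (cmod (\<Sum>y\<in>Y. a x y * cinner (ind_l2 (L y)) \<xi>))\<^sup>2)"
    unfolding kop_step_kernel by (rule norm_orthonormal_sum[OF X.orthonormal X.finite_I])
  also have "\<dots> \<le> (\<Sum>y\<in>Y. (cmod (cinner (ind_l2 (L y)) \<xi>))\<^sup>2)" by (rule assms)
  also have "\<dots> \<le> (norm \<xi>)\<^sup>2" by (rule Bessel_finite[OF Y.orthonormal Y.finite_I])
  finally have "norm (kop (\<K> a) \<xi>) \<le> norm \<xi>" by (rule power2_le_imp_le) simp
  then show "norm (kop (\<K> a) \<xi>) \<le> 1 * norm \<xi>" by simp
qed simp

lemma adj_step_kernel: "adj_kernel (\<K> a) = step_kernel Y L X J (\<lambda>y x. cnj (a x y))"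
proof
  fix z :: "real \<times> real"
  have c: "cnj (indicator S t) = indicator S t" for S and t :: real by (simp add: indicator_def)
  have "adj_kernel (\<K> a) z = (\<Sum>x\<in>X. \<Sum>y\<in>Y. cnj (a x y) * indicator (L y) (fst z) * indicator (J x) (snd z))"
    by (simp only: adj_kernel_def step_kernel_eq case_prod_unfold c cnj_sum complex_cnj_mult fst_conv snd_conv mult_ac)
  also have "\<dots> = (\<Sum>y\<in>Y. \<Sum>x\<in>X. cnj (a x y) * indicator (L y) (fst z) * indicator (J x) (snd z))"
    by (rule sum.swap)
  also have "\<dots> = step_kernel Y L X J (\<lambda>y x. cnj (a x y)) z"
    unfolding step_kernel_eq by (simp only: mult_ac)
  finally show "adj_kernel (\<K> a) z = step_kernel Y L X J (\<lambda>y x. cnj (a x y)) z" .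
qed

end

lemma norm_kop_adj_le:
  assumes A: "square_integrable lborel A"
  shows "norm (kop (adj_kernel A) x) \<le> norm (kop A) * norm x"
proof (cases "kop (adj_kernel A) x = 0")
  case False
  have "(norm (kop (adj_kernel A) x))\<^sup>2 = x \<bullet> kop A (kop (adj_kernel A) x)"
    unfolding power2_norm_eq_inner inner_l2_def cinner_adj_kernel[OF A] ..
  also have "\<dots> \<le> norm x * norm (kop A (kop (adj_kernel A) x))" by (rule norm_cauchy_schwarz)
  also have "\<dots> \<le> norm x * (norm (kop A) * norm (kop (adj_kernel A) x))"
    by (intro mult_left_mono norm_blinfun) auto
  finally have "norm (kop (adj_kernel A) x) * norm (kop (adj_kernel A) x)
      \<le> (norm (kop A) * norm x) * norm (kop (adj_kernel A) x)"
    by (simp add: power2_eq_square mult_ac)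
  then show ?thesis using False by (simp add: mult_le_cancel_right)
qed simp

section \<open>Exponentially separated cells\<close>

text \<open>The cells have length 1, so that their indicators are orthonormal, while the ratio of points of two
  different cells tends to \<open>0\<close> or \<open>\<infinity>\<close> with \<open>\<rho>\<close>.\<close>

definition exp_cell :: "real \<Rightarrow> nat \<Rightarrow> real set" where
  "exp_cell \<rho> n = {\<rho> ^ n <..< \<rho> ^ n + 1}"

definition neg_cell :: "real \<Rightarrow> nat \<Rightarrow> real set" where
  "neg_cell \<rho> n = {- (\<rho> ^ n) - 1 <..< - (\<rho> ^ n)}"

lemma mult_power_le_power:
  fixes \<rho> :: real
  assumes "\<rho> \<ge> 1" "m < n"
  shows "\<rho> * \<rho> ^ m \<le> \<rho> ^ n"
  using power_increasing[of "Suc m" n \<rho>] assms by simp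

lemma exp_cell_disjoint:
  assumes "\<rho> \<ge> 2" "m \<noteq> n"
  shows "exp_cell \<rho> m \<inter> exp_cell \<rho> n = {}" "neg_cell \<rho> m \<inter> neg_cell \<rho> n = {}"
proof -
  have gap: "\<rho> ^ m + 1 \<le> \<rho> ^ n" if "m < n" for m n
  proof -
    have "\<rho> ^ m \<ge> 1" using assms by (simp add: one_le_power)
    then have "\<rho> ^ m + 1 \<le> 2 * \<rho> ^ m" by simp
    also have "\<dots> \<le> \<rho> * \<rho> ^ m" using assms \<open>\<rho> ^ m \<ge> 1\<close> by (intro mult_right_mono) auto
    also have "\<dots> \<le> \<rho> ^ n" using assms that by (intro mult_power_le_power) auto
    finally show ?thesis .
  qed
  consider "m < n" | "n < m" using assms by linarith
  then show "exp_cell \<rho> m \<inter> exp_cell \<rho> n = {}" "neg_cell \<rho> m \<inter> neg_cell \<rho> n = {}"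
    by (cases; use gap[of m n] gap[of n m] in \<open>auto simp: exp_cell_def neg_cell_def\<close>)+
qed

lemma unit_family_cells:
  assumes "\<rho> \<ge> 2" "finite X" "inj_on \<alpha> X"
  shows "unit_family X (\<lambda>x. exp_cell \<rho> (\<alpha> x))" "unit_family X (\<lambda>x. neg_cell \<rho> (\<alpha> x))"
proof -
  have "\<alpha> x \<noteq> \<alpha> y" if "x \<in> X" "y \<in> X" "x \<noteq> y" for x y
    using assms(3) that by (auto dest: inj_onD)
  then have "disjoint_family_on (\<lambda>x. exp_cell \<rho> (\<alpha> x)) X" "disjoint_family_on (\<lambda>x. neg_cell \<rho> (\<alpha> x)) X"
    unfolding disjoint_family_on_def using exp_cell_disjoint[OF assms(1)] by blast+
  then show "unit_family X (\<lambda>x. exp_cell \<rho> (\<alpha> x))" "unit_family X (\<lambda>x. neg_cell \<rho> (\<alpha> x))"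
    using assms(2) by (auto simp: unit_family_def exp_cell_def neg_cell_def)
qed

lemma cell_ratio:
  assumes \<rho>: "\<rho> \<ge> 2" and b: "b \<in> exp_cell \<rho> i" and a: "a \<in> exp_cell \<rho> j" and ij: "i \<noteq> j"
  shows "\<bar>b / (a + b) - (if j < i then 1 else 0)\<bar> \<le> 2 / \<rho>" "0 \<le> b / (a + b)" "b / (a + b) \<le> 1"
proof -
  have 1: "\<rho> ^ i \<ge> 1" "\<rho> ^ j \<ge> 1" using \<rho> by (simp_all add: one_le_power)
  have ab: "a > 0" "b > 0" "a \<le> 2 * \<rho> ^ j" "b \<le> 2 * \<rho> ^ i" "\<rho> ^ j \<le> a" "\<rho> ^ i \<le> b"
    using a b 1 by (auto simp: exp_cell_def)
  have frac: "u / (u + v) \<le> 2 / \<rho>" if "u > 0" "v > 0" "u \<le> 2 * \<rho> ^ m" "\<rho> ^ n \<le> v" "m < n" for u v m n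
  proof -
    have "\<rho> * u \<le> 2 * (\<rho> * \<rho> ^ m)" using that \<rho> mult_left_mono[OF that(3), of \<rho>] by simp
    also have "\<dots> \<le> 2 * \<rho> ^ n" using mult_power_le_power[of \<rho> m n] \<rho> that by simp
    also have "\<dots> \<le> 2 * (u + v)" using that by simp
    finally show ?thesis using that \<rho> by (simp add: field_simps)
  qed
  show "0 \<le> b / (a + b)" "b / (a + b) \<le> 1" using ab by simp_all
  show "\<bar>b / (a + b) - (if j < i then 1 else 0)\<bar> \<le> 2 / \<rho>"
  proof (cases "j < i")
    case True
    have "1 - b / (a + b) = a / (a + b)" using ab by (simp add: field_simps)
    moreover have "a / (a + b) \<le> 2 / \<rho>" using frac[of a b j i] ab True by simp
    moreover have "a / (a + b) \<ge> 0" using ab by simp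
    ultimately show ?thesis using True by simp
  next
    case False
    have "b / (b + a) \<le> 2 / \<rho>" using frac[of b a i j] ab False ij by simp
    then show ?thesis using False ab by (simp add: add.commute)
  qed
qed

text \<open>The limit of the divided difference on cells with exponents \<open>i\<close> (on the negative half-line) and
  \<open>j\<close>, \<open>k\<close> (on the positive one), as \<open>\<rho>\<close> tends to infinity.\<close>

definition sign_mask :: "nat \<Rightarrow> nat \<Rightarrow> nat \<Rightarrow> real" where
  "sign_mask i j k = (if j < i \<and> k < i then - 1 else 1)"

lemma divdiff2_near_mask:
  assumes \<rho>: "\<rho> \<ge> 2" and s: "s \<in> neg_cell \<rho> i" and y: "y \<in> exp_cell \<rho> j" and t: "t \<in> exp_cell \<rho> k"
    and "i \<noteq> j" "i \<noteq> k"
  shows "\<bar>divdiff2 signed_square s y t - sign_mask i j k\<bar> \<le> 8 / \<rho>"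
proof -
  define b where "b = - s"
  have b: "b \<in> exp_cell \<rho> i" using s by (auto simp: b_def neg_cell_def exp_cell_def)
  have pos: "u > 0" if "u \<in> exp_cell \<rho> n" for u n
  proof -
    have "\<rho> ^ n > 0" using \<rho> by simp
    then show ?thesis using that by (auto simp: exp_cell_def)
  qed
  define u where "u = b / (y + b)"
  define v where "v = b / (t + b)"
  define U :: real where "U = (if j < i then 1 else 0)"
  define V :: real where "V = (if k < i then 1 else 0)"
  have u: "\<bar>u - U\<bar> \<le> 2 / \<rho>" "0 \<le> u" "u \<le> 1"
    unfolding u_def U_def using cell_ratio[OF \<rho> b y] assms by auto
  have v: "\<bar>v - V\<bar> \<le> 2 / \<rho>" "0 \<le> v" "v \<le> 1"
    unfolding v_def V_def using cell_ratio[OF \<rho> b t] assms by auto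
  have "divdiff2 signed_square s y t = 1 - 2 * u * v"
    using divdiff2_signed_square[OF pos[OF y] pos[OF b] pos[OF t]] by (simp add: u_def v_def b_def add.commute)
  moreover have "sign_mask i j k = 1 - 2 * U * V" by (simp add: sign_mask_def U_def V_def)
  ultimately have "divdiff2 signed_square s y t - sign_mask i j k = - 2 * ((u - U) * v + U * (v - V))"
    by (simp only:) (simp add: algebra_simps)
  moreover have "\<bar>- 2 * (e + e')\<bar> \<le> 2 * (\<bar>e\<bar> + \<bar>e'\<bar>)" for e e' :: real
    using abs_triangle_ineq[of e e'] abs_mult[of "-2" "e + e'"] by argo
  ultimately have "\<bar>divdiff2 signed_square s y t - sign_mask i j k\<bar> \<le> 2 * (\<bar>(u - U) * v\<bar> + \<bar>U * (v - V)\<bar>)"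
    by (simp only:)
  also have "\<dots> \<le> 2 * (\<bar>u - U\<bar> * 1 + 1 * \<bar>v - V\<bar>)"
    unfolding abs_mult by (intro mult_left_mono add_mono mult_right_mono) (use v in \<open>auto simp: U_def\<close>)
  also have "\<dots> \<le> 8 / \<rho>" using u(1) v(1) by simp
  finally show ?thesis .
qed

abbreviation "dd2 x y z \<equiv> complex_of_real (divdiff2 signed_square x y z)"

lemma dd2_measurable [measurable (raw)]:
  assumes "f \<in> borel_measurable M" "g \<in> borel_measurable M" "h \<in> borel_measurable M"
  shows "(\<lambda>w. dd2 (f w) (g w) (h w)) \<in> borel_measurable M"
  using measurable_compose[OF _ divdiff2_measurable, of "\<lambda>w. (f w, g w, h w)" M] assms by simp

lemma dd2_cell_average:
  assumes \<rho>: "\<rho> \<ge> 2" and s: "s \<in> neg_cell \<rho> i" and t: "t \<in> exp_cell \<rho> k"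
    and ij: "i \<noteq> j" "i \<noteq> k"
  shows "integrable lborel (\<lambda>y. dd2 s y t * indicator (exp_cell \<rho> j) y)"
    and "cmod ((\<integral>y. dd2 s y t * indicator (exp_cell \<rho> j) y \<partial>lborel) - of_real (sign_mask i j k)) \<le> 8 / \<rho>"
proof -
  let ?I = "indicator (exp_cell \<rho> j) :: real \<Rightarrow> complex"
  let ?M = "complex_of_real (sign_mask i j k)"
  have em: "emeasure lborel (exp_cell \<rho> j) = 1" "exp_cell \<rho> j \<in> sets borel" by (auto simp: exp_cell_def)
  note [measurable] = em(2)
  have ri: "integrable lborel (\<lambda>y. 8 / \<rho> * indicator (exp_cell \<rho> j) y :: real)"
    using em by (intro integrable_mult_right) simp
  have bd: "cmod ((dd2 s y t - ?M) * ?I y) \<le> 8 / \<rho> * indicator (exp_cell \<rho> j) y" for y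
    using divdiff2_near_mask[OF \<rho> s _ t ij, of y]
    by (cases "y \<in> exp_cell \<rho> j") (auto simp: indicator_def simp flip: of_real_diff)
  have di: "integrable lborel (\<lambda>y. (dd2 s y t - ?M) * ?I y)"
    by (rule Bochner_Integration.integrable_bound[OF ri]) (simp, rule AE_I2, rule order_trans[OF bd], simp only: real_norm_def abs_ge_self)
  have "integrable lborel (indicator (exp_cell \<rho> j) :: real \<Rightarrow> real)" using em by simp
  then have "integrable lborel ?I" by (rule Bochner_Integration.integrable_bound) (auto simp: indicator_def)
  then have ci: "integrable lborel (\<lambda>y. ?M * ?I y)" by (intro integrable_mult_right)
  have sum: "(\<lambda>y. dd2 s y t * ?I y) = (\<lambda>y. (dd2 s y t - ?M) * ?I y + ?M * ?I y)"
    by (simp add: algebra_simps)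
  show "integrable lborel (\<lambda>y. dd2 s y t * ?I y)"
    unfolding sum using di ci by (rule Bochner_Integration.integrable_add)
  have "?I = (\<lambda>y. complex_of_real (indicator (exp_cell \<rho> j) y))" by (auto simp: indicator_def)
  then have "(\<integral>y. ?I y \<partial>lborel) = complex_of_real (\<integral>y. indicator (exp_cell \<rho> j) y \<partial>lborel)"
    by (simp only: integral_complex_of_real)
  then have "(\<integral>y. ?I y \<partial>lborel) = 1"
    using em by (simp add: measure_def)
  then have "(\<integral>y. dd2 s y t * ?I y \<partial>lborel) - ?M = (\<integral>y. (dd2 s y t - ?M) * ?I y \<partial>lborel)"
    unfolding sum Bochner_Integration.integral_add[OF di ci] by simp
  also have "cmod \<dots> \<le> (\<integral>y. cmod ((dd2 s y t - ?M) * ?I y) \<partial>lborel)" by (rule integral_norm_bound)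
  also have "\<dots> \<le> (\<integral>y. 8 / \<rho> * indicator (exp_cell \<rho> j) y \<partial>lborel)"
    by (rule integral_mono[OF integrable_norm[OF di] ri]) (rule bd)
  also have "\<dots> = 8 / \<rho>" using em by (simp add: measure_def)
  finally show "cmod ((\<integral>y. dd2 s y t * ?I y \<partial>lborel) - ?M) \<le> 8 / \<rho>" .
qed

lemma square_integrable_bound:
  assumes "f \<in> borel_measurable M" "square_integrable M g" "\<And>z. cmod (f z) \<le> cmod (g z)"
  shows "square_integrable M f"
  unfolding square_integrable_def
proof
  have gi: "integrable M (\<lambda>z. (cmod (g z))\<^sup>2)" using assms by (simp add: square_integrable_def)
  show "integrable M (\<lambda>x. (cmod (f x))\<^sup>2)"
    by (rule Bochner_Integration.integrable_bound[OF gi]) (use assms in \<open>auto intro!: power_mono\<close>)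
qed (rule assms)

lemma hs2_mono:
  assumes "square_integrable lborel f" "square_integrable lborel g" "\<And>z. cmod (f z) \<le> cmod (g z)"
  shows "hs2 f \<le> hs2 g"
  unfolding hs2_def
  by (rule integral_mono) (use assms in \<open>auto simp: square_integrable_def intro!: power_mono\<close>)

text \<open>The composed kernel is not a step kernel, since the divided difference still varies over the
  cells.  Its distance from the masked product is dominated by the step kernel \<open>d\<close>, whose
  Hilbert--Schmidt norm is explicit and tends to 0 as \<open>\<rho>\<close> grows.\<close>

lemma schur_step_kernels:
  fixes X :: "'x set" and Y :: "'y set" and Z :: "'z set"
    and a :: "'x \<Rightarrow> 'y \<Rightarrow> complex" and b :: "'y \<Rightarrow> 'z \<Rightarrow> complex"
  assumes \<rho>: "\<rho> \<ge> 2"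
    and XY: "step_pair X (\<lambda>x. neg_cell \<rho> (\<alpha> x)) Y (\<lambda>y. exp_cell \<rho> (\<beta> y))"
    and YZ: "step_pair Y (\<lambda>y. exp_cell \<rho> (\<beta> y)) Z (\<lambda>z. exp_cell \<rho> (\<gamma> z))"
    and ne: "\<And>x y. x \<in> X \<Longrightarrow> y \<in> Y \<Longrightarrow> \<alpha> x \<noteq> \<beta> y" "\<And>x z. x \<in> X \<Longrightarrow> z \<in> Z \<Longrightarrow> \<alpha> x \<noteq> \<gamma> z"
  defines "A \<equiv> step_kernel X (\<lambda>x. neg_cell \<rho> (\<alpha> x)) Y (\<lambda>y. exp_cell \<rho> (\<beta> y)) a"
    and "B \<equiv> step_kernel Y (\<lambda>y. exp_cell \<rho> (\<beta> y)) Z (\<lambda>z. exp_cell \<rho> (\<gamma> z)) b"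
    and "k \<equiv> \<lambda>x z. \<Sum>y\<in>Y. of_real (sign_mask (\<alpha> x) (\<beta> y) (\<gamma> z)) * a x y * b y z"
    and "d \<equiv> \<lambda>x z. complex_of_real (8 / \<rho> * (\<Sum>y\<in>Y. cmod (a x y) * cmod (b y z)))"
  shows "cmod ((\<integral>y. dd2 s y t * A (s, y) * B (y, t) \<partial>lborel)
       - step_kernel X (\<lambda>x. neg_cell \<rho> (\<alpha> x)) Z (\<lambda>z. exp_cell \<rho> (\<gamma> z)) k (s, t))
     \<le> cmod (step_kernel X (\<lambda>x. neg_cell \<rho> (\<alpha> x)) Z (\<lambda>z. exp_cell \<rho> (\<gamma> z)) d (s, t))"
proof -
  interpret XY: step_pair X "\<lambda>x. neg_cell \<rho> (\<alpha> x)" Y "\<lambda>y. exp_cell \<rho> (\<beta> y)" by (rule XY)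
  interpret YZ: step_pair Y "\<lambda>y. exp_cell \<rho> (\<beta> y)" Z "\<lambda>z. exp_cell \<rho> (\<gamma> z)" by (rule YZ)
  let ?J = "\<lambda>x. neg_cell \<rho> (\<alpha> x)"
  let ?L = "\<lambda>y. exp_cell \<rho> (\<beta> y)"
  let ?H = "\<lambda>z. exp_cell \<rho> (\<gamma> z)"
  show ?thesis
  proof (cases "(\<exists>x\<in>X. s \<in> ?J x) \<and> (\<exists>z\<in>Z. t \<in> ?H z)")
    case True
    then obtain x z where x: "x \<in> X" "s \<in> ?J x" and z: "z \<in> Z" "t \<in> ?H z" by blast
    have st: "step_kernel X ?J Z ?H c (s, t) = c x z" for c
      unfolding step_kernel_def fst_conv snd_conv XY.X.sum_step[OF x] by (rule YZ.Y.sum_step[OF z])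
    have Ae: "A (s, y) = (\<Sum>y'\<in>Y. a x y' * indicator (?L y') y)" for y
      unfolding A_def step_kernel_def fst_conv snd_conv by (rule XY.X.sum_step[OF x])
    have Be: "B (y, t) = (\<Sum>y'\<in>Y. b y' z * indicator (?L y') y)" for y
      unfolding B_def step_kernel_def fst_conv snd_conv YZ.Y.sum_step[OF z] ..
    have int: "integrable lborel (\<lambda>y'. dd2 s y' t * indicator (?L y) y')" if "y \<in> Y" for y
      by (rule dd2_cell_average(1)[OF \<rho> x(2) z(2)]) (use ne x z that in auto)
    have prod: "dd2 s y t * A (s, y) * B (y, t) = (\<Sum>y'\<in>Y. (a x y' * b y' z) * (dd2 s y t * indicator (?L y') y))" for y
    proof (cases "\<exists>y'\<in>Y. y \<in> ?L y'")
      case True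
      then obtain y' where y': "y' \<in> Y" "y \<in> ?L y'" by blast
      show ?thesis
        unfolding Ae Be XY.Y.sum_step[OF y'] using XY.Y.sum_step[OF y', of "\<lambda>y'. (a x y' * b y' z) * dd2 s y t"]
        by (simp only: mult_ac)
    next
      case False
      then have "(\<Sum>y'\<in>Y. a x y' * indicator (?L y') y) = 0"
        "(\<Sum>y'\<in>Y. ((a x y' * b y' z) * dd2 s y t) * indicator (?L y') y) = 0"
        by (intro XY.Y.sum_step_0; blast)+
      then show ?thesis unfolding Ae by (simp only: mult_ac mult_zero_left mult_zero_right)
    qed
    have "(\<integral>y. dd2 s y t * A (s, y) * B (y, t) \<partial>lborel)
        = (\<Sum>y\<in>Y. (a x y * b y z) * (\<integral>y'. dd2 s y' t * indicator (?L y) y' \<partial>lborel))"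
      unfolding prod
      by (subst Bochner_Integration.integral_sum) (auto intro!: integrable_mult_right int simp del: of_bool_eq)
    then have "(\<integral>y. dd2 s y t * A (s, y) * B (y, t) \<partial>lborel) - k x z
        = (\<Sum>y\<in>Y. (a x y * b y z) * ((\<integral>y'. dd2 s y' t * indicator (?L y) y' \<partial>lborel) - of_real (sign_mask (\<alpha> x) (\<beta> y) (\<gamma> z))))"
      by (simp only: k_def sum_subtractf[symmetric] right_diff_distrib mult_ac)
    also have "cmod \<dots> \<le> (\<Sum>y\<in>Y. cmod (a x y) * cmod (b y z) * (8 / \<rho>))"
    proof (rule sum_norm_le)
      fix y assume y: "y \<in> Y"
      have "cmod ((\<integral>y'. dd2 s y' t * indicator (?L y) y' \<partial>lborel) - of_real (sign_mask (\<alpha> x) (\<beta> y) (\<gamma> z))) \<le> 8 / \<rho>"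
        by (rule dd2_cell_average(2)[OF \<rho> x(2) z(2)]) (use ne x z y in auto)
      then show "cmod ((a x y * b y z) * ((\<integral>y'. dd2 s y' t * indicator (?L y) y' \<partial>lborel) - of_real (sign_mask (\<alpha> x) (\<beta> y) (\<gamma> z))))
         \<le> cmod (a x y) * cmod (b y z) * (8 / \<rho>)"
        unfolding norm_mult by (intro mult_left_mono) auto
    qed
    also have "\<dots> = cmod (d x z)"
    proof -
      have "8 / \<rho> * (\<Sum>y\<in>Y. cmod (a x y) * cmod (b y z)) \<ge> 0" using \<rho> by (intro mult_nonneg_nonneg sum_nonneg) auto
      then show ?thesis unfolding d_def norm_of_real by (simp only: abs_of_nonneg sum_distrib_left mult_ac)
    qed
    finally show ?thesis unfolding st .
  next
    case False
    then consider "\<And>x. x \<in> X \<Longrightarrow> s \<notin> ?J x" | "\<And>z. z \<in> Z \<Longrightarrow> t \<notin> ?H z" by blast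
    then have *: "(\<forall>y. A (s, y) * B (y, t) = 0) \<and> (\<forall>c. step_kernel X ?J Z ?H c (s, t) = 0)"
    proof cases
      case 1
      then have "step_kernel X ?J Y ?L c (s, r) = 0" "step_kernel X ?J Z ?H c' (s, r) = 0" for c c' r
        unfolding step_kernel_def fst_conv snd_conv by (intro XY.X.sum_step_0; blast)+
      then show ?thesis by (simp add: A_def)
    next
      case 2
      have *: "(\<Sum>z\<in>Z. f z * indicator (?H z) t) = 0" for f :: "'z \<Rightarrow> complex"
        using 2 by (intro YZ.Y.sum_step_0)
      have "step_kernel Y ?L Z ?H c (r, t) = 0" "step_kernel X ?J Z ?H c' (r, t) = 0" for c c' r
        unfolding step_kernel_def fst_conv snd_conv * by simp_all
      then show ?thesis by (simp add: B_def)
    qed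
    then show ?thesis by (simp only: mult.assoc) simp
  qed
qed

section \<open>From finite matrices to the Schur multiplier\<close>

lemma schur_kernel_perturbation:
  fixes X :: "'x set" and Y :: "'y set" and Z :: "'z set"
    and a :: "'x \<Rightarrow> 'y \<Rightarrow> complex" and b :: "'y \<Rightarrow> 'z \<Rightarrow> complex"
  assumes fin: "finite X" "finite Y" "finite Z"
    and inj: "inj_on \<alpha> X" "inj_on \<beta> Y" "inj_on \<gamma> Z"
    and ne: "\<And>x y. x \<in> X \<Longrightarrow> y \<in> Y \<Longrightarrow> \<alpha> x \<noteq> \<beta> y" "\<And>x z. x \<in> X \<Longrightarrow> z \<in> Z \<Longrightarrow> \<alpha> x \<noteq> \<gamma> z"
    and \<epsilon>: "\<epsilon> > 0"
  defines "k \<equiv> \<lambda>x z. \<Sum>y\<in>Y. of_real (sign_mask (\<alpha> x) (\<beta> y) (\<gamma> z)) * a x y * b y z"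
  obtains J L H K D where
    "step_pair X J Y L" "step_pair Y L Z H" "step_pair X J Z H"
    "square_integrable lborel K" "square_integrable lborel D"
    "K = (\<lambda>w. step_kernel X J Z H k w + D w)"
    "norm (kop D) \<le> \<epsilon>"
    "schur_multiplier dd2 (kop (step_kernel X J Y L a)) (kop (step_kernel Y L Z H b)) = kop K"
proof -
  define S where "S = (\<Sum>x\<in>X. \<Sum>z\<in>Z. (\<Sum>y\<in>Y. cmod (a x y) * cmod (b y z))\<^sup>2)"
  have S: "S \<ge> 0" unfolding S_def by (intro sum_nonneg) auto
  \<comment> \<open>the error is dominated by a step kernel of Hilbert--Schmidt norm \<open>8 / \<rho> * sqrt S\<close>\<close>
  define \<rho> where "\<rho> = max 2 (8 * sqrt S / \<epsilon>)"
  have \<rho>: "\<rho> \<ge> 2" "8 / \<rho> * sqrt S \<le> \<epsilon>"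
  proof -
    show "\<rho> \<ge> 2" by (simp add: \<rho>_def)
    have "8 * sqrt S / \<epsilon> \<le> \<rho>" by (simp add: \<rho>_def)
    then have "8 * sqrt S \<le> \<rho> * \<epsilon>" using \<epsilon> by (simp add: field_simps)
    then show "8 / \<rho> * sqrt S \<le> \<epsilon>" using \<open>\<rho> \<ge> 2\<close> by (simp add: field_simps)
  qed
  define J where "J = (\<lambda>x. neg_cell \<rho> (\<alpha> x))"
  define L where "L = (\<lambda>y. exp_cell \<rho> (\<beta> y))"
  define H where "H = (\<lambda>z. exp_cell \<rho> (\<gamma> z))"
  have uJ: "unit_family X J" and uL: "unit_family Y L" and uH: "unit_family Z H"
    unfolding J_def L_def H_def
    by (rule unit_family_cells[OF \<rho>(1)]; (rule fin inj)?)+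
  have XY: "step_pair X J Y L" and YZ: "step_pair Y L Z H" and XZ: "step_pair X J Z H"
    using uJ uL uH by (auto simp: step_pair_def)
  interpret XY: step_pair X J Y L by (rule XY)
  interpret YZ: step_pair Y L Z H by (rule YZ)
  interpret XZ: step_pair X J Z H by (rule XZ)
  define A where "A = XY.\<K> a"
  define B where "B = YZ.\<K> b"
  have A: "square_integrable lborel A" and B: "square_integrable lborel B"
    by (simp_all add: A_def B_def XY.step_kernel_square_integrable YZ.step_kernel_square_integrable)
  define d where "d = (\<lambda>x z. complex_of_real (8 / \<rho> * (\<Sum>y\<in>Y. cmod (a x y) * cmod (b y z))))"
  define K where "K = (\<lambda>(s, t). \<integral>y. dd2 s y t * A (s, y) * B (y, t) \<partial>lborel)"
  define D where "D w = K w - XZ.\<K> k w" for w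
  note [measurable] = square_integrable_pair_measurable[OF A] square_integrable_pair_measurable[OF B]
  have Km: "K \<in> borel_measurable lborel"
  proof -
    have "K \<in> borel_measurable (borel \<Otimes>\<^sub>M borel)"
      unfolding K_def case_prod_unfold
      by (rule sigma_finite_measure.borel_measurable_lebesgue_integral[OF sigma_finite_lborel]) simp
    then show ?thesis by (simp add: borel_prod)
  qed
  have Dle: "cmod (D w) \<le> cmod (XZ.\<K> d w)" for w
  proof -
    obtain s t where w: "w = (s, t)" by (cases w)
    show ?thesis
      unfolding w D_def K_def prod.case A_def B_def d_def k_def J_def L_def H_def
      by (rule schur_step_kernels[OF \<rho>(1) XY[unfolded J_def L_def] YZ[unfolded L_def H_def] ne])
  qed
  have "XZ.\<K> k \<in> borel_measurable lborel"
    using XZ.step_kernel_square_integrable by (simp add: square_integrable_def)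
  then have Dm: "D \<in> borel_measurable lborel" unfolding D_def[abs_def] using Km by measurable
  have D: "square_integrable lborel D"
    by (rule square_integrable_bound[OF Dm XZ.step_kernel_square_integrable[of d] Dle])
  have KD: "K = (\<lambda>w. XZ.\<K> k w + D w)" by (simp add: D_def)
  have K: "square_integrable lborel K"
    unfolding KD by (intro square_integrable_add D XZ.step_kernel_square_integrable)
  have "hs2 D \<le> hs2 (XZ.\<K> d)" by (rule hs2_mono[OF D XZ.step_kernel_square_integrable Dle])
  also have "\<dots> = (8 / \<rho>)\<^sup>2 * S"
  proof -
    have "(cmod (d x z))\<^sup>2 = (8 / \<rho>)\<^sup>2 * (\<Sum>y\<in>Y. cmod (a x y) * cmod (b y z))\<^sup>2" for x z
      by (simp only: d_def norm_of_real power2_abs power_mult_distrib)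
    then show ?thesis by (simp only: XZ.hs2_step_kernel S_def sum_distrib_left)
  qed
  finally have "sqrt (hs2 D) \<le> sqrt ((8 / \<rho>)\<^sup>2 * S)" by (rule real_sqrt_le_mono)
  also have "\<dots> = 8 / \<rho> * sqrt S" using \<rho>(1) by (simp add: real_sqrt_mult)
  finally have "sqrt (hs2 D) \<le> 8 / \<rho> * sqrt S" .
  then have nD: "norm (kop D) \<le> \<epsilon>" using norm_kop_le[OF D] \<rho>(2) by linarith
  have "schur_multiplier dd2 (kop A) (kop B) = kop K"
    by (rule schur_multiplier_kop[OF A B divdiff2_measurable K]) (simp add: K_def)
  then show thesis using that[OF XY YZ XZ K D KD nD] by (simp add: A_def B_def)
qed

lemma schatten_norm_contraction_le:
  assumes A: "square_integrable lborel A" and 1: "norm (kop A) \<le> 1" and h: "hs2 A \<le> h" and p: "p \<ge> 2"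
  shows "kop A \<in> schatten_class p" "schatten_norm p (kop A) \<le> h powr (1 / p)"
proof -
  show "kop A \<in> schatten_class p" by (rule schatten_kop_le(1)[OF A p 1])
  have "schatten_norm p (kop A) \<le> (1 powr (p - 2) * hs2 A) powr (1 / p)" by (rule schatten_kop_le(2)[OF A p 1])
  also have "\<dots> \<le> h powr (1 / p)" using h hs2_nonneg[of A] p by (intro powr_mono2) auto
  finally show "schatten_norm p (kop A) \<le> h powr (1 / p)" .
qed

lemma schatten_norm_nonneg: "0 \<le> schatten_norm p T"
  by (simp add: schatten_norm_def)

text \<open>The reduction of the theorem to finite matrices.  A bound for the multiplier on contractive
  matrices \<open>a\<close>, \<open>b\<close> bounds the Schatten norm of an operator that agrees up to \<open>\<epsilon>\<close>, and so does its
  adjoint, with the masked product \<open>k\<close>.  The exponents \<open>\<alpha>\<close>, \<open>\<beta>\<close>, \<open>\<gamma>\<close> place the rows and columns on the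
  half-lines and thereby choose the mask.\<close>

lemma schur_transfer:
  fixes X :: "'x set" and Y :: "'y set" and Z :: "'z set"
    and a :: "'x \<Rightarrow> 'y \<Rightarrow> complex" and b :: "'y \<Rightarrow> 'z \<Rightarrow> complex"
  assumes p: "p \<ge> 1" and N: "N \<in> schur_extensions (2 * p) (2 * p) p dd2"
    and C: "C \<in> schatten_bilinear_bounds (2 * p) (2 * p) p N"
    and fin: "finite X" "finite Y" "finite Z"
    and inj: "inj_on \<alpha> X" "inj_on \<beta> Y" "inj_on \<gamma> Z"
    and ne: "\<And>x y. x \<in> X \<Longrightarrow> y \<in> Y \<Longrightarrow> \<alpha> x \<noteq> \<beta> y" "\<And>x z. x \<in> X \<Longrightarrow> z \<in> Z \<Longrightarrow> \<alpha> x \<noteq> \<gamma> z"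
    and a: "\<And>v. (\<Sum>x\<in>X. (cmod (\<Sum>y\<in>Y. a x y * v y))\<^sup>2) \<le> (\<Sum>y\<in>Y. (cmod (v y))\<^sup>2)"
    and b: "\<And>v. (\<Sum>y\<in>Y. (cmod (\<Sum>z\<in>Z. b y z * v z))\<^sup>2) \<le> (\<Sum>z\<in>Z. (cmod (v z))\<^sup>2)"
    and ha: "(\<Sum>x\<in>X. \<Sum>y\<in>Y. (cmod (a x y))\<^sup>2) \<le> ha" and hb: "(\<Sum>y\<in>Y. \<Sum>z\<in>Z. (cmod (b y z))\<^sup>2) \<le> hb"
    and \<epsilon>: "\<epsilon> > 0"
    and k: "\<And>x z. k x z = (\<Sum>y\<in>Y. of_real (sign_mask (\<alpha> x) (\<beta> y) (\<gamma> z)) * a x y * b y z)"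
  obtains K e f where
    "square_integrable lborel K" "kop K \<in> schatten_class p"
    "schatten_norm p (kop K) \<le> C * (ha * hb) powr (1 / (2 * p))"
    "orthonormal_on X e" "orthonormal_on Z f"
    "\<forall>v. norm (kop K (\<Sum>z\<in>Z. l2_scaleC (v z) (f z)) - (\<Sum>x\<in>X. l2_scaleC (\<Sum>z\<in>Z. k x z * v z) (e x)))
        \<le> \<epsilon> * norm (\<Sum>z\<in>Z. l2_scaleC (v z) (f z))"
    "\<forall>w. norm (op_adjoint (kop K) (\<Sum>x\<in>X. l2_scaleC (w x) (e x)) - (\<Sum>z\<in>Z. l2_scaleC (\<Sum>x\<in>X. cnj (k x z) * w x) (f z)))
        \<le> \<epsilon> * norm (\<Sum>x\<in>X. l2_scaleC (w x) (e x))"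
    "norm (op_adjoint (kop K)) \<le> norm (kop K)"
    "norm (kop K) \<le> sqrt (\<Sum>x\<in>X. \<Sum>z\<in>Z. (cmod (k x z))\<^sup>2) + \<epsilon>"
proof -
  have k_def: "k = (\<lambda>x z. \<Sum>y\<in>Y. of_real (sign_mask (\<alpha> x) (\<beta> y) (\<gamma> z)) * a x y * b y z)"
    by (intro ext k)
  obtain J L H K D where XY: "step_pair X J Y L" and YZ: "step_pair Y L Z H" and XZ: "step_pair X J Z H"
    and K: "square_integrable lborel K" and D: "square_integrable lborel D"
    and KD: "K = (\<lambda>w. step_kernel X J Z H k w + D w)"
    and nD: "norm (kop D) \<le> \<epsilon>"
    and sm: "schur_multiplier dd2 (kop (step_kernel X J Y L a)) (kop (step_kernel Y L Z H b)) = kop K"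
    using schur_kernel_perturbation[OF fin inj ne \<epsilon>, of a b] unfolding k_def by blast
  interpret XY: step_pair X J Y L by (rule XY)
  interpret YZ: step_pair Y L Z H by (rule YZ)
  interpret XZ: step_pair X J Z H by (rule XZ)
  define TA where "TA = kop (XY.\<K> a)"
  define TB where "TB = kop (YZ.\<K> b)"
  have nA: "norm TA \<le> 1" unfolding TA_def by (rule XY.norm_kop_step_kernel_le_1[OF a])
  have nB: "norm TB \<le> 1" unfolding TB_def by (rule YZ.norm_kop_step_kernel_le_1[OF b])
  have p2: "2 * p \<ge> 2" using p by simp
  have cA: "TA \<in> schatten_class q" and sA: "schatten_norm q TA \<le> ha powr (1 / q)" if "q \<ge> 2" for q
    using schatten_norm_contraction_le[OF XY.step_kernel_square_integrable nA[unfolded TA_def] _ that, of ha] ha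
    by (simp_all add: TA_def XY.hs2_step_kernel)
  have cB: "TB \<in> schatten_class q" and sB: "schatten_norm q TB \<le> hb powr (1 / q)" if "q \<ge> 2" for q
    using schatten_norm_contraction_le[OF YZ.step_kernel_square_integrable nB[unfolded TB_def] _ that, of hb] hb
    by (simp_all add: TB_def YZ.hs2_step_kernel)
  have NK: "N TA TB = kop K"
    using N cA[of 2] cB[of 2] cA[OF p2] cB[OF p2] sm by (simp add: schur_extensions_def TA_def TB_def)
  have cK: "kop K \<in> schatten_class p"
    using N cA[OF p2] cB[OF p2] unfolding NK[symmetric] by (auto simp: schur_extensions_def schatten_bilinear_def)
  have C0: "C \<ge> 0" using C by (simp add: schatten_bilinear_bounds_def)
  have ha0: "ha \<ge> 0" by (rule order_trans[OF _ ha]) (intro sum_nonneg zero_le_power2)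
  have hb0: "hb \<ge> 0" by (rule order_trans[OF _ hb]) (intro sum_nonneg zero_le_power2)
  have "schatten_norm p (kop K) \<le> C * schatten_norm (2 * p) TA * schatten_norm (2 * p) TB"
    using C cA[OF p2] cB[OF p2] unfolding NK[symmetric] by (simp add: schatten_bilinear_bounds_def)
  also have "\<dots> \<le> C * ha powr (1 / (2 * p)) * hb powr (1 / (2 * p))"
    using sA[OF p2] sB[OF p2] C0 schatten_norm_nonneg by (intro mult_mono mult_nonneg_nonneg) auto
  also have "\<dots> = C * (ha * hb) powr (1 / (2 * p))"
    using ha0 hb0 by (simp add: powr_mult mult.assoc)
  finally have bK: "schatten_norm p (kop K) \<le> C * (ha * hb) powr (1 / (2 * p))" .
  have split: "kop K = kop (XZ.\<K> k) + kop D"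
    unfolding KD by (rule kop_add[OF XZ.step_kernel_square_integrable D])
  have Kf: "norm (kop K (\<Sum>z\<in>Z. l2_scaleC (v z) (ind_l2 (H z))) - (\<Sum>x\<in>X. l2_scaleC (\<Sum>z\<in>Z. k x z * v z) (ind_l2 (J x))))
        \<le> \<epsilon> * norm (\<Sum>z\<in>Z. l2_scaleC (v z) (ind_l2 (H z)))" for v
    unfolding split blinfun.add_left XZ.kop_step_kernel_sum
    by (simp add: norm_blinfun_apply_le[OF nD])
  have adj: "op_adjoint (kop K) x = kop (adj_kernel (XZ.\<K> k)) x + kop (adj_kernel D) x" for x
    unfolding op_adjoint_kop[OF K]
    by (rule cinner_nondegenerate)
       (simp add: cinner_adj_kernel[OF K] cinner_add_left cinner_adj_kernel[OF D]
         cinner_adj_kernel[OF XZ.step_kernel_square_integrable] split blinfun.add_left cinner_add_right)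
  interpret ZX: step_pair Z H X J using XZ by (simp add: step_pair_def)
  have Ke: "norm (op_adjoint (kop K) (\<Sum>x\<in>X. l2_scaleC (w x) (ind_l2 (J x))) - (\<Sum>z\<in>Z. l2_scaleC (\<Sum>x\<in>X. cnj (k x z) * w x) (ind_l2 (H z))))
        \<le> \<epsilon> * norm (\<Sum>x\<in>X. l2_scaleC (w x) (ind_l2 (J x)))" for w
    unfolding adj XZ.adj_step_kernel ZX.kop_step_kernel_sum
    using order_trans[OF norm_kop_adj_le[OF D] mult_right_mono[OF nD norm_ge_zero]] by simp
  have "norm (op_adjoint (kop K)) \<le> norm (kop K)"
    unfolding op_adjoint_kop[OF K] by (rule norm_blinfun_bound) (auto intro: norm_kop_adj_le[OF K])
  moreover have "norm (kop K) \<le> sqrt (\<Sum>x\<in>X. \<Sum>z\<in>Z. (cmod (k x z))\<^sup>2) + \<epsilon>"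
    unfolding split XZ.hs2_step_kernel[symmetric]
    by (rule order_trans[OF norm_triangle_ineq])
       (intro add_mono nD norm_kop_le XZ.step_kernel_square_integrable)
  ultimately show thesis using that[OF K cK bK XY.X.orthonormal YZ.Y.orthonormal allI[OF Kf] allI[OF Ke]] by blast
qed

section \<open>A negacyclic sign matrix\<close>

text \<open>Triangular truncation is the Schur product with \<open>(1 - tri_sign) / 2\<close>.  With \<open>-1\<close> on the diagonal the
  entries of the \<open>n \<times> n\<close> matrix depend only on \<open>l - i\<close> and change sign when \<open>l - i\<close> is shifted by \<open>n\<close>.  Such a
  negacyclic matrix is diagonalised by the characters \<open>z\<^sup>l\<close> with \<open>z\<^sup>n = -1\<close>, so that its singular values are explicit.\<close>

definition tri_sign :: "nat \<Rightarrow> nat \<Rightarrow> complex" where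
  "tri_sign i l = (if i < l then 1 else - 1)"

definition neg_root :: "nat \<Rightarrow> nat \<Rightarrow> complex" where
  "neg_root n k = cis (pi * (2 * real k + 1) / real n)"

definition neg_vec :: "nat \<Rightarrow> nat \<Rightarrow> nat \<Rightarrow> complex" where
  "neg_vec n k l = neg_root n k ^ l / sqrt (real n)"

definition neg_eigenvalue :: "nat \<Rightarrow> nat \<Rightarrow> complex" where
  "neg_eigenvalue n k = 2 * neg_root n k / (1 - neg_root n k)"

lemma cmod_neg_root [simp]: "cmod (neg_root n k) = 1"
  by (simp add: neg_root_def)

lemma neg_root_power:
  assumes "n > 0"
  shows "neg_root n k ^ n = - 1"
proof -
  have "neg_root n k ^ n = cis (pi * (2 * real k + 1))"
    using assms by (simp add: neg_root_def Complex.DeMoivre)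
  also have "\<dots> = cis (real k * (2 * pi)) * cis pi"
    unfolding cis_mult by (rule arg_cong[of _ _ cis]) (simp add: algebra_simps)
  also have "cis (real k * (2 * pi)) = 1"
    unfolding Complex.DeMoivre[symmetric] by simp
  finally show ?thesis by simp
qed

lemma neg_root_neq_1: "n > 0 \<Longrightarrow> neg_root n k \<noteq> 1"
  using neg_root_power[of n k] by auto

lemma sum_cis_roots_of_unity:
  assumes n: "n > 0" and d: "d \<noteq> 0" "\<bar>d\<bar> < int n"
  shows "(\<Sum>j<n. cis (2 * pi * real_of_int d / real n) ^ j) = 0"
proof -
  let ?w = "cis (2 * pi * real_of_int d / real n)"
  have "?w \<noteq> 1"
  proof
    assume "?w = 1"
    then obtain m :: int where "2 * pi * real_of_int d / real n = of_int (2 * m) * pi"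
      by (auto simp: cis_conv_exp exp_eq_1)
    then have "real_of_int d = real_of_int (m * int n)" using n by (simp add: field_simps)
    then have dm: "d = m * int n" by (simp only: of_int_eq_iff)
    then have "int n * \<bar>m\<bar> < int n * 1" using d(2) by (simp add: abs_mult mult.commute)
    then have "m = 0" using n by (subst (asm) mult_less_cancel_left_pos) auto
    then show False using dm d(1) by simp
  qed
  moreover have "?w ^ n = 1"
  proof -
    have "?w ^ n = cis (2 * pi * real_of_int d)" using n by (simp add: Complex.DeMoivre)
    then show ?thesis by (simp add: cis_multiple_2pi)
  qed
  ultimately show ?thesis by (simp add: geometric_sum)
qed

lemma neg_vec_mult_cnj:
  "neg_vec n k x * cnj (neg_vec n k' y)
    = cis (pi * ((2 * real k + 1) * real x - (2 * real k' + 1) * real y) / real n) / real n"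
proof -
  have "neg_root n k ^ x * cnj (neg_root n k' ^ y) = cis (pi * ((2 * real k + 1) * real x - (2 * real k' + 1) * real y) / real n)"
    by (simp add: neg_root_def Complex.DeMoivre cis_cnj cis_mult diff_divide_distrib add_divide_distrib algebra_simps)
  moreover have "sqrt (real n) * sqrt (real n) = real n" by simp
  ultimately show ?thesis
    by (simp add: neg_vec_def flip: of_real_mult)
qed

lemma neg_vec_orthonormal:
  assumes "k < n" "k' < n"
  shows "(\<Sum>l<n. neg_vec n k l * cnj (neg_vec n k' l)) = (if k = k' then 1 else 0)"
proof -
  have "(\<Sum>l<n. neg_vec n k l * cnj (neg_vec n k' l))
      = (\<Sum>l<n. cis (2 * pi * real_of_int (int k - int k') / real n) ^ l) / real n"
    unfolding neg_vec_mult_cnj sum_divide_distrib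
    by (intro sum.cong refl) (simp add: Complex.DeMoivre algebra_simps)
  moreover have "(\<Sum>l<n. cis (2 * pi * real_of_int (int k - int k') / real n) ^ l) = 0" if "k \<noteq> k'"
    by (rule sum_cis_roots_of_unity) (use that assms in auto)
  ultimately show ?thesis using assms by auto
qed

lemma neg_vec_orthonormal_rows:
  assumes "x < n" "y < n"
  shows "(\<Sum>k<n. neg_vec n k x * cnj (neg_vec n k y)) = (if x = y then 1 else 0)"
proof -
  have "(\<Sum>k<n. neg_vec n k x * cnj (neg_vec n k y))
      = (\<Sum>k<n. cis (pi * real_of_int (int x - int y) / real n) * cis (2 * pi * real_of_int (int x - int y) / real n) ^ k) / real n"
    unfolding neg_vec_mult_cnj sum_divide_distrib
    by (intro sum.cong refl)
       (simp add: Complex.DeMoivre cis_mult algebra_simps diff_divide_distrib add_divide_distrib)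
  also have "\<dots> = cis (pi * real_of_int (int x - int y) / real n)
      * (\<Sum>k<n. cis (2 * pi * real_of_int (int x - int y) / real n) ^ k) / real n"
    by (simp only: sum_distrib_left)
  finally have *: "(\<Sum>k<n. neg_vec n k x * cnj (neg_vec n k y)) = cis (pi * real_of_int (int x - int y) / real n)
      * (\<Sum>k<n. cis (2 * pi * real_of_int (int x - int y) / real n) ^ k) / real n" .
  have "(\<Sum>k<n. cis (2 * pi * real_of_int (int x - int y) / real n) ^ k) = 0" if "x \<noteq> y"
    by (rule sum_cis_roots_of_unity) (use that assms in auto)
  then show ?thesis unfolding * using assms by auto
qed

lemma finite_Parseval:
  fixes u :: "nat \<Rightarrow> nat \<Rightarrow> complex"
  assumes "\<And>k k'. k < n \<Longrightarrow> k' < n \<Longrightarrow> (\<Sum>i<n. u k i * cnj (u k' i)) = (if k = k' then 1 else 0)"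
  shows "(\<Sum>i<n. (cmod (\<Sum>k<n. d k * u k i))\<^sup>2) = (\<Sum>k<n. (cmod (d k))\<^sup>2)"
proof -
  have "complex_of_real (\<Sum>i<n. (cmod (\<Sum>k<n. d k * u k i))\<^sup>2)
      = (\<Sum>i<n. (\<Sum>k<n. d k * u k i) * cnj (\<Sum>k<n. d k * u k i))"
    by (simp only: of_real_sum complex_norm_square)
  also have "\<dots> = (\<Sum>i<n. \<Sum>k<n. \<Sum>k'<n. (d k * cnj (d k')) * (u k i * cnj (u k' i)))"
    by (simp only: cnj_sum complex_cnj_mult sum_product mult_ac)
  also have "\<dots> = (\<Sum>k<n. \<Sum>k'<n. \<Sum>i<n. (d k * cnj (d k')) * (u k i * cnj (u k' i)))"
    by (subst sum.swap, rule sum.cong[OF refl], rule sum.swap)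
  also have "\<dots> = (\<Sum>k<n. \<Sum>k'<n. (d k * cnj (d k')) * (if k = k' then 1 else 0))"
    unfolding sum_distrib_left[symmetric] by (intro sum.cong refl) (simp add: assms)
  also have "\<dots> = (\<Sum>k<n. d k * cnj (d k))"
    by (intro sum.cong refl) (simp add: if_distrib cong: if_cong)
  also have "\<dots> = complex_of_real (\<Sum>k<n. (cmod (d k))\<^sup>2)"
    by (simp only: of_real_sum complex_norm_square)
  finally show ?thesis by (simp only: of_real_eq_iff)
qed

lemma sum_split_lessThan:
  fixes f :: "nat \<Rightarrow> 'a :: comm_monoid_add"
  assumes "m \<le> n"
  shows "sum f {..<n} = sum f {..<m} + sum f {m..<n}"
  using sum.atLeastLessThan_concat[of 0 m n f] assms by (simp add: atLeast0LessThan)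

lemma tri_sign_eigenvector:
  assumes i: "i < n"
  shows "(\<Sum>l<n. tri_sign i l * neg_vec n k l) = neg_eigenvalue n k * neg_vec n k i"
proof -
  define z where "z = neg_root n k"
  have n: "n > 0" using i by simp
  have z: "z \<noteq> 1" "z ^ n = - 1" using neg_root_neq_1[OF n] neg_root_power[OF n] by (simp_all add: z_def)
  have s: "(\<Sum>l<Suc i. z ^ l) + (\<Sum>l\<in>{Suc i..<n}. z ^ l) = (\<Sum>l<n. z ^ l)"
    using sum_split_lessThan[of "Suc i" n "\<lambda>l. z ^ l"] i by simp
  have "(\<Sum>l<n. tri_sign i l * z ^ l) = (\<Sum>l<Suc i. tri_sign i l * z ^ l) + (\<Sum>l\<in>{Suc i..<n}. tri_sign i l * z ^ l)"
    by (rule sum_split_lessThan) (use i in simp)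
  also have "(\<Sum>l<Suc i. tri_sign i l * z ^ l) = - (\<Sum>l<Suc i. z ^ l)"
    unfolding sum_negf[symmetric] by (intro sum.cong refl) (simp add: tri_sign_def)
  also have "(\<Sum>l\<in>{Suc i..<n}. tri_sign i l * z ^ l) = (\<Sum>l\<in>{Suc i..<n}. z ^ l)"
    by (intro sum.cong refl) (simp add: tri_sign_def)
  also have "- (\<Sum>l<Suc i. z ^ l) + (\<Sum>l\<in>{Suc i..<n}. z ^ l) = (\<Sum>l<n. z ^ l) - 2 * (\<Sum>l<Suc i. z ^ l)"
    unfolding s[symmetric] by simp
  also have "\<dots> = (z ^ n - 1) / (z - 1) - 2 * ((z ^ Suc i - 1) / (z - 1))"
    by (simp only: geometric_sum[OF z(1)])
  also have "\<dots> = 2 * z / (1 - z) * z ^ i"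
  proof -
    have "z - 1 \<noteq> 0" "1 - z \<noteq> 0" using z by auto
    then show ?thesis by (simp add: z(2) divide_simps) (simp add: algebra_simps)
  qed
  finally have "(\<Sum>l<n. tri_sign i l * z ^ l) = 2 * z / (1 - z) * z ^ i" .
  then have "(\<Sum>l<n. tri_sign i l * z ^ l) / sqrt (real n) = 2 * z / (1 - z) * z ^ i / sqrt (real n)" by simp
  then show ?thesis by (simp add: neg_vec_def neg_eigenvalue_def z_def sum_divide_distrib)
qed

lemma tri_sign_transpose_eigenvector:
  assumes l: "l < n"
  shows "(\<Sum>i<n. tri_sign i l * neg_vec n k i) = (- 2 / (1 - neg_root n k)) * neg_vec n k l"
proof -
  define z where "z = neg_root n k"
  have n: "n > 0" using l by simp
  have z: "z \<noteq> 1" "z ^ n = - 1" using neg_root_neq_1[OF n] neg_root_power[OF n] by (simp_all add: z_def)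
  have s: "(\<Sum>i<l. z ^ i) + (\<Sum>i\<in>{l..<n}. z ^ i) = (\<Sum>i<n. z ^ i)"
    using sum_split_lessThan[of l n "\<lambda>i. z ^ i"] l by simp
  have "(\<Sum>i<n. tri_sign i l * z ^ i) = (\<Sum>i<l. tri_sign i l * z ^ i) + (\<Sum>i\<in>{l..<n}. tri_sign i l * z ^ i)"
    by (rule sum_split_lessThan) (use l in simp)
  also have "(\<Sum>i<l. tri_sign i l * z ^ i) = (\<Sum>i<l. z ^ i)"
    by (intro sum.cong refl) (simp add: tri_sign_def)
  also have "(\<Sum>i\<in>{l..<n}. tri_sign i l * z ^ i) = - (\<Sum>i\<in>{l..<n}. z ^ i)"
    unfolding sum_negf[symmetric] by (intro sum.cong refl) (simp add: tri_sign_def)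
  also have "(\<Sum>i<l. z ^ i) + - (\<Sum>i\<in>{l..<n}. z ^ i) = 2 * (\<Sum>i<l. z ^ i) - (\<Sum>i<n. z ^ i)"
    unfolding s[symmetric] by simp
  also have "\<dots> = 2 * ((z ^ l - 1) / (z - 1)) - (z ^ n - 1) / (z - 1)"
    by (simp only: geometric_sum[OF z(1)])
  also have "\<dots> = (- 2 / (1 - z)) * z ^ l"
  proof -
    have w: "z - 1 \<noteq> 0" "1 - z = - (z - 1)" using z by auto
    have "2 * ((z ^ l - 1) / (z - 1)) - (z ^ n - 1) / (z - 1) = 2 * z ^ l / (z - 1)"
      unfolding z(2) using w(1) by (simp add: divide_simps)
    then show ?thesis by (simp only: w(2) minus_divide_divide times_divide_eq_left)
  qed
  finally have "(\<Sum>i<n. tri_sign i l * z ^ i) = (- 2 / (1 - z)) * z ^ l" .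
  then have "(\<Sum>i<n. tri_sign i l * z ^ i) / sqrt (real n) = (- 2 / (1 - z)) * z ^ l / sqrt (real n)" by simp
  then show ?thesis by (simp add: neg_vec_def z_def sum_divide_distrib)
qed

text \<open>The singular values are \<open>2 / |1 - z|\<close>, and the chord \<open>|1 - z|\<close> is at most the angle \<open>\<pi> (2 k + 1) / n\<close>.\<close>

lemma neg_eigenvalue_bounds:
  assumes n: "n > 0"
  shows "real n / (4 * real (Suc k)) \<le> cmod (neg_eigenvalue n k)" "1 \<le> cmod (neg_eigenvalue n k)"
    "cmod (- 2 / (1 - neg_root n k)) = cmod (neg_eigenvalue n k)"
proof -
  define r where "r = cmod (1 - neg_root n k)"
  have e: "cmod (neg_eigenvalue n k) = 2 / r" by (simp add: neg_eigenvalue_def norm_divide norm_mult r_def)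
  have rpos: "r > 0" using neg_root_neq_1[OF n, of k] by (simp add: r_def)
  have "r = cmod (neg_root n k - 1)" by (simp add: r_def norm_minus_commute)
  also have "\<dots> = 2 * \<bar>sin (pi * (2 * real k + 1) / real n / 2)\<bar>"
    using dist_exp_i_1[of "pi * (2 * real k + 1) / real n"] by (simp add: neg_root_def cis_conv_exp)
  also have "\<dots> \<le> 2 * \<bar>pi * (2 * real k + 1) / real n / 2\<bar>"
    by (intro mult_left_mono abs_sin_x_le_abs_x) simp
  also have "\<dots> = pi * (2 * real k + 1) / real n" by simp
  also have "\<dots> \<le> 4 * (2 * real (Suc k)) / real n"
    using pi_less_4 by (intro divide_right_mono mult_mono) auto
  finally have r: "r \<le> 8 * real (Suc k) / real n" by simp
  have "real n / (4 * real (Suc k)) = 2 / (8 * real (Suc k) / real n)" using n by (simp add: field_simps)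
  also have "\<dots> \<le> 2 / r" using r rpos n by (intro divide_left_mono mult_pos_pos) auto
  finally show "real n / (4 * real (Suc k)) \<le> cmod (neg_eigenvalue n k)" unfolding e .
  have "r \<le> 2" using norm_triangle_ineq4[of 1 "neg_root n k"] by (simp add: r_def)
  then show "1 \<le> cmod (neg_eigenvalue n k)" unfolding e using rpos by simp
  show "cmod (- 2 / (1 - neg_root n k)) = cmod (neg_eigenvalue n k)" unfolding e by (simp add: norm_divide r_def)
qed

text \<open>The unitary part of the sign matrix, conjugated entrywise.\<close>

definition neg_phase :: "nat \<Rightarrow> nat \<Rightarrow> complex" where
  "neg_phase n k = cnj (neg_eigenvalue n k) / cmod (neg_eigenvalue n k)"

definition neg_unitary :: "nat \<Rightarrow> nat \<Rightarrow> nat \<Rightarrow> complex" where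
  "neg_unitary n i l = (\<Sum>k<n. neg_phase n k * cnj (neg_vec n k i) * neg_vec n k l)"

lemma cmod_neg_phase:
  assumes "n > 0"
  shows "cmod (neg_phase n k) = 1" "neg_phase n k * neg_eigenvalue n k = cmod (neg_eigenvalue n k)"
proof -
  have nz: "cmod (neg_eigenvalue n k) \<noteq> 0" using neg_eigenvalue_bounds(2)[OF assms, of k] by linarith
  then show "cmod (neg_phase n k) = 1" by (simp add: neg_phase_def norm_divide)
  show "neg_phase n k * neg_eigenvalue n k = cmod (neg_eigenvalue n k)"
    using nz complex_norm_square[of "neg_eigenvalue n k"]
    by (simp add: neg_phase_def field_simps power2_eq_square)
qed

lemma neg_unitary_isometry:
  "(\<Sum>i<n. (cmod (\<Sum>l<n. neg_unitary n i l * v l))\<^sup>2) = (\<Sum>l<n. (cmod (v l))\<^sup>2)"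
proof -
  have 1: "(\<Sum>l<n. neg_unitary n i l * v l)
     = (\<Sum>k<n. (neg_phase n k * (\<Sum>l<n. v l * neg_vec n k l)) * cnj (neg_vec n k i))" for i
    unfolding neg_unitary_def sum_distrib_left sum_distrib_right
    by (subst sum.swap) (simp only: mult_ac)
  have "(\<Sum>i<n. (cmod (\<Sum>l<n. neg_unitary n i l * v l))\<^sup>2) = (\<Sum>k<n. (cmod (neg_phase n k * (\<Sum>l<n. v l * neg_vec n k l)))\<^sup>2)"
    unfolding 1
  proof (rule finite_Parseval)
    fix k k' assume kk: "k < n" "k' < n"
    show "(\<Sum>i<n. cnj (neg_vec n k i) * cnj (cnj (neg_vec n k' i))) = (if k = k' then 1 else 0)"
      using neg_vec_orthonormal[OF kk(2,1)] by (simp add: mult.commute eq_commute[of k'])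
  qed
  also have "\<dots> = (\<Sum>k<n. (cmod (\<Sum>l<n. v l * neg_vec n k l))\<^sup>2)"
    by (intro sum.cong refl) (simp add: norm_mult cmod_neg_phase)
  also have "\<dots> = (\<Sum>l<n. (cmod (v l))\<^sup>2)"
    by (rule finite_Parseval[where u = "\<lambda>l k. neg_vec n k l"]) (rule neg_vec_orthonormal_rows)
  finally show ?thesis .
qed

lemma neg_unitary_column:
  assumes "l < n"
  shows "(\<Sum>i<n. (cmod (neg_unitary n i l))\<^sup>2) = 1"
proof -
  have "(\<Sum>l'<n. neg_unitary n i l' * (if l' = l then 1 else 0)) = neg_unitary n i l" for i
    using assms by (simp add: if_distrib cong: if_cong)
  moreover have "(cmod (if l' = l then 1 else 0))\<^sup>2 = (if l' = l then 1 else 0)" for l' by simp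
  then have "(\<Sum>l'<n. (cmod (if l' = l then 1 else 0))\<^sup>2) = 1"
    using assms by (simp only:) simp
  ultimately show ?thesis
    using neg_unitary_isometry[of n "\<lambda>l'. if l' = l then 1 else 0"] by simp
qed

text \<open>Pairing the sign matrix with its own unitary part yields its trace norm, here of order \<open>n ln n\<close>: this
  is how a unitary matrix is made to lose a logarithm under triangular truncation.\<close>

lemma sum_tri_sign_neg_unitary:
  assumes "n > 0"
  shows "(\<Sum>i<n. \<Sum>l<n. tri_sign i l * neg_unitary n i l) = complex_of_real (\<Sum>k<n. cmod (neg_eigenvalue n k))"
proof -
  have "(\<Sum>i<n. \<Sum>l<n. tri_sign i l * neg_unitary n i l)
      = (\<Sum>i<n. \<Sum>k<n. neg_phase n k * cnj (neg_vec n k i) * (\<Sum>l<n. tri_sign i l * neg_vec n k l))"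
    unfolding neg_unitary_def sum_distrib_left
    by (rule sum.cong[OF refl], subst sum.swap) (simp only: mult_ac)
  also have "\<dots> = (\<Sum>i<n. \<Sum>k<n. (neg_phase n k * neg_eigenvalue n k) * (neg_vec n k i * cnj (neg_vec n k i)))"
    by (intro sum.cong refl) (simp add: tri_sign_eigenvector)
  also have "\<dots> = (\<Sum>k<n. (neg_phase n k * neg_eigenvalue n k) * (\<Sum>i<n. neg_vec n k i * cnj (neg_vec n k i)))"
    unfolding sum_distrib_left by (rule sum.swap)
  also have "\<dots> = (\<Sum>k<n. complex_of_real (cmod (neg_eigenvalue n k)))"
    by (intro sum.cong refl) (simp add: neg_vec_orthonormal cmod_neg_phase[OF assms])
  finally show ?thesis by simp
qed

lemma cmod_sum_neg_unitary_le: "cmod (\<Sum>i<n. \<Sum>l<n. neg_unitary n i l) \<le> n"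
proof -
  define r where "r i = (\<Sum>l<n. neg_unitary n i l)" for i
  have "(\<Sum>i<n. (cmod (r i))\<^sup>2) = n" using neg_unitary_isometry[of n "\<lambda>_. 1"] by (simp add: r_def)
  moreover have "(\<Sum>i<n. cmod (r i))\<^sup>2 \<le> (\<Sum>i<n. (cmod (r i))\<^sup>2) * n"
    using sum_squared_le_sum_of_squares[of "\<lambda>i. cmod (r i)" "{..<n}"] by simp
  ultimately have "(\<Sum>i<n. cmod (r i))\<^sup>2 \<le> (real n)\<^sup>2" by (simp add: power2_eq_square)
  then have "(\<Sum>i<n. cmod (r i)) \<le> n" by (rule power2_le_imp_le) simp
  then show ?thesis using norm_sum[of r "{..<n}"] unfolding r_def by linarith
qed

section \<open>The lower bound as \<open>p\<close> tends to 1\<close>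

lemma sum_powr_ge:
  fixes p :: real
  assumes p: "p > 1"
  shows "(1 - (real n + 1) powr (1 - p)) / (p - 1) \<le> (\<Sum>k<n. real (Suc k) powr (- p))"
proof (induction n)
  case (Suc n)
  let ?x = "real n + 1"
  have "\<exists>z. ?x < z \<and> z < ?x + 1 \<and> (?x + 1) powr (1 - p) - ?x powr (1 - p) = (?x + 1 - ?x) * ((1 - p) * z powr (1 - p - 1))"
  proof (rule MVT2)
    fix y assume "?x \<le> y"
    then have "0 < y" by linarith
    then show "((\<lambda>y. y powr (1 - p)) has_real_derivative (1 - p) * y powr (1 - p - 1)) (at y)"
      by (rule has_real_derivative_powr)
  qed simp
  then obtain z where z: "?x < z" "(?x + 1) powr (1 - p) - ?x powr (1 - p) = (1 - p) * z powr (- p)" by auto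
  have "z powr (- p) \<le> ?x powr (- p)" using z(1) p by (intro powr_mono2') auto
  then have "(p - 1) * z powr (- p) \<le> (p - 1) * ?x powr (- p)" using p by (intro mult_left_mono) auto
  then have "?x powr (1 - p) - (?x + 1) powr (1 - p) \<le> (p - 1) * ?x powr (- p)"
    using z(2) by (simp add: algebra_simps)
  then have "(?x powr (1 - p) - (?x + 1) powr (1 - p)) / (p - 1) \<le> ?x powr (- p)"
    using p by (simp add: divide_le_eq mult.commute)
  moreover have "(1 - (?x + 1) powr (1 - p)) / (p - 1)
     = (1 - ?x powr (1 - p)) / (p - 1) + (?x powr (1 - p) - (?x + 1) powr (1 - p)) / (p - 1)"
    by (simp add: add_divide_distrib[symmetric])
  ultimately show ?case using Suc by (simp add: add.commute)
qed simp

text \<open>With \<open>s = t\<^sup>2\<close> this is \<open>s\<^sup>q \<ge> t\<^sub>0\<^sup>q\<^sup>-\<^sup>1 s (1 - s / t\<^sub>0)\<close> for \<open>q = p / 2 \<le> 1\<close>.  It bounds the trace of \<open>|T|\<^sup>p\<close> from below by the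
  quantities \<open>\<parallel>Tg\<parallel>\<close> and \<open>\<parallel>T\<^sup>*Tg\<parallel>\<close>, for which approximate singular vectors are enough.\<close>

lemma powr_ge_quartic:
  fixes p t t0 :: real
  assumes t0: "t0 > 0" and p: "0 < p" "p \<le> 2" and t: "t \<ge> 0"
  shows "t0 powr (p / 2 - 1) * t\<^sup>2 + (- (t0 powr (p / 2 - 2))) * t ^ 4 \<le> t powr p"
proof (cases "t = 0")
  case False
  define s where "s = t\<^sup>2"
  have s: "s > 0" using False t by (simp add: s_def)
  have tp: "t powr p = s powr (p / 2)"
    using False t by (simp add: s_def powr_powr flip: powr_numeral)
  have e: "t0 powr (p / 2 - 1) = t0 powr (p / 2 - 2) * t0"
    using t0 powr_add[of t0 "p / 2 - 2" 1] by simp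
  have t4: "t ^ 4 = s * s" by (simp add: s_def power2_eq_square power4_eq_xxxx)
  show ?thesis
  proof (cases "s \<le> t0")
    case True
    have "t0 powr (p / 2 - 1) \<le> s powr (p / 2 - 1)" using p s True by (intro powr_mono2') auto
    then have "t0 powr (p / 2 - 1) * s \<le> s powr (p / 2 - 1) * s" using s by (intro mult_right_mono) auto
    also have "\<dots> = s powr (p / 2)" using s powr_add[of s "p / 2 - 1" 1] by simp
    finally have "t0 powr (p / 2 - 1) * s \<le> s powr (p / 2)" .
    moreover have "0 \<le> t0 powr (p / 2 - 2) * (s * s)" by simp
    ultimately show ?thesis unfolding tp t4 s_def[symmetric] by linarith
  next
    case False
    have "t0 powr (p / 2 - 2) * s * (t0 - s) \<le> 0" using False s by (intro mult_nonneg_nonpos) auto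
    moreover have "0 \<le> s powr (p / 2)" by simp
    moreover have "t0 powr (p / 2 - 2) * t0 * s + - (t0 powr (p / 2 - 2)) * (s * s) = t0 powr (p / 2 - 2) * s * (t0 - s)"
      by (simp add: algebra_simps)
    ultimately show ?thesis unfolding tp t4 s_def[symmetric] e by linarith
  qed
qed (use p in simp)

text \<open>The middle index ranges over one point, placed below all rows, so the first truncation is
  trivial and the multiplier acts on the rank one matrix with all entries \<open>1/n\<close>.  The result is \<open>1/n\<close> times the
  sign matrix, with singular values of order \<open>1 / (k + 1)\<close>.\<close>

lemma schatten_ge_small_p:
  assumes p: "1 < p" "p \<le> 2" and N: "N \<in> schur_extensions (2 * p) (2 * p) p dd2"
    and C: "C \<in> schatten_bilinear_bounds (2 * p) (2 * p) p N" and n: "n > 0"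
  shows "(\<Sum>k<n. real (Suc k) powr (- p)) \<le> 64 * C powr p"
proof -
  define a where "a = (\<lambda>(x :: nat) (y :: unit). complex_of_real (1 / sqrt (real n)))"
  define b where "b = (\<lambda>(y :: unit) (z :: nat). complex_of_real (1 / sqrt (real n)))"
  define k where "k x z = tri_sign x z / complex_of_real (real n)" for x z
  \<comment> \<open>small against the squares of all singular values, since these are at least \<open>1 / n\<close>\<close>
  define \<epsilon> where "\<epsilon> = 1 / (20 * (real n)\<^sup>2)"
  have eps: "\<epsilon> > 0" using n by (simp add: \<epsilon>_def)
  have sq: "(1 / sqrt (real n))\<^sup>2 = 1 / real n" by (simp add: power_divide)
  have cab: "(cmod (a x y))\<^sup>2 = 1 / real n" "(cmod (b y z))\<^sup>2 = 1 / real n" for x y z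
    unfolding a_def b_def norm_of_real power2_abs sq by simp_all
  have contr_a: "(\<Sum>x<n. (cmod (\<Sum>y\<in>{()}. a x y * v y))\<^sup>2) \<le> (\<Sum>y\<in>{()}. (cmod (v y))\<^sup>2)" for v
    using n by (simp add: norm_mult power_mult_distrib cab)
  have contr_b: "(\<Sum>y\<in>{()}. (cmod (\<Sum>z<n. b y z * v z))\<^sup>2) \<le> (\<Sum>z<n. (cmod (v z))\<^sup>2)" for v
  proof -
    have "cmod (\<Sum>z<n. b () z * v z) \<le> (\<Sum>z<n. 1 / sqrt (real n) * cmod (v z))"
      by (rule order_trans[OF norm_sum]) (simp add: norm_mult b_def norm_divide)
    also have "\<dots> = 1 / sqrt (real n) * (\<Sum>z<n. cmod (v z))" by (simp only: sum_distrib_left)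
    finally have "(cmod (\<Sum>z<n. b () z * v z))\<^sup>2 \<le> (1 / sqrt (real n) * (\<Sum>z<n. cmod (v z)))\<^sup>2"
      by (rule power_mono) simp
    also have "\<dots> = 1 / real n * (\<Sum>z<n. cmod (v z))\<^sup>2" unfolding power_mult_distrib sq ..
    also have "\<dots> \<le> 1 / real n * ((\<Sum>z<n. (cmod (v z))\<^sup>2) * n)"
      using sum_squared_le_sum_of_squares[of "\<lambda>z. cmod (v z)" "{..<n}"] by (intro mult_left_mono) auto
    also have "\<dots> = (\<Sum>z<n. (cmod (v z))\<^sup>2)" using n by simp
    finally show ?thesis by simp
  qed
  have ha: "(\<Sum>x<n. \<Sum>y\<in>{()}. (cmod (a x y))\<^sup>2) \<le> 1" and hb: "(\<Sum>y\<in>{()}. \<Sum>z<n. (cmod (b y z))\<^sup>2) \<le> 1"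
    using n by (simp_all add: cab)
  have kk: "k x z = (\<Sum>y\<in>{()}. of_real (sign_mask (2 * x + 2) 1 (2 * z + 1)) * a x y * b y z)" for x z
  proof -
    have "1 / sqrt (real n) * (1 / sqrt (real n)) = 1 / real n" using sq by (simp only: power2_eq_square)
    then have "complex_of_real (1 / sqrt (real n)) * complex_of_real (1 / sqrt (real n)) = complex_of_real (1 / real n)"
      by (simp only: of_real_mult[symmetric])
    then have "complex_of_real (1 / sqrt (real n)) * complex_of_real (1 / sqrt (real n)) = 1 / complex_of_real (real n)"
      by simp
    moreover have "complex_of_real (sign_mask (2 * x + 2) 1 (2 * z + 1)) = tri_sign x z"
      by (auto simp: sign_mask_def tri_sign_def)
    ultimately show ?thesis by (simp only: k_def a_def b_def mult.assoc) simp
  qed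
  have inj: "inj_on (\<lambda>x. 2 * x + 2 :: nat) {..<n}" "inj_on (\<lambda>_ :: unit. 1 :: nat) {()}" "inj_on (\<lambda>z. 2 * z + 1 :: nat) {..<n}"
    by (auto simp: inj_on_def)
  have ne: "2 * x + 2 \<noteq> (1 :: nat)" "2 * x + 2 \<noteq> 2 * z + (1 :: nat)" for x z :: nat by presburger+
  have p1: "p \<ge> 1" using p by simp
  have fu: "finite {()}" by simp
  obtain K e f where K: "square_integrable lborel K" "kop K \<in> schatten_class p"
    and bK: "schatten_norm p (kop K) \<le> C * (1 * 1) powr (1 / (2 * p))"
    and ore: "orthonormal_on {..<n} e" and orf: "orthonormal_on {..<n} f"
    and Kf: "\<forall>v. norm (kop K (\<Sum>z<n. l2_scaleC (v z) (f z)) - (\<Sum>x<n. l2_scaleC (\<Sum>z<n. k x z * v z) (e x)))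
        \<le> \<epsilon> * norm (\<Sum>z<n. l2_scaleC (v z) (f z))"
    and Ke: "\<forall>w. norm (op_adjoint (kop K) (\<Sum>x<n. l2_scaleC (w x) (e x)) - (\<Sum>z<n. l2_scaleC (\<Sum>x<n. cnj (k x z) * w x) (f z)))
        \<le> \<epsilon> * norm (\<Sum>x<n. l2_scaleC (w x) (e x))"
    and nadj: "norm (op_adjoint (kop K)) \<le> norm (kop K)"
    and nK: "norm (kop K) \<le> sqrt (\<Sum>x<n. \<Sum>z<n. (cmod (k x z))\<^sup>2) + \<epsilon>"
    by (rule schur_transfer[OF p1 N C finite_lessThan[of n] fu finite_lessThan[of n] inj ne contr_a contr_b ha hb eps kk])
  define T where "T = kop K"
  define T' where "T' = op_adjoint T"
  define E where "E j = (\<Sum>x<n. l2_scaleC (neg_vec n j x) (e x))" for j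
  define F where "F j = (\<Sum>z<n. l2_scaleC (neg_vec n j z) (f z))" for j
  define l where "l j = cmod (neg_eigenvalue n j) / real n" for j
  have oF: "orthonormal_on {..<n} F"
    unfolding orthonormal_on_def
  proof (intro ballI)
    fix i j assume ij: "i \<in> {..<n}" "j \<in> {..<n}"
    have "cinner (F i) (F j) = (\<Sum>z<n. neg_vec n j z * cnj (neg_vec n i z))"
      unfolding F_def orthonormal_cinner_sum_sum[OF orf finite_lessThan] by (simp only: mult.commute)
    then show "cinner (F i) (F j) = (if i = j then 1 else 0)"
      using neg_vec_orthonormal[of j n i] ij by (simp add: eq_commute)
  qed
  have nF: "norm (F j) = 1" if "j < n" for j using orthonormal_on_norm[OF oF] that by simp
  have nE: "norm (E j) = 1" if "j < n" for j
  proof -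
    have "(norm (E j))\<^sup>2 = (norm (F j))\<^sup>2"
      unfolding E_def F_def norm_orthonormal_sum[OF ore finite_lessThan] norm_orthonormal_sum[OF orf finite_lessThan] ..
    then have "norm (E j) = norm (F j)" by (rule power2_eq_imp_eq) simp_all
    then show ?thesis using nF[OF that] by simp
  qed
  have TF: "norm (T (F j) - l2_scaleC (neg_eigenvalue n j / real n) (E j)) \<le> \<epsilon>" if j: "j < n" for j
  proof -
    have "(\<Sum>z<n. k x z * neg_vec n j z) = neg_eigenvalue n j / real n * neg_vec n j x" if "x < n" for x
      using tri_sign_eigenvector[OF that, of j] by (simp add: k_def flip: sum_divide_distrib)
    then have "(\<Sum>x<n. l2_scaleC (\<Sum>z<n. k x z * neg_vec n j z) (e x)) = l2_scaleC (neg_eigenvalue n j / real n) (E j)"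
      unfolding E_def l2_scaleC_sum by (intro sum.cong refl) simp
    then show ?thesis using Kf[rule_format, of "neg_vec n j"] nF[OF j] by (simp add: T_def F_def)
  qed
  have T'E: "norm (T' (E j) - l2_scaleC (- 2 / (1 - neg_root n j) / real n) (F j)) \<le> \<epsilon>" if j: "j < n" for j
  proof -
    have "(\<Sum>x<n. cnj (k x z) * neg_vec n j x) = - 2 / (1 - neg_root n j) / real n * neg_vec n j z" if "z < n" for z
    proof -
      have "cnj (k x z) = tri_sign x z / real n" for x by (simp add: k_def tri_sign_def)
      then show ?thesis
        using tri_sign_transpose_eigenvector[OF that, of j] by (simp flip: sum_divide_distrib)
    qed
    then have "(\<Sum>z<n. l2_scaleC (\<Sum>x<n. cnj (k x z) * neg_vec n j x) (f z)) = l2_scaleC (- 2 / (1 - neg_root n j) / real n) (F j)"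
      unfolding F_def l2_scaleC_sum by (intro sum.cong refl) simp
    then show ?thesis using Ke[rule_format, of "neg_vec n j"] nE[OF j] by (simp add: T_def T'_def E_def)
  qed
  have nT: "norm T' \<le> 2"
  proof -
    have "cmod (k x z) = 1 / real n" for x z by (simp add: k_def tri_sign_def norm_divide)
    then have "(\<Sum>x<n. \<Sum>z<n. (cmod (k x z))\<^sup>2) = real n * (real n * (1 / real n)\<^sup>2)"
      by (simp only: sum_constant card_lessThan)
    also have "\<dots> = 1" using n by (simp add: power2_eq_square)
    finally have 1: "sqrt (\<Sum>x<n. \<Sum>z<n. (cmod (k x z))\<^sup>2) = 1" by simp
    have "1 \<le> (real n)\<^sup>2" using n by (intro one_le_power) simp
    then have "0 < 20 * (real n)\<^sup>2" "1 \<le> 20 * (real n)\<^sup>2" by linarith+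
    then have "\<epsilon> \<le> 1" unfolding \<epsilon>_def by (simp only: divide_le_eq_1_pos)
    then show ?thesis using nadj nK unfolding 1 T'_def T_def by linarith
  qed
  have T'lin: "T' (l2_scaleC c x) = l2_scaleC c (T' x)" for c x
    using kop_bounded_ops[OF square_integrable_adj_kernel[OF K(1)]]
    by (simp add: T'_def T_def op_adjoint_kop[OF K(1)] bounded_ops_def)
  have lb: "l j \<ge> 1 / real n" "l j \<ge> 1 / (4 * real (Suc j))" "l j > 0" for j
  proof -
    show 1: "l j \<ge> 1 / real n"
      unfolding l_def using neg_eigenvalue_bounds(2)[OF n, of j] by (rule divide_right_mono) simp
    have "0 < 1 / real n" using n by simp
    with 1 show "l j > 0" by linarith
    have "real n / (4 * real (Suc j)) / real n \<le> l j"
      unfolding l_def using neg_eigenvalue_bounds(1)[OF n, of j] by (rule divide_right_mono) simp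
    moreover have "real n / (4 * real (Suc j)) / real n = 1 / (4 * real (Suc j))"
      using n by (simp del: of_nat_Suc)
    ultimately show "l j \<ge> 1 / (4 * real (Suc j))" by (simp only:)
  qed
  have el: "\<epsilon> \<le> (l j)\<^sup>2 / 20" "\<epsilon> \<le> l j / 20" for j
  proof -
    have e: "\<epsilon> = (1 / real n)\<^sup>2 / 20" by (simp add: \<epsilon>_def power_divide)
    have "(1 / real n)\<^sup>2 \<le> (l j)\<^sup>2" by (rule power_mono[OF lb(1)]) simp
    then show "\<epsilon> \<le> (l j)\<^sup>2 / 20" unfolding e by linarith
    have "1 / real n \<le> 1" using n by simp
    then have "(1 / real n)\<^sup>2 \<le> 1 / real n * 1" unfolding power2_eq_square by (rule mult_left_mono) simp
    then show "\<epsilon> \<le> l j / 20" unfolding e using lb(1)[of j] by linarith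
  qed
  have low: "19 / 20 * l j \<le> norm (T (F j))" if j: "j < n" for j
  proof -
    have "norm (l2_scaleC (neg_eigenvalue n j / real n) (E j)) = l j" using nE[OF j] by (simp add: norm_divide l_def)
    then have "l j \<le> norm (T (F j)) + \<epsilon>"
      using norm_triangle_ineq4[of "T (F j)" "T (F j) - l2_scaleC (neg_eigenvalue n j / real n) (E j)"] TF[OF j] by simp
    then show ?thesis using el(2)[of j] by linarith
  qed
  have up: "norm (T' (T (F j))) \<le> 23 / 20 * (l j)\<^sup>2" if j: "j < n" for j
  proof -
    let ?c = "neg_eigenvalue n j / real n"
    let ?R = "T (F j) - l2_scaleC ?c (E j)"
    have "T' (T (F j)) = T' ?R + l2_scaleC ?c (T' (E j))" by (simp add: blinfun.diff_right T'lin)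
    then have "norm (T' (T (F j))) \<le> norm (T' ?R) + cmod ?c * norm (T' (E j))"
      using norm_triangle_ineq[of "T' ?R" "l2_scaleC ?c (T' (E j))"] by (simp only: norm_l2_scaleC)
    also have "norm (T' ?R) \<le> 2 * \<epsilon>"
      using norm_blinfun_apply_le[OF nT, of ?R] TF[OF j] by simp
    also have "cmod ?c = l j" by (simp add: norm_divide l_def)
    also have "norm (T' (E j)) \<le> l j + \<epsilon>"
    proof -
      have "norm (l2_scaleC (- 2 / (1 - neg_root n j) / real n) (F j)) = l j"
        unfolding norm_l2_scaleC norm_divide[of "- 2 / (1 - neg_root n j)"] neg_eigenvalue_bounds(3)[OF n] nF[OF j] l_def
        by (simp only: norm_of_real abs_of_nat mult_1_right)
      then show ?thesis
        using norm_triangle_ineq[of "T' (E j) - l2_scaleC (- 2 / (1 - neg_root n j) / real n) (F j)"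
            "l2_scaleC (- 2 / (1 - neg_root n j) / real n) (F j)"] T'E[OF j] by simp
    qed
    also have "l j * (l j + \<epsilon>) \<le> l j * (l j + l j / 20)" using lb(3)[of j] el(2)[of j] by (intro mult_left_mono add_left_mono) auto
    finally have "norm (T' (T (F j))) \<le> 2 * \<epsilon> + l j * (l j + l j / 20)" using lb(3)[of j] by simp
    also have "\<dots> \<le> 2 * ((l j)\<^sup>2 / 20) + l j * (l j + l j / 20)" using el(1)[of j] by simp
    also have "\<dots> = 23 / 20 * (l j)\<^sup>2" by (simp add: power2_eq_square algebra_simps)
    finally show ?thesis .
  qed
  \<comment> \<open>a fixed multiple of \<open>(l j)\<^sup>2\<close> large enough for the negative quartic term to be harmless\<close>
  define t0 where "t0 j = 4 * (l j)\<^sup>2" for j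
  have t0: "t0 j > 0" for j using lb(3)[of j] by (simp add: t0_def)
  have summand_ge: "real (Suc j) powr (- p) / 64 \<le> 0 + t0 j powr (p / 2 - 1) * (norm (T (F j)))\<^sup>2
      + (- (t0 j powr (p / 2 - 2))) * (norm (T' (T (F j))))\<^sup>2" if j: "j < n" for j
  proof -
    have l0: "l j > 0" by (rule lb)
    have e: "t0 j powr (p / 2 - 1) = t0 j powr (p / 2 - 2) * t0 j"
      using t0[of j] powr_add[of "t0 j" "p / 2 - 2" 1] by simp
    have 1: "361 / 400 * (l j)\<^sup>2 \<le> (norm (T (F j)))\<^sup>2"
      using power_mono[OF low[OF j], of 2] l0 by (simp add: power_mult_distrib power_divide)
    have 2: "(norm (T' (T (F j))))\<^sup>2 \<le> 529 / 400 * (l j)\<^sup>2 * (l j)\<^sup>2"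
      using power_mono[OF up[OF j], of 2] by (simp add: power_mult_distrib power_divide power2_eq_square mult_ac)
    have "t0 j powr (p / 2 - 1) * ((l j)\<^sup>2 / 2)
        \<le> t0 j powr (p / 2 - 2) * (t0 j * (361 / 400 * (l j)\<^sup>2) - 529 / 400 * (l j)\<^sup>2 * (l j)\<^sup>2)"
    proof -
      have "t0 j * ((l j)\<^sup>2 / 2) \<le> t0 j * (361 / 400 * (l j)\<^sup>2) - 529 / 400 * (l j)\<^sup>2 * (l j)\<^sup>2"
        using zero_le_power2[of "(l j)\<^sup>2"] by (simp add: t0_def power2_eq_square algebra_simps)
      then have "t0 j powr (p / 2 - 2) * (t0 j * ((l j)\<^sup>2 / 2)) \<le> t0 j powr (p / 2 - 2) * (t0 j * (361 / 400 * (l j)\<^sup>2) - 529 / 400 * (l j)\<^sup>2 * (l j)\<^sup>2)"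
        by (rule mult_left_mono) simp
      then show ?thesis by (simp only: e mult.assoc)
    qed
    also have "\<dots> \<le> t0 j powr (p / 2 - 2) * (t0 j * (norm (T (F j)))\<^sup>2 - (norm (T' (T (F j))))\<^sup>2)"
      using 1 2 t0[of j] by (intro mult_left_mono diff_mono) auto
    also have "\<dots> = 0 + t0 j powr (p / 2 - 1) * (norm (T (F j)))\<^sup>2
      + (- (t0 j powr (p / 2 - 2))) * (norm (T' (T (F j))))\<^sup>2" by (simp add: e algebra_simps)
    finally have A: "t0 j powr (p / 2 - 1) * ((l j)\<^sup>2 / 2) \<le> \<dots>" .
    have "real (Suc j) powr (- p) / 64 \<le> t0 j powr (p / 2 - 1) * ((l j)\<^sup>2 / 2)"
    proof -
      have lp: "((l j)\<^sup>2) powr (p / 2 - 1) * (l j)\<^sup>2 = l j powr p"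
      proof -
        have l2: "(l j)\<^sup>2 = l j powr 2" using l0 by (simp add: powr_numeral)
        have "((l j)\<^sup>2) powr (p / 2 - 1) * (l j)\<^sup>2 = l j powr (2 * (p / 2 - 1) + 2)"
          unfolding l2 powr_powr powr_add ..
        also have "2 * (p / 2 - 1) + 2 = p" by simp
        finally show ?thesis .
      qed
      have "(4 :: real) powr (- (1 / 2)) \<le> 4 powr (p / 2 - 1)" using p by (intro powr_mono) auto
      moreover have "(4 :: real) powr (- (1 / 2)) = 1 / 2"
        using powr_minus_divide[of "4 :: real" "1 / 2"] powr_half_sqrt[of "4 :: real"] by simp
      ultimately have four: "1 / 2 \<le> (4 :: real) powr (p / 2 - 1)" by (simp only:)
      have "1 / 4 * l j powr p \<le> 4 powr (p / 2 - 1) * (l j powr p / 2)"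
        using mult_right_mono[OF four, of "l j powr p / 2"] by simp
      also have "\<dots> = t0 j powr (p / 2 - 1) * ((l j)\<^sup>2 / 2)"
      proof -
        have "t0 j powr (p / 2 - 1) = 4 powr (p / 2 - 1) * ((l j)\<^sup>2) powr (p / 2 - 1)"
          unfolding t0_def by (rule powr_mult)
        then show ?thesis unfolding lp[symmetric] by (simp only: mult.assoc times_divide_eq_right)
      qed
      finally have B: "1 / 4 * l j powr p \<le> t0 j powr (p / 2 - 1) * ((l j)\<^sup>2 / 2)" .
      have "(1 / (4 * real (Suc j))) powr p \<le> l j powr p" using lb(2)[of j] p by (intro powr_mono2) auto
      moreover have "(1 / (4 * real (Suc j))) powr p = (1 / 4) powr p * real (Suc j) powr (- p)"
        using powr_divide[of 1 "real (Suc j) * 4" p] powr_mult[of "real (Suc j)" 4 p] powr_divide[of 1 4 p] powr_minus_divide[of "real (Suc j)" p]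
        by (simp add: mult.commute)
      moreover have "(1 / 4 :: real) powr 2 \<le> (1 / 4) powr p" using p by (intro powr_mono') auto
      then have "1 / 16 * real (Suc j) powr (- p) \<le> (1 / 4) powr p * real (Suc j) powr (- p)"
        by (intro mult_right_mono) (auto simp: power_divide)
      ultimately have "1 / 16 * real (Suc j) powr (- p) \<le> l j powr p" by linarith
      then show ?thesis using B by linarith
    qed
    with A show ?thesis by linarith
  qed
  have "(\<Sum>j<n. real (Suc j) powr (- p) / 64) \<le> (\<Sum>j<n. 0 + t0 j powr (p / 2 - 1) * (norm (T (F j)))\<^sup>2
      + (- (t0 j powr (p / 2 - 2))) * (norm (T' (T (F j))))\<^sup>2)"
    by (intro sum_mono summand_ge) simp
  also have "\<dots> \<le> schatten_norm p T powr p"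
    unfolding T'_def T_def
    by (rule schatten_kop_ge[OF K(1) _ K(2) oF finite_lessThan]) (use p powr_ge_quartic[OF t0] in auto)
  also have "\<dots> \<le> C powr p"
    using bK schatten_norm_nonneg p by (intro powr_mono2) (auto simp: T_def)
  finally show ?thesis by (simp only: sum_divide_distrib[symmetric])
qed

text \<open>As \<open>\<Sum> k\<^sup>-\<^sup>p \<ge> 1 / (p - 1)\<close>, the bound \<open>C\<close> is at least a constant times \<open>(1 / (p - 1))\<^sup>1\<^sup>/\<^sup>p\<close>, which is comparable to
  \<open>1 / (p - 1)\<close> because \<open>x\<^sup>x\<close> is bounded below for \<open>x = p - 1\<close>.\<close>

lemma bound_small_p:
  assumes p: "1 < p" "p \<le> 2" and N: "N \<in> schur_extensions (2 * p) (2 * p) p dd2"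
    and C: "C \<in> schatten_bilinear_bounds (2 * p) (2 * p) p N"
  shows "exp (-1) / 512 * p\<^sup>2 * (p / (p - 1)) \<le> C"
proof -
  define x where "x = p - 1"
  have x: "0 < x" "x \<le> 1" using p by (auto simp: x_def)
  have C0: "C \<ge> 0" using C by (simp add: schatten_bilinear_bounds_def)
  have le: "(1 - (real n + 1) powr (1 - p)) / x \<le> 64 * C powr p" if "n \<ge> 1" for n :: nat
    using sum_powr_ge[OF p(1), of n] schatten_ge_small_p[OF p N C, of n] that by (simp add: x_def)
  have "filterlim (\<lambda>n. real (Suc n)) at_top sequentially"
    by (rule filterlim_compose[OF filterlim_real_sequentially filterlim_Suc])
  then have "filterlim (\<lambda>n. real n + 1) at_top sequentially" by (simp only: of_nat_Suc add.commute)
  then have "(\<lambda>n. (real n + 1) powr (1 - p)) \<longlonglongrightarrow> 0"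
    by (rule tendsto_neg_powr[rotated]) (use p in simp)
  then have "(\<lambda>n. (1 - (real n + 1) powr (1 - p)) / x) \<longlonglongrightarrow> (1 - 0) / x"
    by (intro tendsto_intros) (use x in auto)
  then have "(1 - 0) / x \<le> 64 * C powr p"
    by (rule LIMSEQ_le_const2) (use le in blast)
  then have Cp: "1 / (64 * x) \<le> C powr p" using x by (simp add: field_simps)
  have "(1 / (64 * x)) powr (1 / p) \<le> (C powr p) powr (1 / p)"
    using Cp x p by (intro powr_mono2) auto
  also have "\<dots> = C" using p C0 by (simp add: powr_powr)
  finally have 1: "(1 / (64 * x)) powr (1 / p) \<le> C" .
  have e1: "exp (-1) / x \<le> (1 / x) powr (1 / p)"
  proof -
    have "1 - 1 / x \<le> ln x" using ln_add_one_self_le_self2[of "1 / x - 1"] x by (simp add: ln_div)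
    then have "x * (1 - 1 / x) \<le> x * ln x" using x by (intro mult_left_mono) auto
    then have "- 1 \<le> x * ln x" using x by (simp add: algebra_simps)
    then have "- p \<le> x * ln x" using p by linarith
    then have "- 1 \<le> (x * ln x) / p" using p by (simp add: le_divide_eq)
    moreover have "(x * ln x) / p = ln x - ln x / p" using p by (simp add: x_def diff_divide_distrib left_diff_distrib)
    ultimately have "- 1 - ln x \<le> - (ln x / p)" by linarith
    then have "exp (- 1 - ln x) \<le> exp (- (ln x / p))" by simp
    then show ?thesis using x by (simp add: exp_diff powr_def ln_div)
  qed
  have "1 / 64 * (exp (-1) / x) \<le> (1 / 64) powr (1 / p) * (1 / x) powr (1 / p)"
  proof (intro mult_mono e1)
    have "(1 / 64 :: real) powr 1 \<le> (1 / 64) powr (1 / p)" using p by (intro powr_mono') auto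
    then show "(1 / 64 :: real) \<le> (1 / 64) powr (1 / p)" by simp
  qed (use x in auto)
  also have "\<dots> = (1 / (64 * x)) powr (1 / p)" using x by (simp flip: powr_mult)
  finally have 2: "1 / 64 * (exp (-1) / x) \<le> C" using 1 by linarith
  have "exp (-1) / 512 * p\<^sup>2 * (p / (p - 1)) = (exp (-1) / 512 / x) * p ^ 3"
    by (simp add: x_def power3_eq_cube power2_eq_square)
  also have "\<dots> \<le> (exp (-1) / 512 / x) * 2 ^ 3"
    using p x by (intro mult_left_mono power_mono) auto
  also have "\<dots> = 1 / 64 * (exp (-1) / x)" by simp
  finally show ?thesis using 2 by linarith
qed

section \<open>The lower bound for large \<open>p\<close>\<close>

lemma powr_ge_shifted_quadratic:
  fixes p t t0 :: real
  assumes t0: "t0 > 0" and p: "p \<ge> 2" and t: "t \<ge> 0"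
  shows "- (t0 powr p) + t0 powr (p - 2) * t\<^sup>2 \<le> t powr p"
proof (cases "t \<le> t0")
  case True
  have "t0 powr p = t0 powr (p - 2) * t0\<^sup>2" using t0 powr_add[of t0 "p - 2" 2] by simp
  moreover have "t0 powr (p - 2) * t\<^sup>2 \<le> t0 powr (p - 2) * t0\<^sup>2"
    using True t by (intro mult_left_mono power_mono) auto
  moreover have "0 \<le> t powr p" by simp
  ultimately show ?thesis by linarith
next
  case False
  then have tp: "t powr p = t powr (p - 2) * t\<^sup>2" using t0 powr_add[of t "p - 2" 2] by simp
  have "t0 powr (p - 2) * t\<^sup>2 \<le> t powr (p - 2) * t\<^sup>2"
    using False t0 p by (intro mult_right_mono powr_mono2) auto
  moreover have "0 \<le> t0 powr p" by simp
  ultimately show ?thesis unfolding tp by linarith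
qed

text \<open>The constant 2 is lost by testing with the quadratic bound at \<open>t\<^sub>0 = \<parallel>Tx\<parallel> / 2\<close>; it only affects the
  absolute constant of the theorem.\<close>

lemma norm_apply_le_schatten:
  assumes K: "square_integrable lborel K" "kop K \<in> schatten_class p" and p: "p \<ge> 2" and x: "norm x = 1"
  shows "norm (kop K x) \<le> 2 * schatten_norm p (kop K)"
proof (cases "kop K x = 0")
  case False
  define t0 where "t0 = norm (kop K x) / 2"
  have t0: "t0 > 0" using False by (simp add: t0_def)
  have "cinner x x = 1" using x by (simp add: cinner_self)
  then have o: "orthonormal_on {()} (\<lambda>_. x)" by (simp add: orthonormal_on_def)
  have 1: "(\<Sum>i\<in>{()}. - (t0 powr p) + t0 powr (p - 2) * (norm (kop K x))\<^sup>2 + 0 * (norm (op_adjoint (kop K) (kop K x)))\<^sup>2)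
      \<le> schatten_norm p (kop K) powr p"
    by (rule schatten_kop_ge[OF K(1) _ K(2) o, where c = "\<lambda>_. - (t0 powr p)" and a = "\<lambda>_. t0 powr (p - 2)" and b = "\<lambda>_. 0"])
       (use p powr_ge_shifted_quadratic[OF t0 p] in auto)
  have 2: "t0 powr (p - 2) * (norm (kop K x))\<^sup>2 = 4 * t0 powr p"
    using t0 powr_add[of t0 "p - 2" 2] by (simp add: t0_def power_divide)
  have "- (t0 powr p) + t0 powr (p - 2) * (norm (kop K x))\<^sup>2 \<le> schatten_norm p (kop K) powr p"
    using 1 by simp
  then have "t0 powr p \<le> schatten_norm p (kop K) powr p" unfolding 2 using powr_ge_zero[of t0 p] by linarith
  then have "t0 \<le> schatten_norm p (kop K)"
    using powr_less_mono2[of p "schatten_norm p (kop K)" t0] p schatten_norm_nonneg[of p "kop K"] by force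
  then show ?thesis by (simp add: t0_def)
qed (simp add: schatten_norm_nonneg)

text \<open>Exponents for the index sets \<open>(j, i)\<close>, \<open>(j, i')\<close> and \<open>m\<close>.  The order is lexicographic in blocks of length
  \<open>2n + 2\<close>, with even exponents on the negative half-line and odd ones on the positive half-line.  Inside
  a block the first truncation compares \<open>i'\<close> with \<open>i\<close>; the column \<open>m\<close> stands at the bottom of its block, so the second
  truncation compares \<open>m\<close> with \<open>j\<close> only.\<close>

definition pos_lambda :: "nat \<Rightarrow> nat \<times> nat \<Rightarrow> nat" where
  "pos_lambda n x = fst x * (2 * n + 2) + 2 * snd x + 2"

definition pos_mu :: "nat \<Rightarrow> nat \<times> nat \<Rightarrow> nat" where
  "pos_mu n y = fst y * (2 * n + 2) + 2 * snd y + 1"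

definition pos_nu :: "nat \<Rightarrow> nat \<Rightarrow> nat" where
  "pos_nu n m = m * (2 * n + 2) + 1"

lemma block_less:
  assumes "(j :: nat) < j'" "r < d"
  shows "j * d + r < j' * d + r'"
proof -
  have "j * d + r < Suc j * d" using assms by simp
  also have "\<dots> \<le> j' * d" using assms by (intro mult_right_mono) auto
  finally show ?thesis by simp
qed

lemma sign_mask_positions:
  assumes "i < n" "i' < n"
  shows "sign_mask (pos_lambda n (j, i)) (pos_mu n (j, i')) (pos_nu n m) = (if i' \<le> i \<and> m \<le> j then - 1 else 1)"
proof -
  have "pos_mu n (j, i') < pos_lambda n (j, i) \<longleftrightarrow> i' \<le> i" by (auto simp: pos_mu_def pos_lambda_def)
  moreover have "pos_nu n m < pos_lambda n (j, i) \<longleftrightarrow> m \<le> j"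
  proof (cases "m \<le> j")
    case True
    then have "m * (2 * n + 2) \<le> j * (2 * n + 2)" by (rule mult_right_mono) simp
    then show ?thesis using True by (simp add: pos_nu_def pos_lambda_def)
  next
    case False
    then have "j * (2 * n + 2) + (2 * i + 1) < m * (2 * n + 2) + 0" using assms by (intro block_less) auto
    then show ?thesis using False by (simp add: pos_nu_def pos_lambda_def)
  qed
  ultimately show ?thesis by (simp add: sign_mask_def)
qed

lemma inj_positions:
  "inj_on (pos_lambda n) ({..<n} \<times> {..<n})" "inj_on (pos_mu n) ({..<n} \<times> {..<n})" "inj_on (pos_nu n) {..<n}"
proof -
  have *: "x = y" if x: "x \<in> {..<n} \<times> {..<n}" and y: "y \<in> {..<n} \<times> {..<n}"
    and e: "fst x * (2 * n + 2) + 2 * snd x = fst y * (2 * n + 2) + 2 * snd y" for x y :: "nat \<times> nat"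
  proof -
    have "\<not> fst x < fst y" using block_less[of "fst x" "fst y" "2 * snd x" "2 * n + 2" "2 * snd y"] x e by auto
    moreover have "\<not> fst y < fst x" using block_less[of "fst y" "fst x" "2 * snd y" "2 * n + 2" "2 * snd x"] y e by auto
    ultimately have "fst x = fst y" by simp
    then show ?thesis using e by (simp add: prod_eq_iff)
  qed
  show "inj_on (pos_lambda n) ({..<n} \<times> {..<n})" "inj_on (pos_mu n) ({..<n} \<times> {..<n})"
    by (rule inj_onI, rule *, assumption, assumption, simp add: pos_lambda_def pos_mu_def)+
  show "inj_on (pos_nu n) {..<n}"
    by (rule inj_onI) (simp only: pos_nu_def add_right_cancel mult_cancel2, simp)
qed

lemma parity_positions: "pos_lambda n x \<noteq> pos_mu n y" "pos_lambda n x \<noteq> pos_nu n m"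
proof -
  have "even (pos_lambda n x)" "odd (pos_mu n y)" "odd (pos_nu n m)"
    by (simp_all add: pos_lambda_def pos_mu_def pos_nu_def)
  then show "pos_lambda n x \<noteq> pos_mu n y" "pos_lambda n x \<noteq> pos_nu n m" by auto
qed

lemma sum_masked_neg_unitary:
  assumes n: "n > 0"
  shows "(\<Sum>i<n. \<Sum>l<n. if l \<le> i then neg_unitary n i l else 0)
      = ((\<Sum>i<n. \<Sum>l<n. neg_unitary n i l) - of_real (\<Sum>k<n. cmod (neg_eigenvalue n k))) / 2"
proof -
  have "(if l \<le> i then neg_unitary n i l else 0) = (neg_unitary n i l - tri_sign i l * neg_unitary n i l) / 2" for i l
    by (simp add: tri_sign_def)
  then have "(\<Sum>i<n. \<Sum>l<n. if l \<le> i then neg_unitary n i l else 0)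
      = ((\<Sum>i<n. \<Sum>l<n. neg_unitary n i l) - (\<Sum>i<n. \<Sum>l<n. tri_sign i l * neg_unitary n i l)) / 2"
    by (simp only: sum_divide_distrib[symmetric] sum_subtractf)
  then show ?thesis by (simp only: sum_tri_sign_neg_unitary[OF n])
qed

text \<open>With the positions above, the two truncations act on different tensor factors.  Take \<open>a = 1 \<otimes> W\<close> and
  \<open>b = W \<otimes> u\<close> for a unitary \<open>W\<close> and the normalised constant vector \<open>u\<close>.  Both are contractions, and testing
  the masked product on constant vectors produces the square of the truncated form of \<open>W\<close>, that is
  a term of order \<open>\<Lambda>\<^sup>2\<close>, while the unmasked part contributes at most 1.\<close>

lemma schatten_ge_large_p:
  assumes p: "p \<ge> 2" and N: "N \<in> schur_extensions (2 * p) (2 * p) p dd2"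
    and C: "C \<in> schatten_bilinear_bounds (2 * p) (2 * p) p N" and n: "n > 0"
    and \<Lambda>: "\<Lambda> = (\<Sum>k<n. cmod (neg_eigenvalue n k)) / real n" "\<Lambda> \<ge> 1"
  shows "(\<Lambda> - 1)\<^sup>2 / 2 - 2 \<le> 2 * (C * ((real n)\<^sup>2 * real n) powr (1 / (2 * p)))"
proof -
  let ?X = "{..<n} \<times> {..<n}"
  define W where "W = neg_unitary n"
  define a where "a x y = (if fst x = fst y then W (snd x) (snd y) else 0)" for x y :: "nat \<times> nat"
  define b where "b y m = W (fst y) m / complex_of_real (sqrt (real n))" for y :: "nat \<times> nat" and m
  define k where "k x m = (\<Sum>y\<in>?X. of_real (sign_mask (pos_lambda n x) (pos_mu n y) (pos_nu n m)) * a x y * b y m)" for x m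
  have iso: "(\<Sum>i<n. (cmod (\<Sum>l<n. W i l * v l))\<^sup>2) = (\<Sum>l<n. (cmod (v l))\<^sup>2)" for v
    unfolding W_def by (rule neg_unitary_isometry)
  have col: "(\<Sum>i<n. (cmod (W i l))\<^sup>2) = 1" if "l < n" for l
    unfolding W_def by (rule neg_unitary_column[OF that])
  have a_sum: "(\<Sum>y\<in>?X. a (j, i) y * g y) = (\<Sum>i'<n. W i i' * g (j, i'))" if "j < n" for j i g
  proof -
    have "(\<Sum>y\<in>?X. a (j, i) y * g y) = (\<Sum>j'<n. if j' = j then \<Sum>i'<n. W i i' * g (j, i') else 0)"
      unfolding sum.cartesian_product' by (intro sum.cong refl) (simp add: a_def)
    then show ?thesis using that by simp
  qed
  have sq: "(cmod (complex_of_real (sqrt (real n))))\<^sup>2 = real n" by (simp only: norm_of_real power2_abs real_sqrt_pow2 of_nat_0_le_iff)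
  have contr_a: "(\<Sum>x\<in>?X. (cmod (\<Sum>y\<in>?X. a x y * v y))\<^sup>2) \<le> (\<Sum>y\<in>?X. (cmod (v y))\<^sup>2)" for v
  proof -
    have "(\<Sum>x\<in>?X. (cmod (\<Sum>y\<in>?X. a x y * v y))\<^sup>2) = (\<Sum>j<n. \<Sum>i<n. (cmod (\<Sum>i'<n. W i i' * v (j, i')))\<^sup>2)"
      by (subst sum.cartesian_product') (intro sum.cong refl, simp only: a_sum lessThan_iff)
    also have "\<dots> = (\<Sum>y\<in>?X. (cmod (v y))\<^sup>2)"
      unfolding iso sum.cartesian_product' ..
    finally show ?thesis by simp
  qed
  have contr_b: "(\<Sum>y\<in>?X. (cmod (\<Sum>m<n. b y m * v m))\<^sup>2) \<le> (\<Sum>m<n. (cmod (v m))\<^sup>2)" for v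
  proof -
    have b_sum: "(cmod (\<Sum>m<n. b (j, i) m * v m))\<^sup>2 = (cmod (\<Sum>m<n. W j m * v m))\<^sup>2 / real n" for j i
    proof -
      have "(\<Sum>m<n. b (j, i) m * v m) = (\<Sum>m<n. W j m * v m) / complex_of_real (sqrt (real n))"
        by (simp add: b_def sum_divide_distrib)
      then show ?thesis by (simp only: norm_divide power_divide sq)
    qed
    have "(\<Sum>y\<in>?X. (cmod (\<Sum>m<n. b y m * v m))\<^sup>2) = (\<Sum>j<n. \<Sum>i<n. (cmod (\<Sum>m<n. W j m * v m))\<^sup>2 / real n)"
      unfolding sum.cartesian_product' b_sum ..
    also have "\<dots> = (\<Sum>m<n. (cmod (v m))\<^sup>2)" using n iso[of v] by simp
    finally show ?thesis by simp
  qed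
  have ha: "(\<Sum>x\<in>?X. \<Sum>y\<in>?X. (cmod (a x y))\<^sup>2) \<le> (real n)\<^sup>2"
  proof -
    have "(\<Sum>y\<in>?X. (cmod (a (j, i) y))\<^sup>2) = (\<Sum>i'<n. (cmod (W i i'))\<^sup>2)" if "j < n" for j i
    proof -
      have "(\<Sum>y\<in>?X. (cmod (a (j, i) y))\<^sup>2) = (\<Sum>j'<n. if j' = j then \<Sum>i'<n. (cmod (W i i'))\<^sup>2 else 0)"
        unfolding sum.cartesian_product' by (intro sum.cong refl) (simp add: a_def)
      then show ?thesis using that by simp
    qed
    then have "(\<Sum>x\<in>?X. \<Sum>y\<in>?X. (cmod (a x y))\<^sup>2) = (\<Sum>j<n. \<Sum>i<n. \<Sum>i'<n. (cmod (W i i'))\<^sup>2)"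
      by (subst sum.cartesian_product') (intro sum.cong refl, simp only: lessThan_iff)
    also have "\<dots> = (\<Sum>j<n. \<Sum>i'<n. \<Sum>i<n. (cmod (W i i'))\<^sup>2)"
      by (rule sum.cong[OF refl], rule sum.swap)
    also have "\<dots> = (\<Sum>j<n. \<Sum>i'<n. 1)" by (intro sum.cong refl) (simp add: col)
    finally show ?thesis by (simp add: power2_eq_square)
  qed
  have hb: "(\<Sum>y\<in>?X. \<Sum>m<n. (cmod (b y m))\<^sup>2) \<le> real n"
  proof -
    have "(cmod (b (j, i) m))\<^sup>2 = (cmod (W j m))\<^sup>2 / real n" for j i m
      by (simp only: b_def norm_divide power_divide sq fst_conv)
    then have "(\<Sum>y\<in>?X. \<Sum>m<n. (cmod (b y m))\<^sup>2) = (\<Sum>j<n. \<Sum>i<n. \<Sum>m<n. (cmod (W j m))\<^sup>2 / real n)"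
      unfolding sum.cartesian_product' by (simp only:)
    also have "\<dots> = (\<Sum>j<n. \<Sum>m<n. (cmod (W j m))\<^sup>2)" using n by (simp flip: sum_divide_distrib)
    also have "\<dots> = (\<Sum>m<n. \<Sum>j<n. (cmod (W j m))\<^sup>2)" by (rule sum.swap)
    also have "\<dots> = (\<Sum>m<n. 1)" by (intro sum.cong refl) (simp add: col)
    finally show ?thesis by simp
  qed
  have p1: "p \<ge> 1" using p by simp
  have fX: "finite ?X" by simp
  obtain K e f where K: "square_integrable lborel K" "kop K \<in> schatten_class p"
    and bK: "schatten_norm p (kop K) \<le> C * ((real n)\<^sup>2 * real n) powr (1 / (2 * p))"
    and ore: "orthonormal_on ?X e" and orf: "orthonormal_on {..<n} f"
    and Kf: "\<forall>v. norm (kop K (\<Sum>z<n. l2_scaleC (v z) (f z)) - (\<Sum>x\<in>?X. l2_scaleC (\<Sum>z<n. k x z * v z) (e x)))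
        \<le> 1 * norm (\<Sum>z<n. l2_scaleC (v z) (f z))"
    and "\<forall>w. norm (op_adjoint (kop K) (\<Sum>x\<in>?X. l2_scaleC (w x) (e x)) - (\<Sum>z<n. l2_scaleC (\<Sum>x\<in>?X. cnj (k x z) * w x) (f z)))
        \<le> 1 * norm (\<Sum>x\<in>?X. l2_scaleC (w x) (e x))"
    and "norm (op_adjoint (kop K)) \<le> norm (kop K)"
    and "norm (kop K) \<le> sqrt (\<Sum>x\<in>?X. \<Sum>z<n. (cmod (k x z))\<^sup>2) + 1"
    by (rule schur_transfer[OF p1 N C fX fX finite_lessThan[of n] inj_positions parity_positions contr_a contr_b ha hb zero_less_one k_def])
  define u where "u = 1 / complex_of_real (sqrt (real n))"
  define F where "F = (\<Sum>m<n. l2_scaleC u (f m))"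
  define E where "E = (\<Sum>x\<in>?X. l2_scaleC (1 / of_nat n) (e x))"
  have uu: "u * u = 1 / of_nat n"
    unfolding u_def by (simp flip: of_real_mult)
  have nF: "norm F = 1"
  proof -
    have "(norm F)\<^sup>2 = (\<Sum>m<n. (cmod u)\<^sup>2)" unfolding F_def by (rule norm_orthonormal_sum[OF orf finite_lessThan])
    also have "(cmod u)\<^sup>2 = 1 / real n" unfolding u_def norm_divide power_divide sq by simp
    finally have "(norm F)\<^sup>2 = 1\<^sup>2" using n by simp
    then show ?thesis by (rule power2_eq_imp_eq) simp_all
  qed
  have nE: "norm E = 1"
  proof -
    have "(norm E)\<^sup>2 = (\<Sum>x\<in>?X. (cmod (1 / of_nat n))\<^sup>2)" unfolding E_def by (rule norm_orthonormal_sum[OF ore fX])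
    also have "\<dots> = 1\<^sup>2" using n by (simp add: norm_divide power_divide power2_eq_square)
    finally show ?thesis by (rule power2_eq_imp_eq) simp_all
  qed
  define R where "R i = (\<Sum>l<n. W i l)" for i
  define L where "L i = (\<Sum>l<n. if l \<le> i then W i l else 0)" for i
  define s where "s = (\<Sum>i<n. R i)"
  define r where "r = (\<Sum>i<n. L i)"
  have ksum: "(\<Sum>m<n. k (j, i) m * u) = (R i * R j - 2 * (L i * L j)) / of_nat n" if ji: "j < n" "i < n" for j i
  proof -
    have k1: "k (j, i) m = (W j m * R i - 2 * ((if m \<le> j then W j m else 0) * L i)) * u" if "m < n" for m
    proof -
      have "k (j, i) m = (\<Sum>y\<in>?X. a (j, i) y * (of_real (sign_mask (pos_lambda n (j, i)) (pos_mu n y) (pos_nu n m)) * b y m))"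
        unfolding k_def by (simp only: mult_ac)
      also have "\<dots> = (\<Sum>i'<n. W i i' * (of_real (sign_mask (pos_lambda n (j, i)) (pos_mu n (j, i')) (pos_nu n m)) * b (j, i') m))"
        by (rule a_sum[OF ji(1)])
      also have "\<dots> = (\<Sum>i'<n. (W j m * W i i' - 2 * ((if m \<le> j then W j m else 0) * (if i' \<le> i then W i i' else 0))) * u)"
      proof (rule sum.cong[OF refl])
        fix i' assume "i' \<in> {..<n}"
        then have "sign_mask (pos_lambda n (j, i)) (pos_mu n (j, i')) (pos_nu n m) = (if i' \<le> i \<and> m \<le> j then - 1 else 1)"
          using ji by (intro sign_mask_positions) auto
        then show "W i i' * (of_real (sign_mask (pos_lambda n (j, i)) (pos_mu n (j, i')) (pos_nu n m)) * b (j, i') m)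
            = (W j m * W i i' - 2 * ((if m \<le> j then W j m else 0) * (if i' \<le> i then W i i' else 0))) * u"
          by (simp add: b_def u_def)
      qed
      also have "\<dots> = (W j m * R i - 2 * ((if m \<le> j then W j m else 0) * L i)) * u"
        unfolding R_def L_def by (simp only: sum_distrib_right[symmetric] sum_subtractf sum_distrib_left[symmetric])
      finally show ?thesis .
    qed
    have "(\<Sum>m<n. k (j, i) m * u) = (\<Sum>m<n. (W j m * R i - 2 * ((if m \<le> j then W j m else 0) * L i)) * (u * u))"
      by (intro sum.cong refl) (simp add: k1 mult.assoc)
    also have "\<dots> = (R j * R i - 2 * (L j * L i)) * (u * u)"
      unfolding R_def[of j] L_def[of j] by (simp only: sum_distrib_right[symmetric] sum_subtractf sum_distrib_left[symmetric])
    finally show ?thesis unfolding uu by (simp only: mult.commute[of "R j"] mult.commute[of "L j"] times_divide_eq_right mult_1_right)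
  qed
  define Q where "Q = cinner E (\<Sum>x\<in>?X. l2_scaleC (\<Sum>m<n. k x m * u) (e x))"
  have "Q = (\<Sum>x\<in>?X. cnj (1 / of_nat n) * (\<Sum>m<n. k x m * u))"
    unfolding Q_def E_def by (rule orthonormal_cinner_sum_sum[OF ore fX])
  also have "\<dots> = (\<Sum>j<n. \<Sum>i<n. (R i * R j - 2 * (L i * L j)) / (of_nat n * of_nat n))"
    by (subst sum.cartesian_product') (intro sum.cong refl, simp add: ksum)
  also have "\<dots> = (s * s - 2 * (r * r)) / (of_nat n * of_nat n)"
    unfolding s_def r_def
    by (simp only: sum_divide_distrib[symmetric] sum_subtractf sum_distrib_left[symmetric] sum_distrib_right[symmetric])
  finally have Q: "Q = (s * s - 2 * (r * r)) / (of_nat n * of_nat n)" .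
  define \<sigma> where "\<sigma> = s / of_nat n"
  have sn: "s = \<sigma> * of_nat n" using n by (simp add: \<sigma>_def)
  have "r = (s - of_real (\<Lambda> * real n)) / 2"
    unfolding r_def L_def s_def R_def W_def using sum_masked_neg_unitary[OF n] n by (simp add: \<Lambda>(1))
  then have rn: "r = (\<sigma> - of_real \<Lambda>) / 2 * of_nat n" unfolding sn by (simp add: algebra_simps)
  have "Q = \<sigma> * \<sigma> - (\<sigma> - of_real \<Lambda>) * (\<sigma> - of_real \<Lambda>) / 2"
    unfolding Q sn rn using n by (simp add: field_simps)
  moreover have "cmod \<sigma> \<le> 1"
    using cmod_sum_neg_unitary_le[of n] n by (simp add: \<sigma>_def s_def R_def W_def norm_divide)
  then have "cmod (\<sigma> * \<sigma>) \<le> 1" by (simp add: norm_mult mult_le_one)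
  moreover have "(\<Lambda> - 1)\<^sup>2 \<le> cmod ((\<sigma> - of_real \<Lambda>) * (\<sigma> - of_real \<Lambda>))"
  proof -
    have "\<Lambda> \<le> cmod (of_real \<Lambda>)" by simp
    also have "\<dots> \<le> cmod \<sigma> + cmod (\<sigma> - of_real \<Lambda>)"
      using norm_triangle_ineq4[of \<sigma> "\<sigma> - of_real \<Lambda>"] by simp
    finally have "\<Lambda> - 1 \<le> cmod (\<sigma> - of_real \<Lambda>)" using \<open>cmod \<sigma> \<le> 1\<close> by linarith
    then have "(\<Lambda> - 1)\<^sup>2 \<le> (cmod (\<sigma> - of_real \<Lambda>))\<^sup>2" using \<Lambda>(2) by (intro power_mono) auto
    then show ?thesis by (simp add: norm_mult power2_eq_square)
  qed
  ultimately have Qge: "(\<Lambda> - 1)\<^sup>2 / 2 - 1 \<le> cmod Q"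
    using norm_triangle_ineq2[of "(\<sigma> - of_real \<Lambda>) * (\<sigma> - of_real \<Lambda>) / 2" "\<sigma> * \<sigma>"]
    by (simp add: norm_minus_commute norm_divide)
  have "cmod Q \<le> norm E * norm (\<Sum>x\<in>?X. l2_scaleC (\<Sum>m<n. k x m * u) (e x))"
    unfolding Q_def by (rule cmod_cinner_le)
  also have "\<dots> \<le> norm (kop K F) + 1"
    using Kf[rule_format, of "\<lambda>_. u"] nF nE
      norm_triangle_ineq4[of "kop K F" "kop K F - (\<Sum>x\<in>?X. l2_scaleC (\<Sum>m<n. k x m * u) (e x))"]
    by (simp add: F_def)
  finally have "(\<Lambda> - 1)\<^sup>2 / 2 - 2 \<le> norm (kop K F)" using Qge by linarith
  also have "\<dots> \<le> 2 * schatten_norm p (kop K)" by (rule norm_apply_le_schatten[OF K p nF])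
  also have "\<dots> \<le> 2 * (C * ((real n)\<^sup>2 * real n) powr (1 / (2 * p)))" using bK by simp
  finally show ?thesis .
qed

text \<open>The matrices have size polynomial in \<open>n\<close>, so for \<open>n\<close> exponential in \<open>p\<close> the Schatten norms of the two
  contractions are bounded, whereas \<open>\<Lambda>\<close> is of order \<open>ln n\<close>, that is of order \<open>p\<close>.\<close>

lemma bound_large_p:
  assumes p: "p \<ge> 2" and N: "N \<in> schur_extensions (2 * p) (2 * p) p dd2"
    and C: "C \<in> schatten_bilinear_bounds (2 * p) (2 * p) p N"
  shows "exp (-26) * p\<^sup>2 * (p / (p - 1)) \<le> C"
proof -
  \<comment> \<open>\<open>\<Lambda>\<close> is at least \<open>ln n / 4\<close>; the factor 16 makes this \<open>4 p\<close>, so that \<open>\<Lambda> - 1 \<ge> 3 p\<close>\<close>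
  define n where "n = nat \<lceil>exp (16 * p)\<rceil>"
  have n1: "exp (16 * p) \<le> real n" by (simp add: n_def real_nat_ceiling_ge)
  have "0 < exp (16 * p)" by simp
  then have n: "n > 0" using n1 by (metis less_le_trans of_nat_0_less_iff)
  have C0: "C \<ge> 0" using C by (simp add: schatten_bilinear_bounds_def)
  have n2: "real n \<le> exp (17 * p)"
  proof -
    have "real n \<le> exp (16 * p) + 1" using of_int_ceiling_le_add_one[of "exp (16 * p)"] by (simp add: n_def)
    also have "\<dots> \<le> exp (16 * p) * 2" using p by simp
    also have "\<dots> \<le> exp (16 * p) * exp p"
    proof (rule mult_left_mono)
      show "2 \<le> exp p" using p exp_ge_add_one_self[of p] by linarith
    qed simp
    also have "\<dots> = exp (17 * p)" by (simp flip: exp_add)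
    finally show ?thesis .
  qed
  define \<Lambda> where "\<Lambda> = (\<Sum>k<n. cmod (neg_eigenvalue n k)) / real n"
  have "4 * p \<le> ln (real n) / 4"
  proof -
    have "16 * p = ln (exp (16 * p))" by simp
    also have "\<dots> \<le> ln (real n)" using n1 n by (subst ln_le_cancel_iff) auto
    finally show ?thesis by simp
  qed
  also have "\<dots> \<le> ln (real n + 1) / 4" using n by simp
  also have "\<dots> \<le> harm n / 4" using ln_le_harm[of n] by simp
  also have "\<dots> = (\<Sum>k<n. 1 / (4 * real (Suc k)))"
    unfolding harm_def sum_divide_distrib
    by (rule sum.reindex_bij_witness[of _ Suc "\<lambda>k. k - 1"]) (auto simp: field_simps)
  also have "\<dots> \<le> (\<Sum>k<n. cmod (neg_eigenvalue n k) / real n)"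
  proof (rule sum_mono)
    fix k
    have "real n / (4 * real (Suc k)) / real n \<le> cmod (neg_eigenvalue n k) / real n"
      using neg_eigenvalue_bounds(1)[OF n, of k] by (rule divide_right_mono) simp
    moreover have "real n / (4 * real (Suc k)) / real n = 1 / (4 * real (Suc k))"
      using n by (simp del: of_nat_Suc)
    ultimately show "1 / (4 * real (Suc k)) \<le> cmod (neg_eigenvalue n k) / real n" by (simp only:)
  qed
  also have "\<dots> = \<Lambda>" by (simp add: \<Lambda>_def sum_divide_distrib)
  finally have L: "4 * p \<le> \<Lambda>" .
  then have L1: "\<Lambda> \<ge> 1" using p by linarith
  have "4 * p\<^sup>2 \<le> (\<Lambda> - 1)\<^sup>2 / 2 - 2"
  proof -
    have "(3 * p)\<^sup>2 \<le> (\<Lambda> - 1)\<^sup>2" using L p by (intro power_mono) auto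
    moreover have "2\<^sup>2 \<le> p\<^sup>2" using p by (intro power_mono) auto
    ultimately show ?thesis by (simp add: power_mult_distrib)
  qed
  also have "\<dots> \<le> 2 * (C * ((real n)\<^sup>2 * real n) powr (1 / (2 * p)))"
    by (rule schatten_ge_large_p[OF p N C n \<Lambda>_def L1])
  also have "\<dots> \<le> 2 * (C * exp 26)"
  proof -
    have "(real n)\<^sup>2 * real n \<le> (exp (17 * p))\<^sup>2 * exp (17 * p)"
      using n2 by (intro mult_mono power_mono) auto
    also have "\<dots> = exp (51 * p)" by (simp add: power2_eq_square flip: exp_add)
    finally have "((real n)\<^sup>2 * real n) powr (1 / (2 * p)) \<le> exp (51 * p) powr (1 / (2 * p))"
      using p by (intro powr_mono2) auto
    also have "\<dots> = exp (51 / 2)" using p by (simp add: powr_def)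
    also have "\<dots> \<le> exp 26" by simp
    finally show ?thesis using C0 by (intro mult_left_mono) auto
  qed
  finally have "2 * p\<^sup>2 \<le> C * exp 26" by simp
  then have 1: "2 * p\<^sup>2 * exp (-26) \<le> C" by (simp add: exp_minus field_simps)
  have "p / (p - 1) \<le> 2" using p by (simp add: divide_le_eq)
  then have "exp (-26) * p\<^sup>2 * (p / (p - 1)) \<le> exp (-26) * p\<^sup>2 * 2" by (intro mult_left_mono) auto
  then show ?thesis using 1 by (simp add: mult_ac)
qed

theorem theoremB:
  "\<exists>c::real. c > 0 \<and> (\<forall>p::real. 1 < p \<longrightarrow>
     schur_norm (2 * p) (2 * p) p
       (\<lambda>s\<^sub>0 s\<^sub>1 s\<^sub>2. complex_of_real (divdiff2 signed_square s\<^sub>0 s\<^sub>1 s\<^sub>2))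
     \<ge> ennreal (c * p\<^sup>2 * (p / (p - 1))))"
proof (intro exI[of _ "exp (-26) / 512"] conjI allI impI)
  show "exp (-26) / 512 > (0 :: real)" by simp
  fix p :: real assume p: "1 < p"
  have q: "0 \<le> p\<^sup>2 * (p / (p - 1))" using p by simp
  have key: "exp (-26) / 512 * p\<^sup>2 * (p / (p - 1)) \<le> C"
    if N: "N \<in> schur_extensions (2 * p) (2 * p) p dd2" and C: "C \<in> schatten_bilinear_bounds (2 * p) (2 * p) p N" for N C
  proof (cases "p \<le> 2")
    case True
    have "exp (-26) / 512 * (p\<^sup>2 * (p / (p - 1))) \<le> exp (-1) / 512 * (p\<^sup>2 * (p / (p - 1)))"
      by (rule mult_right_mono[OF _ q]) simp
    also have "\<dots> \<le> C" using bound_small_p[OF p True N C] by (simp only: mult.assoc)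
    finally show ?thesis by (simp only: mult.assoc)
  next
    case False
    have "exp (-26) / 512 * (p\<^sup>2 * (p / (p - 1))) \<le> exp (-26) * (p\<^sup>2 * (p / (p - 1)))"
      by (rule mult_right_mono[OF _ q]) simp
    also have "\<dots> \<le> C" using bound_large_p[OF _ N C] False by (simp add: mult.assoc)
    finally show ?thesis by (simp only: mult.assoc)
  qed
  show "ennreal (exp (-26) / 512 * p\<^sup>2 * (p / (p - 1))) \<le> schur_norm (2 * p) (2 * p) p dd2"
    unfolding schur_norm_def
  proof (rule INF_greatest)
    fix N assume N: "N \<in> schur_extensions (2 * p) (2 * p) p dd2"
    then have "schatten_bilinear_bounds (2 * p) (2 * p) p N \<noteq> {}" by (simp add: schur_extensions_def)
    then have "exp (-26) / 512 * p\<^sup>2 * (p / (p - 1)) \<le> Inf (schatten_bilinear_bounds (2 * p) (2 * p) p N)"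
      by (rule cInf_greatest) (rule key[OF N])
    then show "ennreal (exp (-26) / 512 * p\<^sup>2 * (p / (p - 1))) \<le> ennreal (Inf (schatten_bilinear_bounds (2 * p) (2 * p) p N))"
      by (rule ennreal_leI)
  qed
qed

end
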